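(* The proper (nonzero) additive tensor ideals of $\mathrm{Rep}(K_2)$ are in bijection with functions $f:\mathbb{C}P^1\to\mathbb{Z}_+\cup\{\infty\}$ via the map $\phi$, where $\phi(f)$ is the finite additive completion of $$\{M_k(0,\eta),\,M_k(1,\eta),\,P(0),\,P(1)\;:\;k\in\mathbb{Z}_+,\ \eta\in\mathbb{C}P^1,\ f(\eta)>k\}$$ (with $P(0)$ and $P(1)$ included for every $f$).
   Context: $K_2$ is the $8$-dimensional Hopf algebra over $\mathbb{C}$ generated by $K,\xi_1,\xi_2$ with $K^2=1$, $\xi_i^2=0$, $K\xi_i=-\xi_iK$, $\xi_1\xi_2=-\xi_2\xi_1$, and $\Delta(K)=K\otimes K$, $\Delta(\xi_i)=K\otimes\xi_i+\xi_i\otimes1$, $\epsilon(K)=1$, $\epsilon(\xi_i)=0$, $S(K)=K$, $S(\xi_i)=-K\xi_i$. $\mathrm{Rep}(K_2)$ is the tensor category of finite-dimensional left $K_2$-modules. $\mathbb{Z}_+$ is the set of positive integers; $\mathbb{C}P^1=\mathbb{C}\cup\{\infty\}$; $r\in\mathbb{Z}/2=\{0,1\}$. $V(r)$ is the one-dimensional module with $K$ acting by $(-1)^r$ and $\xi_i$ by $0$; $P(r)$ is its projective cover. $M_n(r,\eta)$ ($n\in\mathbb{Z}_+$, $\eta\in\mathbb{C}P^1$) is the $2n$-dimensional indecomposable module with basis $e_1,\dots,e_n,f_1,\dots,f_n$, with $Ke_i=(-1)^{r+1}e_i$, $Kf_i=(-1)^rf_i$, $\xi_1f_i=\xi_2f_i=0$,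 and (with $f_0=0$) $\xi_1e_i=f_i$, $\xi_2e_i=\eta f_i+f_{i-1}$ if $\eta\in\mathbb{C}$, while $\xi_1e_i=f_{i-1}$, $\xi_2e_i=f_i$ if $\eta=\infty$. Subcategories are full and closed under isomorphism. A tensor ideal of a finite tensor category $\mathcal{C}$ is a subcategory $\mathcal{I}$ such that $V\otimes X\in\mathcal{I}$ for all $V\in\mathcal{C}$, $X\in\mathcal{I}$, and such that $Y_1\oplus Y_2\in\mathcal{I}$ implies $Y_1,Y_2\in\mathcal{I}$. It is additive if it is closed under finite direct sums, and proper if it is not all of $\mathcal{C}$. The finite additive completion of a set $S$ of objects is the full subcategory of finite direct sums of elements of $S$ (up to isomorphism). *)

theory Defs
  imports "Jordan_Normal_Form.Jordan_Normal_Form" "HOL-Library.Extended_Nat"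
begin

subsection \<open>The Hopf algebra \<open>K\<^sub>2\<close>\<close>

text \<open>The index \<open>(a, b, c)\<close> stands for the basis monomial \<open>K^a \<xi>\<^sub>1^b \<xi>\<^sub>2^c\<close>
  (\<open>True\<close> is exponent 1), and an element of \<open>K\<^sub>2\<close> is its family of coefficients.
  Elements of \<open>K\<^sub>2 \<otimes> K\<^sub>2\<close> are coefficient families with respect to pairs of monomials.\<close>

type_synonym k2_index = "bool \<times> bool \<times> bool"
type_synonym k2 = "k2_index \<Rightarrow> complex"
type_synonym k2_sq = "k2_index \<times> k2_index \<Rightarrow> complex"

definition k2_add :: "k2 \<Rightarrow> k2 \<Rightarrow> k2" where
  "k2_add x y = (\<lambda>p. x p + y p)"

definition k2_scale :: "complex \<Rightarrow> k2 \<Rightarrow> k2" where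
  "k2_scale c x = (\<lambda>p. c * x p)"

definition k2_basis :: "k2_index \<Rightarrow> k2" where
  "k2_basis p = (\<lambda>q. if q = p then 1 else 0)"

definition k2_one :: k2 where "k2_one = k2_basis (False, False, False)"
definition k2_K :: k2 where "k2_K = k2_basis (True, False, False)"
definition k2_xi1 :: k2 where "k2_xi1 = k2_basis (False, True, False)"
definition k2_xi2 :: k2 where "k2_xi2 = k2_basis (False, False, True)"

text \<open>The product of two monomials is normalised by moving \<open>K^a'\<close> to the left past
  \<open>\<xi>\<^sub>1^b \<xi>\<^sub>2^c\<close>, and then \<open>\<xi>\<^sub>1^b'\<close> past \<open>\<xi>\<^sub>2^c\<close>.\<close>

fun k2_monom_mult :: "k2_index \<Rightarrow> k2_index \<Rightarrow> k2" where
  "k2_monom_mult (a, b, c) (a', b', c') =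
     (if (b \<and> b') \<or> (c \<and> c') then (\<lambda>_. 0)
      else k2_scale ((if a' \<and> b \<noteq> c then -1 else 1) * (if b' \<and> c then -1 else 1))
             (k2_basis (a \<noteq> a', b \<or> b', c \<or> c')))"

definition k2_mult :: "k2 \<Rightarrow> k2 \<Rightarrow> k2" where
  "k2_mult x y = (\<lambda>r. \<Sum>p\<in>UNIV. \<Sum>q\<in>UNIV. x p * y q * k2_monom_mult p q r)"

definition k2_tensor :: "k2 \<Rightarrow> k2 \<Rightarrow> k2_sq" where
  "k2_tensor x y = (\<lambda>(p, q). x p * y q)"

text \<open>The ordinary (unsigned) product \<open>(x \<otimes> y)(x' \<otimes> y') = xx' \<otimes> yy'\<close>.\<close>

definition k2_sq_mult :: "k2_sq \<Rightarrow> k2_sq \<Rightarrow> k2_sq" where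
  "k2_sq_mult s t = (\<lambda>r. \<Sum>(p, q)\<in>UNIV. \<Sum>(p', q')\<in>UNIV.
     s (p, q) * t (p', q') * k2_tensor (k2_monom_mult p p') (k2_monom_mult q q') r)"

definition comult_K :: k2_sq where
  "comult_K = k2_tensor k2_K k2_K"

definition comult_xi :: "k2 \<Rightarrow> k2_sq" where
  "comult_xi x = (\<lambda>r. k2_tensor k2_K x r + k2_tensor x k2_one r)"

fun comult_monom :: "k2_index \<Rightarrow> k2_sq" where
  "comult_monom (a, b, c) =
     k2_sq_mult (if a then comult_K else k2_tensor k2_one k2_one)
       (k2_sq_mult (if b then comult_xi k2_xi1 else k2_tensor k2_one k2_one)
                   (if c then comult_xi k2_xi2 else k2_tensor k2_one k2_one))"

definition comult :: "k2 \<Rightarrow> k2_sq" where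
  "comult x = (\<lambda>r. \<Sum>p\<in>UNIV. x p * comult_monom p r)"

text \<open>The counit and the antipode (an algebra antihomomorphism) do not enter the notion of a
  tensor ideal; they complete the Hopf algebra structure.\<close>

definition counit :: "k2 \<Rightarrow> complex" where
  "counit x = x (False, False, False) + x (True, False, False)"

fun antipode_monom :: "k2_index \<Rightarrow> k2" where
  "antipode_monom (a, b, c) =
     k2_mult (if c then k2_scale (-1) (k2_mult k2_K k2_xi2) else k2_one)
       (k2_mult (if b then k2_scale (-1) (k2_mult k2_K k2_xi1) else k2_one)
                (if a then k2_K else k2_one))"

definition antipode :: "k2 \<Rightarrow> k2" where
  "antipode x = (\<lambda>r. \<Sum>p\<in>UNIV. x p * antipode_monom p r)"

lemma sum_UNIV_prod:
  fixes g :: "'a::finite \<times> 'b::finite \<Rightarrow> 'c::comm_monoid_add"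
  shows "(\<Sum>p\<in>UNIV. g p) = (\<Sum>a\<in>UNIV. \<Sum>b\<in>UNIV. g (a, b))"
  by (simp add: sum.cartesian_product UNIV_Times_UNIV[symmetric] del: UNIV_Times_UNIV)

lemmas k2_eval = k2_mult_def k2_scale_def k2_basis_def
  k2_one_def k2_K_def k2_xi1_def k2_xi2_def sum_UNIV_prod UNIV_bool

lemma k2_relations:
  "k2_mult k2_K k2_K = k2_one"
  "k2_mult k2_xi1 k2_xi1 = (\<lambda>_. 0)"
  "k2_mult k2_xi2 k2_xi2 = (\<lambda>_. 0)"
  "k2_mult k2_K k2_xi1 = k2_scale (-1) (k2_mult k2_xi1 k2_K)"
  "k2_mult k2_K k2_xi2 = k2_scale (-1) (k2_mult k2_xi2 k2_K)"
  "k2_mult k2_xi1 k2_xi2 = k2_scale (-1) (k2_mult k2_xi2 k2_xi1)"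
  by (auto simp: fun_eq_iff k2_eval)

lemma k2_basis_generators:
  "k2_basis (a, b, c) =
     k2_mult (if a then k2_K else k2_one)
       (k2_mult (if b then k2_xi1 else k2_one) (if c then k2_xi2 else k2_one))"
  by (cases a; cases b; cases c) (auto simp: fun_eq_iff k2_eval)

lemma k2_mult_one: "k2_mult k2_one x = x" "k2_mult x k2_one = x"
  by (auto simp: fun_eq_iff k2_eval)

lemma k2_monom_assoc:
  "(\<Sum>s\<in>UNIV. k2_monom_mult p q s * k2_monom_mult s r t) =
   (\<Sum>s\<in>UNIV. k2_monom_mult q r s * k2_monom_mult p s t)"
proof -
  have delta: "(\<Sum>s\<in>UNIV. k2_scale c (k2_basis u) s * g s) = c * g u"
    for c u and g :: "k2_index \<Rightarrow> complex"
  proof -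
    have "(\<Sum>s\<in>UNIV. k2_scale c (k2_basis u) s * g s) = (\<Sum>s\<in>UNIV. if s = u then c * g u else 0)"
      by (rule sum.cong) (auto simp: k2_scale_def k2_basis_def)
    then show ?thesis by simp
  qed
  obtain a b c a' b' c' a'' b'' c'' where
    eqs: "p = (a, b, c)" "q = (a', b', c')" "r = (a'', b'', c'')"
    by (metis prod_cases3)
  show ?thesis
    unfolding eqs
    by (cases a''; cases b; cases c; cases b'; cases c')
       (simp_all add: delta, auto simp: k2_scale_def k2_basis_def)
qed

lemma k2_mult_assoc: "k2_mult (k2_mult x y) z = k2_mult x (k2_mult y z)"
proof
  fix t
  let ?U = "UNIV :: k2_index set"
  have rearrange: "(\<Sum>s\<in>?U. \<Sum>r\<in>?U. \<Sum>p\<in>?U. \<Sum>q\<in>?U. F s r p q) =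
      (\<Sum>p\<in>?U. \<Sum>q\<in>?U. \<Sum>r\<in>?U. \<Sum>s\<in>?U. F s r p q)"
    for F :: "k2_index \<Rightarrow> k2_index \<Rightarrow> k2_index \<Rightarrow> k2_index \<Rightarrow> complex"
  proof -
    have "(\<Sum>s\<in>?U. \<Sum>r\<in>?U. \<Sum>p\<in>?U. \<Sum>q\<in>?U. F s r p q) =
        (\<Sum>s\<in>?U. \<Sum>p\<in>?U. \<Sum>r\<in>?U. \<Sum>q\<in>?U. F s r p q)"
      by (intro sum.cong refl sum.swap)
    also have "\<dots> = (\<Sum>p\<in>?U. \<Sum>s\<in>?U. \<Sum>r\<in>?U. \<Sum>q\<in>?U. F s r p q)"
      by (rule sum.swap)
    also have "\<dots> = (\<Sum>p\<in>?U. \<Sum>s\<in>?U. \<Sum>q\<in>?U. \<Sum>r\<in>?U. F s r p q)"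
      by (intro sum.cong refl sum.swap)
    also have "\<dots> = (\<Sum>p\<in>?U. \<Sum>q\<in>?U. \<Sum>s\<in>?U. \<Sum>r\<in>?U. F s r p q)"
      by (intro sum.cong refl sum.swap)
    also have "\<dots> = (\<Sum>p\<in>?U. \<Sum>q\<in>?U. \<Sum>r\<in>?U. \<Sum>s\<in>?U. F s r p q)"
      by (intro sum.cong refl sum.swap)
    finally show ?thesis .
  qed
  have "k2_mult (k2_mult x y) z t =
      (\<Sum>s\<in>?U. \<Sum>r\<in>?U. \<Sum>p\<in>?U. \<Sum>q\<in>?U.
         x p * y q * z r * (k2_monom_mult p q s * k2_monom_mult s r t))"
    unfolding k2_mult_def sum_distrib_right
    by (intro sum.cong refl) (simp add: mult_ac)
  also have "\<dots> = (\<Sum>p\<in>?U. \<Sum>q\<in>?U. \<Sum>r\<in>?U. \<Sum>s\<in>?U.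
         x p * y q * z r * (k2_monom_mult p q s * k2_monom_mult s r t))"
    by (rule rearrange)
  also have "\<dots> = (\<Sum>p\<in>?U. \<Sum>q\<in>?U. \<Sum>r\<in>?U. \<Sum>s\<in>?U.
         x p * y q * z r * (k2_monom_mult q r s * k2_monom_mult p s t))"
    by (simp only: sum_distrib_left[symmetric] k2_monom_assoc)
  also have "\<dots> = (\<Sum>p\<in>?U. \<Sum>s\<in>?U. \<Sum>q\<in>?U. \<Sum>r\<in>?U.
         x p * y q * z r * (k2_monom_mult q r s * k2_monom_mult p s t))"
  proof (rule sum.cong[OF refl])
    fix p
    let ?G = "\<lambda>q r s. x p * y q * z r * (k2_monom_mult q r s * k2_monom_mult p s t)"
    have "(\<Sum>q\<in>?U. \<Sum>r\<in>?U. \<Sum>s\<in>?U. ?G q r s) = (\<Sum>q\<in>?U. \<Sum>s\<in>?U. \<Sum>r\<in>?U. ?G q r s)"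
      by (intro sum.cong refl sum.swap)
    also have "\<dots> = (\<Sum>s\<in>?U. \<Sum>q\<in>?U. \<Sum>r\<in>?U. ?G q r s)"
      by (rule sum.swap)
    finally show "(\<Sum>q\<in>?U. \<Sum>r\<in>?U. \<Sum>s\<in>?U. ?G q r s) = (\<Sum>s\<in>?U. \<Sum>q\<in>?U. \<Sum>r\<in>?U. ?G q r s)" .
  qed
  also have "\<dots> = k2_mult x (k2_mult y z) t"
    unfolding k2_mult_def sum_distrib_right sum_distrib_left
    by (intro sum.cong refl) (simp add: mult_ac)
  finally show "k2_mult (k2_mult x y) z t = k2_mult x (k2_mult y z) t" .
qed


subsection \<open>The category \<open>Rep(K\<^sub>2)\<close>\<close>

text \<open>A finite-dimensional left \<open>K\<^sub>2\<close>-module is given by an action on some \<open>\<complex>\<^sup>n\<close>, that is, by a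
  unital algebra homomorphism from \<open>K\<^sub>2\<close> to the complex \<open>n \<times> n\<close> matrices; here \<open>n = 0\<close> is
  allowed. Choosing bases, every finite-dimensional module is isomorphic to one of this form.\<close>

datatype k2_module = K2_Module (vdim: nat) (act: "k2 \<Rightarrow> complex mat")

definition Rep :: "k2_module set" where
  "Rep = {M. (\<forall>x. act M x \<in> carrier_mat (vdim M) (vdim M)) \<and>
     (\<forall>x y. act M (k2_add x y) = act M x + act M y) \<and>
     (\<forall>c x. act M (k2_scale c x) = c \<cdot>\<^sub>m act M x) \<and>
     act M k2_one = 1\<^sub>m (vdim M) \<and>
     (\<forall>x y. act M (k2_mult x y) = act M x * act M y)}"

definition Hom :: "k2_module \<Rightarrow> k2_module \<Rightarrow> complex mat set" where
  "Hom M N = {T \<in> carrier_mat (vdim N) (vdim M). \<forall>x. T * act M x = act N x * T}"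

definition module_iso :: "k2_module \<Rightarrow> k2_module \<Rightarrow> bool" where
  "module_iso M N \<longleftrightarrow> (\<exists>S\<in>Hom M N. \<exists>T\<in>Hom N M. S * T = 1\<^sub>m (vdim N) \<and> T * S = 1\<^sub>m (vdim M))"

definition surjective :: "complex mat \<Rightarrow> bool" where
  "surjective T \<longleftrightarrow> (\<forall>v\<in>carrier_vec (dim_row T). \<exists>u\<in>carrier_vec (dim_col T). T *\<^sub>v u = v)"

definition mat_lincomb :: "nat \<Rightarrow> ('i::finite \<Rightarrow> complex) \<Rightarrow> ('i \<Rightarrow> complex mat) \<Rightarrow> complex mat" where
  "mat_lincomb n c A = mat n n (\<lambda>ij. \<Sum>i\<in>UNIV. c i * A i $$ ij)"

text \<open>The Kronecker product, with respect to the lexicographically ordered basis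
  \<open>v\<^sub>i \<otimes> w\<^sub>j\<close>.\<close>

definition kronecker :: "complex mat \<Rightarrow> complex mat \<Rightarrow> complex mat" where
  "kronecker A B = mat (dim_row A * dim_row B) (dim_col A * dim_col B)
     (\<lambda>(i, j). A $$ (i div dim_row B, j div dim_col B) * B $$ (i mod dim_row B, j mod dim_col B))"

definition tensor_module :: "k2_module \<Rightarrow> k2_module \<Rightarrow> k2_module" where
  "tensor_module V X = K2_Module (vdim V * vdim X)
     (\<lambda>x. mat_lincomb (vdim V * vdim X) (comult x)
       (\<lambda>(p, q). kronecker (act V (k2_basis p)) (act X (k2_basis q))))"

definition direct_sum :: "k2_module list \<Rightarrow> k2_module" where
  "direct_sum Ms = K2_Module (sum_list (map vdim Ms)) (\<lambda>x. diag_block_mat (map (\<lambda>M. act M x) Ms))"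

subsection \<open>The modules \<open>V(r)\<close>, \<open>P(r)\<close> and \<open>M\<^sub>n(r, \<eta>)\<close>\<close>

text \<open>The module in which \<open>K, \<xi>\<^sub>1, \<xi>\<^sub>2\<close> act by the \<open>n \<times> n\<close> matrices \<open>A, B, C\<close>, provided
  that these satisfy the defining relations.\<close>

definition generator_module ::
  "nat \<Rightarrow> complex mat \<Rightarrow> complex mat \<Rightarrow> complex mat \<Rightarrow> k2_module" where
  "generator_module n A B C = K2_Module n
     (\<lambda>x. mat_lincomb n x (\<lambda>(a, b, c).
        (if a then A else 1\<^sub>m n) * ((if b then B else 1\<^sub>m n) * (if c then C else 1\<^sub>m n))))"

definition simple_V :: "nat \<Rightarrow> k2_module" where
  "simple_V r = generator_module 1 ((-1)^r \<cdot>\<^sub>m 1\<^sub>m 1) (0\<^sub>m 1 1) (0\<^sub>m 1 1)"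

definition projective :: "k2_module \<Rightarrow> bool" where
  "projective P \<longleftrightarrow> P \<in> Rep \<and>
     (\<forall>M\<in>Rep. \<forall>N\<in>Rep. \<forall>g\<in>Hom M N. \<forall>h\<in>Hom P N. surjective g \<longrightarrow> (\<exists>k\<in>Hom P M. g * k = h))"

definition essential_epi :: "k2_module \<Rightarrow> k2_module \<Rightarrow> complex mat \<Rightarrow> bool" where
  "essential_epi P V p \<longleftrightarrow> p \<in> Hom P V \<and> surjective p \<and>
     (\<forall>N\<in>Rep. \<forall>h\<in>Hom N P. surjective (p * h) \<longrightarrow> surjective h)"

text \<open>Projective covers are unique up to isomorphism only; any \<open>P\<close> with this property serves
  as \<open>P(r)\<close> when \<open>V = V(r)\<close>.\<close>

definition projective_cover :: "k2_module \<Rightarrow> k2_module \<Rightarrow> bool" where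
  "projective_cover P V \<longleftrightarrow> projective P \<and> (\<exists>p. essential_epi P V p)"

datatype cp1 = Finite_Point complex | Infinite_Point

text \<open>With respect to the ordered basis \<open>e\<^sub>1, \<dots>, e\<^sub>n, f\<^sub>1, \<dots>, f\<^sub>n\<close>; the matrix
  \<open>jordan_block n \<eta>\<close> sends the \<open>i\<close>-th unit vector to \<open>\<eta>\<close> times itself plus the
  \<open>(i - 1)\<close>-st one.\<close>

definition e_to_f :: "nat \<Rightarrow> complex mat \<Rightarrow> complex mat" where
  "e_to_f n A = four_block_mat (0\<^sub>m n n) (0\<^sub>m n n) A (0\<^sub>m n n)"

definition M_K :: "nat \<Rightarrow> nat \<Rightarrow> complex mat" where
  "M_K n r = four_block_mat ((-1)^(r + 1) \<cdot>\<^sub>m 1\<^sub>m n) (0\<^sub>m n n) (0\<^sub>m n n) ((-1)^r \<cdot>\<^sub>m 1\<^sub>m n)"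

fun module_M :: "nat \<Rightarrow> nat \<Rightarrow> cp1 \<Rightarrow> k2_module" where
  "module_M n r (Finite_Point \<eta>) =
     generator_module (2 * n) (M_K n r) (e_to_f n (1\<^sub>m n)) (e_to_f n (jordan_block n \<eta>))"
| "module_M n r Infinite_Point =
     generator_module (2 * n) (M_K n r) (e_to_f n (jordan_block n 0)) (e_to_f n (1\<^sub>m n))"

subsection \<open>Tensor ideals\<close>

text \<open>A full subcategory is given by its set of objects.\<close>

definition subcategory :: "k2_module set \<Rightarrow> bool" where
  "subcategory I \<longleftrightarrow> I \<subseteq> Rep \<and> (\<forall>X\<in>I. \<forall>Y\<in>Rep. module_iso X Y \<longrightarrow> Y \<in> I)"

definition tensor_ideal :: "k2_module set \<Rightarrow> bool" where
  "tensor_ideal I \<longleftrightarrow> subcategory I \<and>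
     (\<forall>V\<in>Rep. \<forall>X\<in>I. tensor_module V X \<in> I) \<and>
     (\<forall>Y1\<in>Rep. \<forall>Y2\<in>Rep. direct_sum [Y1, Y2] \<in> I \<longrightarrow> Y1 \<in> I \<and> Y2 \<in> I)"

definition additive_ideal :: "k2_module set \<Rightarrow> bool" where
  "additive_ideal I \<longleftrightarrow> (\<forall>Xs. set Xs \<subseteq> I \<longrightarrow> direct_sum Xs \<in> I)"

definition proper :: "k2_module set \<Rightarrow> bool" where
  "proper I \<longleftrightarrow> I \<noteq> Rep"

definition nonzero :: "k2_module set \<Rightarrow> bool" where
  "nonzero I \<longleftrightarrow> (\<exists>X\<in>I. vdim X \<noteq> 0)"

definition additive_completion :: "k2_module set \<Rightarrow> k2_module set" where
  "additive_completion S = {Y \<in> Rep. \<exists>Xs. set Xs \<subseteq> S \<and> module_iso Y (direct_sum Xs)}"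

definition phi :: "(cp1 \<Rightarrow> enat) \<Rightarrow> k2_module set" where
  "phi f = additive_completion
     ({module_M k r \<eta> | k r \<eta>. 1 \<le> k \<and> r \<in> {0, 1} \<and> enat k < f \<eta>} \<union>
      {P. \<exists>r\<in>{0, 1}. projective_cover P (simple_V r)})"

end

theory Submission
  imports "Jordan_Normal_Form.Jordan_Normal_Form_Existence" Defs
begin

text \<open>Write \<open>\<xi>(t)\<close> for \<open>\<xi>\<^sub>2 - (\<eta> + t) \<xi>\<^sub>1\<close> at a finite point \<open>\<eta>\<close>, and for \<open>\<xi>\<^sub>1 - t \<xi>\<^sub>2\<close> at infinity; it squares to \<open>0\<close>.
  Call a module \<^emph>\<open>null of order \<open>n\<close>\<close> at \<open>\<eta>\<close> if there is a polynomial matrix \<open>h(t)\<close> with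
  \<open>\<xi>(t) h(t) + h(t) \<xi>(t) = t\<^sup>n\<close> modulo \<open>t\<^bsup>n+1\<^esup>\<close>, that is, if the \<open>n\<close>-th power of the cohomology class
  attached to \<open>\<eta>\<close> annihilates it stably. This passes to retracts, direct sums and all tensor products, and
  \<open>M\<^sub>k(r, \<eta>)\<close> is null of order \<open>n\<close> at \<open>\<eta>\<close> iff \<open>k \<le> n\<close>, and of order \<open>0\<close> at all other points. So \<open>\<phi>(f)\<close>
  consists of the modules that are null of some order below \<open>f(\<eta>)\<close> at every \<open>\<eta>\<close>.

  For this one needs that a module is a direct sum of modules \<open>M\<^sub>k(r, \<eta>)\<close> and \<open>P(r)\<close> unless it has an
  endomorphism \<open>\<theta>\<close> with \<open>tr(K \<theta>) \<noteq> 0\<close>. Null modules have no such endomorphism. Neither have the objects \<open>X\<close> of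
  a proper ideal, because \<open>\<theta>\<close> would make the unit object a retract of \<open>X\<^sup>* \<otimes> X\<close>. The indecomposable modules
  that are not projective are pencils \<open>E \<rightarrow> F\<close>; a non-square pencil has nonzero supertrace, a singular square
  pencil has a minimal polynomial kernel vector from which an endomorphism is built, and a
  regular pencil is given by a Jordan block.

  Finally, an ideal containing \<open>M\<^sub>k(r, \<eta>)\<close> contains \<open>M\<^sub>j(0, \<eta>) \<otimes> M\<^sub>k(r, \<eta>)\<close> for \<open>j \<le> k\<close>, which is null at \<open>\<eta>\<close> of
  order \<open>j\<close> but not \<open>j - 1\<close> and hence has a summand \<open>M\<^sub>j(s, \<eta>)\<close>.\<close>

text \<open>The order at \<eta> is a pole order. On M_k(r, \<eta>) the family \<xi>(t) becomes N - t
  with N a nilpotent Jordan block of size k, and t^n (N - t)^(-1) is polynomial exactly when n \<ge>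
  k; for n < k a truncated left kernel of N - t obstructs every homotopy. Homotopies survive
  tensoring since \<xi>(t) acts on V \<otimes> X as K \<otimes> \<xi>(t) + \<xi>(t) \<otimes> 1 and
  K anticommutes with \<xi>(t).

  The trace has to be tr(K \<theta>) because the square of the antipode is conjugation by K: the
  invariant vector of X^* \<otimes> X made from \<theta> carries a factor K, and evaluation turns it
  into this supertrace. A homotopy kills the same number, since anticommutators with \<xi>(t) have
  supertrace 0 against every endomorphism. This common obstruction spares the full Kronecker
  classification of pencils: only regular square ones need a normal form, and for the others one
  endomorphism \<theta> is enough.\<close>

subsection \<open>Matrix algebra with dimension side conditions\<close>

(* as a simp rule, carrier_matD loops with carrier_dim *)
declare carrier_matD [simp del]

lemma carrier_dim: "(A \<in> carrier_mat n m) = (dim_row A = n \<and> dim_col A = m)"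
  by (simp add: carrier_mat_def)

lemma mat_assoc:
  "dim_col A = dim_row B \<Longrightarrow> dim_col B = dim_row C \<Longrightarrow> A * B * C = A * (B * (C :: 'a::comm_ring_1 mat))"
  by (rule assoc_mult_mat[of _ "dim_row A" "dim_row B" _ "dim_row C" _ "dim_col C"]) (simp_all add: carrier_dim)

lemma mat_distrib:
  fixes A B C :: "'a::comm_ring_1 mat"
  shows "dim_row A = dim_row B \<Longrightarrow> dim_col A = dim_col B \<Longrightarrow> dim_col B = dim_row C \<Longrightarrow>
      (A + B) * C = A * C + B * C"
    and "dim_row B = dim_row C \<Longrightarrow> dim_col B = dim_col C \<Longrightarrow> dim_col A = dim_row B \<Longrightarrow>
      A * (B + C) = A * B + A * C"
  subgoal by (rule add_mult_distrib_mat[of _ "dim_row A" "dim_col A" _ _ "dim_col C"]) (simp_all add: carrier_dim)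
  subgoal by (rule mult_add_distrib_mat[of _ "dim_row A" "dim_col A" _ "dim_col B"]) (simp_all add: carrier_dim)
  done

lemma mat_smult_mult:
  fixes A B :: "'a::comm_ring_1 mat"
  shows "dim_col A = dim_row B \<Longrightarrow> (c \<cdot>\<^sub>m A) * B = c \<cdot>\<^sub>m (A * B)"
    and "dim_col A = dim_row B \<Longrightarrow> A * (c \<cdot>\<^sub>m B) = c \<cdot>\<^sub>m (A * B)"
  subgoal by (rule mult_smult_assoc_mat[of _ "dim_row A" "dim_row B" _ "dim_col B"]) (simp_all add: carrier_dim)
  subgoal by (rule mult_smult_distrib[of _ "dim_row A" "dim_row B" _ "dim_col B"]) (simp_all add: carrier_dim)
  done

lemma mat_one_zero:
  fixes A :: "'a::comm_ring_1 mat"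
  shows "dim_row A = n \<Longrightarrow> 1\<^sub>m n * A = A" "dim_col A = n \<Longrightarrow> A * 1\<^sub>m n = A"
    and "dim_row A = m \<Longrightarrow> 0\<^sub>m n m * A = 0\<^sub>m n (dim_col A)"
    and "dim_col A = m \<Longrightarrow> A * 0\<^sub>m m n = 0\<^sub>m (dim_row A) n"
    and "dim_row A = n \<Longrightarrow> dim_col A = m \<Longrightarrow> A + 0\<^sub>m n m = A"
    and "dim_row A = n \<Longrightarrow> dim_col A = m \<Longrightarrow> 0\<^sub>m n m + A = A"
    and "c \<cdot>\<^sub>m 0\<^sub>m n m = (0\<^sub>m n m :: 'a mat)"
    and "c \<cdot>\<^sub>m (d \<cdot>\<^sub>m A) = (c * d) \<cdot>\<^sub>m A"
    and "(1::'a) \<cdot>\<^sub>m A = A"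
    and "(0::'a) \<cdot>\<^sub>m A = 0\<^sub>m (dim_row A) (dim_col A)"
    and "dim_row A = dim_row B \<Longrightarrow> dim_col A = dim_col B \<Longrightarrow> c \<cdot>\<^sub>m (A + B) = c \<cdot>\<^sub>m A + c \<cdot>\<^sub>m B"
    and "dim_row A = dim_row B \<Longrightarrow> dim_col A = dim_col B \<Longrightarrow> A - B = A + (-1) \<cdot>\<^sub>m B"
  subgoal by (metis carrier_matI left_mult_one_mat)
  subgoal by (metis carrier_matI right_mult_one_mat)
  subgoal by (rule eq_matI) (auto simp: scalar_prod_def)
  subgoal by (rule eq_matI) (auto simp: scalar_prod_def)
  by (auto intro!: eq_matI simp: algebra_simps)

text \<open>Normal form: sums of scalar multiples of right-nested products. All side conditions are
  equations between dimensions, so that simp can discharge them.\<close>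

lemmas mat_ring = mat_assoc mat_distrib mat_smult_mult mat_one_zero

subsection \<open>Modules given by generators\<close>

definition relations :: "nat \<Rightarrow> complex mat \<Rightarrow> complex mat \<Rightarrow> complex mat \<Rightarrow> bool" where
  "relations n A B C \<longleftrightarrow> dim_row A = n \<and> dim_col A = n \<and> dim_row B = n \<and> dim_col B = n \<and>
     dim_row C = n \<and> dim_col C = n \<and> A * A = 1\<^sub>m n \<and> B * B = 0\<^sub>m n n \<and> C * C = 0\<^sub>m n n \<and>
     A * B = (-1) \<cdot>\<^sub>m (B * A) \<and> A * C = (-1) \<cdot>\<^sub>m (C * A) \<and> B * C = (-1) \<cdot>\<^sub>m (C * B)"

lemma relations_dims:
  assumes "relations n A B C"
  shows "dim_row A = n" "dim_col A = n" "dim_row B = n" "dim_col B = n" "dim_row C = n" "dim_col C = n"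
  using assms by (auto simp: relations_def)

text \<open>Oriented for rewriting: \<open>C\<close> moves to the right past \<open>B\<close>, and
  \<open>A\<close> to the right past both. The versions with a trailing \<open>X\<close> apply
  inside longer right-nested products.\<close>

lemma relations_rules:
  assumes "relations n A B C"
  shows "A * A = 1\<^sub>m n" "B * B = 0\<^sub>m n n" "C * C = 0\<^sub>m n n"
    "A * B = (-1) \<cdot>\<^sub>m (B * A)" "A * C = (-1) \<cdot>\<^sub>m (C * A)" "C * B = (-1) \<cdot>\<^sub>m (B * C)"
    "dim_row X = n \<Longrightarrow> A * (A * X) = X"
    "dim_row X = n \<Longrightarrow> B * (B * X) = 0\<^sub>m n (dim_col X)"
    "dim_row X = n \<Longrightarrow> C * (C * X) = 0\<^sub>m n (dim_col X)"
    "dim_row X = n \<Longrightarrow> A * (B * X) = (-1) \<cdot>\<^sub>m (B * (A * X))"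
    "dim_row X = n \<Longrightarrow> A * (C * X) = (-1) \<cdot>\<^sub>m (C * (A * X))"
    "dim_row X = n \<Longrightarrow> C * (B * X) = (-1) \<cdot>\<^sub>m (B * (C * X))"
proof -
  note d [simp] = relations_dims[OF assms]
  have r: "A * A = 1\<^sub>m n" "B * B = 0\<^sub>m n n" "C * C = 0\<^sub>m n n"
    "A * B = (-1) \<cdot>\<^sub>m (B * A)" "A * C = (-1) \<cdot>\<^sub>m (C * A)" and BC: "B * C = (-1) \<cdot>\<^sub>m (C * B)"
    using assms by (auto simp: relations_def)
  have CB: "C * B = (-1) \<cdot>\<^sub>m (B * C)"
    unfolding BC by (simp add: mat_ring)
  show "A * A = 1\<^sub>m n" "B * B = 0\<^sub>m n n" "C * C = 0\<^sub>m n n"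
    "A * B = (-1) \<cdot>\<^sub>m (B * A)" "A * C = (-1) \<cdot>\<^sub>m (C * A)" "C * B = (-1) \<cdot>\<^sub>m (B * C)"
    by fact+
  assume X: "dim_row X = n"
  have step: "U * (V * X) = (U * V) * X" if "dim_col U = n" "dim_row V = n" "dim_col V = n" for U V
    using that X by (simp add: mat_assoc)
  show "A * (A * X) = X" "B * (B * X) = 0\<^sub>m n (dim_col X)" "C * (C * X) = 0\<^sub>m n (dim_col X)"
    "A * (B * X) = (-1) \<cdot>\<^sub>m (B * (A * X))" "A * (C * X) = (-1) \<cdot>\<^sub>m (C * (A * X))"
    "C * (B * X) = (-1) \<cdot>\<^sub>m (B * (C * X))"
    using X by (simp_all add: step r CB) (simp_all add: mat_ring)
qed

lemma mat_lincomb_dim [simp]: "dim_row (mat_lincomb n x W) = n" "dim_col (mat_lincomb n x W) = n"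
  by (simp_all add: mat_lincomb_def)

lemma mat_lincomb_index [simp]:
  "i < n \<Longrightarrow> j < n \<Longrightarrow> mat_lincomb n x W $$ (i, j) = (\<Sum>p\<in>UNIV. x p * W p $$ (i, j))"
  by (simp add: mat_lincomb_def)

lemma mat_lincomb_mult:
  fixes W :: "'a::finite \<Rightarrow> complex mat" and V :: "'b::finite \<Rightarrow> complex mat"
  assumes [simp]: "\<And>p. dim_row (W p) = n" "\<And>p. dim_col (W p) = n" "\<And>p. dim_row (V p) = n" "\<And>p. dim_col (V p) = n"
  shows "mat_lincomb n x W * mat_lincomb n y V =
    mat_lincomb n (\<lambda>(p, q). x p * y q) (\<lambda>(p, q). W p * V q)"
proof (rule eq_matI)
  fix i j
  assume "i < dim_row (mat_lincomb n (\<lambda>(p, q). x p * y q) (\<lambda>(p, q). W p * V q))"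
    "j < dim_col (mat_lincomb n (\<lambda>(p, q). x p * y q) (\<lambda>(p, q). W p * V q))"
  then have ij [simp]: "i < n" "j < n" by simp_all
  have "(mat_lincomb n x W * mat_lincomb n y V) $$ (i, j) =
      (\<Sum>k<n. \<Sum>p\<in>UNIV. \<Sum>q\<in>UNIV. x p * W p $$ (i, k) * (y q * V q $$ (k, j)))"
    by (simp add: scalar_prod_def sum_product lessThan_atLeast0)
  also have "\<dots> = (\<Sum>p\<in>UNIV. \<Sum>q\<in>UNIV. \<Sum>k<n. x p * W p $$ (i, k) * (y q * V q $$ (k, j)))"
    by (subst sum.swap, intro sum.cong refl, rule sum.swap)
  also have "\<dots> = (\<Sum>p\<in>UNIV. \<Sum>q\<in>UNIV. x p * y q * (W p * V q) $$ (i, j))"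
    by (intro sum.cong refl) (simp add: scalar_prod_def sum_distrib_left lessThan_atLeast0 mult_ac)
  also have "\<dots> = mat_lincomb n (\<lambda>(p, q). x p * y q) (\<lambda>(p, q). W p * V q) $$ (i, j)"
    by (simp add: sum_UNIV_prod)
  finally show "(mat_lincomb n x W * mat_lincomb n y V) $$ (i, j) =
      mat_lincomb n (\<lambda>(p, q). x p * y q) (\<lambda>(p, q). W p * V q) $$ (i, j)" .
qed simp_all

lemma mat_lincomb_compose:
  "mat_lincomb n (\<lambda>r. \<Sum>s\<in>UNIV. c s * d s r) W = mat_lincomb n c (\<lambda>s. mat_lincomb n (d s) W)"
proof (rule eq_matI)
  fix i j
  assume "i < dim_row (mat_lincomb n c (\<lambda>s. mat_lincomb n (d s) W))"
    "j < dim_col (mat_lincomb n c (\<lambda>s. mat_lincomb n (d s) W))"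
  then have ij [simp]: "i < n" "j < n" by simp_all
  have "(\<Sum>r\<in>UNIV. (\<Sum>s\<in>UNIV. c s * d s r) * W r $$ (i, j)) =
      (\<Sum>r\<in>UNIV. \<Sum>s\<in>UNIV. c s * (d s r * W r $$ (i, j)))"
    by (simp add: sum_distrib_right mult.assoc)
  also have "\<dots> = (\<Sum>s\<in>UNIV. c s * (\<Sum>r\<in>UNIV. d s r * W r $$ (i, j)))"
    by (subst sum.swap) (simp add: sum_distrib_left)
  finally show "mat_lincomb n (\<lambda>r. \<Sum>s\<in>UNIV. c s * d s r) W $$ (i, j) =
      mat_lincomb n c (\<lambda>s. mat_lincomb n (d s) W) $$ (i, j)" by simp
qed simp_all

lemma mat_lincomb_unit:
  fixes W :: "'a::finite \<Rightarrow> complex mat"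
  assumes "dim_row (W u) = n" "dim_col (W u) = n"
  shows "mat_lincomb n (\<lambda>q. if q = u then c else 0) W = c \<cdot>\<^sub>m W u"
proof (rule eq_matI)
  fix i j assume "i < dim_row (c \<cdot>\<^sub>m W u)" "j < dim_col (c \<cdot>\<^sub>m W u)"
  then have ij [simp]: "i < n" "j < n" using assms by simp_all
  have "(\<Sum>p\<in>UNIV. (if p = u then c else 0) * W p $$ (i, j)) = (\<Sum>p\<in>UNIV. if p = u then c * W u $$ (i, j) else 0)"
    by (rule sum.cong) auto
  then show "mat_lincomb n (\<lambda>q. if q = u then c else 0) W $$ (i, j) = (c \<cdot>\<^sub>m W u) $$ (i, j)"
    using assms by simp
qed (use assms in simp_all)

lemma mat_lincomb_cong: "(\<And>p. x p = y p) \<Longrightarrow> (\<And>p. W p = V p) \<Longrightarrow> mat_lincomb n x W = mat_lincomb n y V"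
  by (simp add: mat_lincomb_def)

definition monomial :: "nat \<Rightarrow> complex mat \<Rightarrow> complex mat \<Rightarrow> complex mat \<Rightarrow> k2_index \<Rightarrow> complex mat" where
  "monomial n A B C = (\<lambda>(a, b, c).
     (if a then A else 1\<^sub>m n) * ((if b then B else 1\<^sub>m n) * (if c then C else 1\<^sub>m n)))"

lemma generator_module_monomial:
  "generator_module n A B C = K2_Module n (\<lambda>x. mat_lincomb n x (monomial n A B C))"
  by (simp add: generator_module_def monomial_def)

lemma monomial_dim:
  assumes "relations n A B C"
  shows "dim_row (monomial n A B C p) = n" "dim_col (monomial n A B C p) = n"
  using relations_dims[OF assms] by (auto simp: monomial_def split: prod.split)

lemma mat_lincomb_scale_basis:
  assumes "dim_row (W u) = n" "dim_col (W u) = n"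
  shows "mat_lincomb n (k2_scale c (k2_basis u)) W = c \<cdot>\<^sub>m W u"
    and "mat_lincomb n (k2_basis u) W = W u"
  using mat_lincomb_unit[of W u n c, OF assms] mat_lincomb_unit[of W u n 1, OF assms]
  by (simp_all add: k2_scale_def k2_basis_def mat_ring if_distrib[of "\<lambda>x. _ * x"] cong: if_cong)

lemma mat_lincomb_zero: "mat_lincomb n (\<lambda>_. 0) W = 0\<^sub>m n n"
  by (rule eq_matI) simp_all

text \<open>Checked on all 64 pairs of basis monomials; bilinearity then makes the action of
  \<open>generator_module\<close> multiplicative.\<close>

lemma monomial_mult:
  assumes "relations n A B C"
  shows "monomial n A B C p * monomial n A B C q =
    mat_lincomb n (k2_monom_mult p q) (monomial n A B C)"
proof -
  note d [simp] = relations_dims[OF assms] monomial_dim[OF assms]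
  obtain a b c a' b' c' where eqs: "p = (a, b, c)" "q = (a', b', c')"
    by (metis prod_cases3)
  show ?thesis
    unfolding eqs
    by (cases a; cases b; cases c; cases a'; cases b'; cases c')
      (simp_all add: mat_lincomb_zero mat_lincomb_scale_basis monomial_def
        relations_rules[OF assms] mat_ring)
qed

lemma generator_module_Rep:
  assumes "relations n A B C"
  shows "generator_module n A B C \<in> Rep"
proof -
  note d [simp] = relations_dims[OF assms] monomial_dim[OF assms]
  let ?W = "monomial n A B C"
  have "mat_lincomb n (k2_mult x y) ?W = mat_lincomb n x ?W * mat_lincomb n y ?W" for x y
  proof -
    have "k2_mult x y = (\<lambda>r. \<Sum>s\<in>UNIV. (case s of (p, q) \<Rightarrow> x p * y q) * (case s of (p, q) \<Rightarrow> k2_monom_mult p q) r)"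
      by (subst sum_UNIV_prod) (simp add: k2_mult_def fun_eq_iff)
    then have "mat_lincomb n (k2_mult x y) ?W =
        mat_lincomb n (\<lambda>(p, q). x p * y q) (\<lambda>s. mat_lincomb n (case s of (p, q) \<Rightarrow> k2_monom_mult p q) ?W)"
      by (simp add: mat_lincomb_compose)
    also have "\<dots> = mat_lincomb n (\<lambda>(p, q). x p * y q) (\<lambda>(p, q). ?W p * ?W q)"
      by (rule mat_lincomb_cong) (auto simp: monomial_mult[OF assms])
    also have "\<dots> = mat_lincomb n x ?W * mat_lincomb n y ?W"
      by (rule mat_lincomb_mult[symmetric]) simp_all
    finally show ?thesis .
  qed
  moreover have "mat_lincomb n (k2_add x y) ?W = mat_lincomb n x ?W + mat_lincomb n y ?W" for x y
    by (rule eq_matI) (simp_all add: k2_add_def sum.distrib algebra_simps)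
  moreover have "mat_lincomb n (k2_scale c x) ?W = c \<cdot>\<^sub>m mat_lincomb n x ?W" for c x
    by (rule eq_matI) (simp_all add: k2_scale_def sum_distrib_left algebra_simps)
  moreover have "mat_lincomb n k2_one ?W = 1\<^sub>m n"
    by (simp add: k2_one_def mat_lincomb_scale_basis) (simp add: monomial_def mat_ring)
  ultimately show ?thesis
    by (simp add: Rep_def generator_module_monomial carrier_dim)
qed

abbreviation "opK M \<equiv> act M k2_K"
abbreviation "op1 M \<equiv> act M k2_xi1"
abbreviation "op2 M \<equiv> act M k2_xi2"

lemma vdim_generator_module [simp]: "vdim (generator_module n A B C) = n"
  by (simp add: generator_module_def)

lemma op_generator_module:
  assumes "relations n A B C"
  shows "opK (generator_module n A B C) = A" "op1 (generator_module n A B C) = B"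
    "op2 (generator_module n A B C) = C"
  unfolding generator_module_monomial k2_K_def k2_xi1_def k2_xi2_def
  using relations_dims[OF assms] monomial_dim[OF assms]
  by (simp_all add: mat_lincomb_scale_basis) (simp_all add: monomial_def mat_ring)

lemma Rep_act:
  assumes "M \<in> Rep"
  shows "dim_row (act M x) = vdim M" "dim_col (act M x) = vdim M"
    "act M (k2_add x y) = act M x + act M y" "act M (k2_scale c x) = c \<cdot>\<^sub>m act M x"
    "act M k2_one = 1\<^sub>m (vdim M)" "act M (k2_mult x y) = act M x * act M y"
  using assms by (auto simp: Rep_def carrier_dim)

lemma Rep_relations:
  assumes M: "M \<in> Rep"
  shows "relations (vdim M) (opK M) (op1 M) (op2 M)"
proof -
  note r = Rep_act[OF M]
  have z: "act M (\<lambda>_. 0) = 0\<^sub>m (vdim M) (vdim M)"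
    using r(4)[of 0 "k2_one"] r(5) by (simp add: k2_scale_def mat_ring)
  show ?thesis
    unfolding relations_def r(6)[symmetric] k2_relations r(4)[symmetric]
    by (simp add: r(1,2,5) z)
qed

text \<open>\<open>Rep\<close> provides additivity for two summands only, so the element is
  assembled one basis coefficient at a time.\<close>

lemma Rep_lincomb:
  assumes M: "M \<in> Rep"
  shows "act M x = mat_lincomb (vdim M) x (\<lambda>p. act M (k2_basis p))"
proof -
  note r = Rep_act[OF M]
  have z: "act M (\<lambda>_. 0) = 0\<^sub>m (vdim M) (vdim M)"
    using r(4)[of 0 "k2_one"] r(5) by (simp add: k2_scale_def mat_ring)
  have "act M (\<lambda>q. if q \<in> S then x q else 0) =
      mat (vdim M) (vdim M) (\<lambda>ij. \<Sum>p\<in>S. x p * act M (k2_basis p) $$ ij)" if "finite S" for S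
    using that
  proof (induction S)
    case empty
    show ?case by (simp add: z) (rule eq_matI, simp_all)
  next
    case (insert u S)
    have eq: "(\<lambda>q. if q \<in> insert u S then x q else 0) =
        k2_add (k2_scale (x u) (k2_basis u)) (\<lambda>q. if q \<in> S then x q else 0)"
      using insert.hyps by (auto simp: k2_add_def k2_scale_def k2_basis_def fun_eq_iff)
    show ?case
      unfolding eq r(3,4) insert.IH
      using insert.hyps by (intro eq_matI) (simp_all add: r(1,2))
  qed
  from this[of UNIV] show ?thesis by (simp add: mat_lincomb_def)
qed

lemma Rep_basis:
  assumes M: "M \<in> Rep"
  shows "act M (k2_basis p) = monomial (vdim M) (opK M) (op1 M) (op2 M) p"
proof -
  obtain a b c where p: "p = (a, b, c)" by (metis prod_cases3)
  show ?thesis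
    unfolding p k2_basis_generators Rep_act(6)[OF M]
    by (simp add: monomial_def Rep_act(5)[OF M])
qed

text \<open>A module is literally equal to the one rebuilt from its three matrices, because
  \<open>act M\<close> is determined by them. Two modules can thus be proved equal, not just
  isomorphic, by comparing three matrices.\<close>

lemma Rep_generator_module:
  assumes M: "M \<in> Rep"
  shows "generator_module (vdim M) (opK M) (op1 M) (op2 M) = M"
  unfolding generator_module_monomial
proof -
  have "act M = (\<lambda>x. mat_lincomb (vdim M) x (monomial (vdim M) (opK M) (op1 M) (op2 M)))"
    by (rule ext, subst Rep_lincomb[OF M]) (simp add: Rep_basis[OF M])
  then show "K2_Module (vdim M) (\<lambda>x. mat_lincomb (vdim M) x (monomial (vdim M) (opK M) (op1 M) (op2 M))) = M"
    by (metis k2_module.collapse)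
qed

lemma Rep_eqI:
  assumes "M \<in> Rep" "N \<in> Rep" "vdim M = vdim N" "opK M = opK N" "op1 M = op1 N" "op2 M = op2 N"
  shows "M = N"
  using Rep_generator_module[OF assms(1)] Rep_generator_module[OF assms(2)] assms(3-) by metis

text \<open>The elements that \<open>T\<close> intertwines are closed under products and linear
  combinations, so the three generators suffice.\<close>

lemma HomI:
  assumes M: "M \<in> Rep" and N: "N \<in> Rep" and "dim_row T = vdim N" "dim_col T = vdim M"
    and "T * opK M = opK N * T" "T * op1 M = op1 N * T" "T * op2 M = op2 N * T"
  shows "T \<in> Hom M N"
proof -
  note [simp] = assms(3,4) Rep_act(1,2)[OF M] Rep_act(1,2)[OF N]
  have e: "T * (X * Y) = X' * (Y' * T)" if "T * X = X' * T" "T * Y = Y' * T"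
    "dim_row X = vdim M" "dim_col X = vdim M" "dim_row X' = vdim N" "dim_col X' = vdim N"
    "dim_row Y = vdim M" "dim_row Y' = vdim N" "dim_col Y' = vdim N" for X Y X' Y'
  proof -
    have "T * (X * Y) = (T * X) * Y" using that(3-) by (simp add: mat_assoc)
    also have "\<dots> = X' * (T * Y)" unfolding that(1) using that(3-) by (simp add: mat_assoc)
    finally show ?thesis unfolding that(2) .
  qed
  have basis: "T * act M (k2_basis p) = act N (k2_basis p) * T" for p
  proof -
    obtain a b c where p: "p = (a, b, c)" by (metis prod_cases3)
    have one: "T * 1\<^sub>m (vdim M) = 1\<^sub>m (vdim N) * T" by (simp add: mat_ring)
    have f: "T * (if a then act M x else 1\<^sub>m (vdim M)) = (if a then act N x else 1\<^sub>m (vdim N)) * T"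
      if "T * act M x = act N x * T" for a x using that one by simp
    have "T * ((if a then opK M else 1\<^sub>m (vdim M)) * ((if b then op1 M else 1\<^sub>m (vdim M)) * (if c then op2 M else 1\<^sub>m (vdim M)))) =
      (if a then opK N else 1\<^sub>m (vdim N)) * (((if b then op1 N else 1\<^sub>m (vdim N)) * (if c then op2 N else 1\<^sub>m (vdim N))) * T)"
      by (rule e[OF f[OF assms(5)]], subst e[OF f[OF assms(6)] f[OF assms(7)]]) (auto simp: mat_assoc)
    then show ?thesis
      unfolding Rep_basis[OF M] Rep_basis[OF N] p monomial_def by (simp add: mat_assoc)
  qed
  have "T * act M x = act N x * T" for x
  proof (rule eq_matI)
    fix i j assume "i < dim_row (act N x * T)" "j < dim_col (act N x * T)"
    then have ij [simp]: "i < vdim N" "j < vdim M" by simp_all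
    have "(T * act M x) $$ (i, j) = (\<Sum>k<vdim M. \<Sum>p\<in>UNIV. T $$ (i, k) * (x p * act M (k2_basis p) $$ (k, j)))"
      by (subst Rep_lincomb[OF M]) (simp add: scalar_prod_def sum_distrib_left lessThan_atLeast0)
    also have "\<dots> = (\<Sum>p\<in>UNIV. \<Sum>k<vdim M. T $$ (i, k) * (x p * act M (k2_basis p) $$ (k, j)))"
      by (rule sum.swap)
    also have "\<dots> = (\<Sum>p\<in>UNIV. x p * (T * act M (k2_basis p)) $$ (i, j))"
      by (simp add: scalar_prod_def sum_distrib_left lessThan_atLeast0 mult_ac)
    also have "\<dots> = (\<Sum>p\<in>UNIV. x p * (act N (k2_basis p) * T) $$ (i, j))"
      by (simp only: basis)
    also have "\<dots> = (\<Sum>p\<in>UNIV. \<Sum>k<vdim N. x p * act N (k2_basis p) $$ (i, k) * T $$ (k, j))"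
      by (simp add: scalar_prod_def sum_distrib_left lessThan_atLeast0 mult_ac)
    also have "\<dots> = (\<Sum>k<vdim N. \<Sum>p\<in>UNIV. x p * act N (k2_basis p) $$ (i, k) * T $$ (k, j))"
      by (rule sum.swap)
    also have "\<dots> = (act N x * T) $$ (i, j)"
      by (subst Rep_lincomb[OF N]) (simp add: scalar_prod_def sum_distrib_right lessThan_atLeast0)
    finally show "(T * act M x) $$ (i, j) = (act N x * T) $$ (i, j)" .
  qed simp_all
  then show ?thesis by (simp add: Hom_def carrier_dim)
qed

lemma HomD:
  assumes "T \<in> Hom M N"
  shows "dim_row T = vdim N" "dim_col T = vdim M" "T * act M x = act N x * T"
  using assms by (auto simp: Hom_def carrier_dim)

lemma Hom_comp:
  assumes "M \<in> Rep" "N \<in> Rep" "L \<in> Rep" "S \<in> Hom N L" "T \<in> Hom M N"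
  shows "S * T \<in> Hom M L"
proof -
  note [simp] = HomD(1,2)[OF assms(4)] HomD(1,2)[OF assms(5)] Rep_act(1,2)[OF assms(1)] Rep_act(1,2)[OF assms(2)] Rep_act(1,2)[OF assms(3)]
  have "S * T * act M x = act L x * (S * T)" for x
  proof -
    have "S * T * act M x = S * (T * act M x)" by (simp add: mat_assoc)
    also have "\<dots> = (S * act N x) * T" unfolding HomD(3)[OF assms(5)] by (simp add: mat_assoc)
    finally show ?thesis unfolding HomD(3)[OF assms(4)] by (simp add: mat_assoc)
  qed
  then show ?thesis by (simp add: Hom_def carrier_dim)
qed

lemma Hom_one: "M \<in> Rep \<Longrightarrow> 1\<^sub>m (vdim M) \<in> Hom M M"
  using Rep_act(1,2)[of M] by (auto simp: Hom_def mat_ring)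

subsection \<open>Tensor products\<close>

lemma sum_div_mod:
  fixes f :: "nat \<Rightarrow> nat \<Rightarrow> 'a::comm_monoid_add"
  shows "(\<Sum>k<n * m. f (k div m) (k mod m)) = (\<Sum>a<n. \<Sum>b<m. f a b)"
proof -
  have "(\<Sum>k<n * m. f (k div m) (k mod m)) = (\<Sum>a<n. \<Sum>k\<in>{a * m..<a * m + m}. f (k div m) (k mod m))"
    by (rule sum.nat_group[symmetric])
  also have "\<dots> = (\<Sum>a<n. \<Sum>b<m. f a b)"
  proof (rule sum.cong[OF refl])
    fix a
    have "(\<Sum>k\<in>{a * m..<a * m + m}. f (k div m) (k mod m)) = (\<Sum>b\<in>{0..<m}. f ((b + a * m) div m) ((b + a * m) mod m))"
      using sum.shift_bounds_nat_ivl[of "\<lambda>k. f (k div m) (k mod m)" 0 "a * m" m] by (simp add: add.commute)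
    also have "\<dots> = (\<Sum>b<m. f a b)"
      by (rule sum.cong) auto
    finally show "(\<Sum>k\<in>{a * m..<a * m + m}. f (k div m) (k mod m)) = (\<Sum>b<m. f a b)" .
  qed
  finally show ?thesis .
qed

lemma div_mod_less:
  assumes "i < n * (m :: nat)"
  shows "i div m < n" "i mod m < m"
proof -
  have "m > 0" using assms by (cases m) auto
  then show "i div m < n" "i mod m < m" using assms by (auto simp: less_mult_imp_div_less)
qed

lemma kronecker_dim [simp]:
  "dim_row (kronecker A B) = dim_row A * dim_row B" "dim_col (kronecker A B) = dim_col A * dim_col B"
  by (simp_all add: kronecker_def)

lemma kronecker_index [simp]:
  "i < dim_row A * dim_row B \<Longrightarrow> j < dim_col A * dim_col B \<Longrightarrow> kronecker A B $$ (i, j) =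
    A $$ (i div dim_row B, j div dim_col B) * B $$ (i mod dim_row B, j mod dim_col B)"
  by (simp add: kronecker_def)

lemma kronecker_mult:
  assumes [simp]: "dim_col A = dim_row C" "dim_col B = dim_row D"
  shows "kronecker A B * kronecker C D = kronecker (A * C) (B * D)"
proof (rule eq_matI)
  fix i j assume "i < dim_row (kronecker (A * C) (B * D))" "j < dim_col (kronecker (A * C) (B * D))"
  then have ij: "i < dim_row A * dim_row B" "j < dim_col C * dim_col D" by simp_all
  note [simp] = ij div_mod_less[OF ij(1)] div_mod_less[OF ij(2)]
  have "(kronecker A B * kronecker C D) $$ (i, j) =
    (\<Sum>k<dim_row C * dim_row D. (\<lambda>a b. A $$ (i div dim_row B, a) * B $$ (i mod dim_row B, b) *
       (C $$ (a, j div dim_col D) * D $$ (b, j mod dim_col D))) (k div dim_row D) (k mod dim_row D))"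
    by (simp add: scalar_prod_def lessThan_atLeast0)
  also have "\<dots> = (\<Sum>a<dim_row C. \<Sum>b<dim_row D. A $$ (i div dim_row B, a) * B $$ (i mod dim_row B, b) *
       (C $$ (a, j div dim_col D) * D $$ (b, j mod dim_col D)))"
    by (rule sum_div_mod)
  also have "\<dots> = (A * C) $$ (i div dim_row B, j div dim_col D) * (B * D) $$ (i mod dim_row B, j mod dim_col D)"
    by (simp add: scalar_prod_def lessThan_atLeast0 sum_product mult_ac)
  finally show "(kronecker A B * kronecker C D) $$ (i, j) = kronecker (A * C) (B * D) $$ (i, j)" by simp
qed simp_all

lemma kronecker_linear:
  "dim_row A = dim_row A' \<Longrightarrow> dim_col A = dim_col A' \<Longrightarrow> kronecker (A + A') B = kronecker A B + kronecker A' B"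
  "dim_row B = dim_row B' \<Longrightarrow> dim_col B = dim_col B' \<Longrightarrow> kronecker A (B + B') = kronecker A B + kronecker A B'"
  "kronecker (c \<cdot>\<^sub>m A) B = c \<cdot>\<^sub>m kronecker A B"
  "kronecker A (c \<cdot>\<^sub>m B) = c \<cdot>\<^sub>m kronecker A B"
  "kronecker (0\<^sub>m n m) B = 0\<^sub>m (n * dim_row B) (m * dim_col B)"
  "kronecker A (0\<^sub>m n m) = 0\<^sub>m (dim_row A * n) (dim_col A * m)"
  by (rule eq_matI; auto simp: div_mod_less algebra_simps)+

lemma kronecker_one:
  "kronecker (1\<^sub>m n) (1\<^sub>m m) = 1\<^sub>m (n * m)" "kronecker A (1\<^sub>m (Suc 0)) = A" "kronecker (1\<^sub>m (Suc 0)) B = B"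
  subgoal
  proof (rule eq_matI)
    fix i j assume "i < dim_row (1\<^sub>m (n * m) :: complex mat)" "j < dim_col (1\<^sub>m (n * m) :: complex mat)"
    then show "kronecker (1\<^sub>m n) (1\<^sub>m m) $$ (i, j) = 1\<^sub>m (n * m) $$ (i, j)"
      using div_mod_less[of i n m] div_mod_less[of j n m] by simp (metis div_mult_mod_eq)
  qed simp_all
  subgoal by (rule eq_matI) auto
  subgoal by (rule eq_matI) auto
  done

lemma mat_lincomb_tensor:
  assumes "V \<in> Rep" "X \<in> Rep"
  shows "mat_lincomb (vdim V * vdim X) (k2_tensor x y)
      (\<lambda>(p, q). kronecker (act V (k2_basis p)) (act X (k2_basis q))) = kronecker (act V x) (act X y)"
proof (rule eq_matI)
  note [simp] = Rep_act(1,2)[OF assms(1)] Rep_act(1,2)[OF assms(2)]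
  fix i j assume "i < dim_row (kronecker (act V x) (act X y))" "j < dim_col (kronecker (act V x) (act X y))"
  then have ij: "i < vdim V * vdim X" "j < vdim V * vdim X" by simp_all
  note [simp] = ij div_mod_less[OF ij(1)] div_mod_less[OF ij(2)]
  show "mat_lincomb (vdim V * vdim X) (k2_tensor x y)
      (\<lambda>(p, q). kronecker (act V (k2_basis p)) (act X (k2_basis q))) $$ (i, j) = kronecker (act V x) (act X y) $$ (i, j)"
    by (subst Rep_lincomb[OF assms(1), of x], subst Rep_lincomb[OF assms(2), of y])
      (simp add: sum_product k2_tensor_def sum_UNIV_prod[where 'a = k2_index and 'b = k2_index] mult_ac)
qed (simp_all add: Rep_act[OF assms(1)] Rep_act[OF assms(2)])

text \<open>Matrices attached to elements of the tensor square multiply like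
  \<open>k2_sq_mult\<close> (fact \<open>mult\<close>). As \<open>comult\<close> is defined
  multiplicatively on monomials, each monomial acts by the product of the matrices of the coproducts
  of K, xi_1 and xi_2, without computing any coefficient of a coproduct.\<close>

lemma tensor_module_generators:
  assumes V: "V \<in> Rep" and X: "X \<in> Rep"
  shows "tensor_module V X = generator_module (vdim V * vdim X) (kronecker (opK V) (opK X))
      (kronecker (opK V) (op1 X) + kronecker (op1 V) (1\<^sub>m (vdim X)))
      (kronecker (opK V) (op2 X) + kronecker (op2 V) (1\<^sub>m (vdim X)))" (is "_ = generator_module ?n ?A ?B ?C")
    and "relations (vdim V * vdim X) (kronecker (opK V) (opK X))
      (kronecker (opK V) (op1 X) + kronecker (op1 V) (1\<^sub>m (vdim X)))
      (kronecker (opK V) (op2 X) + kronecker (op2 V) (1\<^sub>m (vdim X)))"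
proof -
  note [simp] = Rep_act(1,2)[OF V] Rep_act(1,2)[OF X]
  define W where "W = (\<lambda>(p, q). kronecker (act V (k2_basis p)) (act X (k2_basis q)))"
  have Wd [simp]: "dim_row (W p) = ?n" "dim_col (W p) = ?n" for p
    by (auto simp: W_def split: prod.split)
  note tensor = mat_lincomb_tensor[OF V X, folded W_def]
  have mult: "mat_lincomb ?n (k2_sq_mult s t) W = mat_lincomb ?n s W * mat_lincomb ?n t W" for s t
  proof -
    have "k2_sq_mult s t = (\<lambda>r. \<Sum>u\<in>UNIV. (case u of (u1, u2) \<Rightarrow> s u1 * t u2) *
        (case u of ((p, q), (p', q')) \<Rightarrow> k2_tensor (k2_monom_mult p p') (k2_monom_mult q q')) r)"
      unfolding k2_sq_mult_def
      by (subst sum_UNIV_prod[where 'a = "k2_index \<times> k2_index" and 'b = "k2_index \<times> k2_index"])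
        (simp add: fun_eq_iff case_prod_unfold)
    then have "mat_lincomb ?n (k2_sq_mult s t) W = mat_lincomb ?n (\<lambda>(u1, u2). s u1 * t u2)
        (\<lambda>u. mat_lincomb ?n (case u of ((p, q), (p', q')) \<Rightarrow> k2_tensor (k2_monom_mult p p') (k2_monom_mult q q')) W)"
      by (simp add: mat_lincomb_compose)
    also have "\<dots> = mat_lincomb ?n (\<lambda>(u1, u2). s u1 * t u2) (\<lambda>(u1, u2). W u1 * W u2)"
    proof (rule mat_lincomb_cong[OF refl])
      fix u :: "(k2_index \<times> k2_index) \<times> (k2_index \<times> k2_index)"
      obtain p q p' q' where u: "u = ((p, q), (p', q'))" by (metis surj_pair)
      have m: "act M (k2_monom_mult p p') = act M (k2_basis p) * act M (k2_basis p')" if "M \<in> Rep" for M p p'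
        using monomial_mult[OF Rep_relations[OF that], of p p'] Rep_lincomb[OF that, of "k2_monom_mult p p'"]
        by (simp add: Rep_basis[OF that])
      show "mat_lincomb ?n (case u of ((p, q), (p', q')) \<Rightarrow> k2_tensor (k2_monom_mult p p') (k2_monom_mult q q')) W =
          (case u of (u1, u2) \<Rightarrow> W u1 * W u2)"
        by (simp add: u tensor m[OF V] m[OF X]) (simp add: W_def kronecker_mult)
    qed
    also have "\<dots> = mat_lincomb ?n s W * mat_lincomb ?n t W"
      by (rule mat_lincomb_mult[symmetric]) simp_all
    finally show ?thesis .
  qed
  have add: "mat_lincomb ?n (\<lambda>r. s r + t r) W = mat_lincomb ?n s W + mat_lincomb ?n t W" for s t
    by (rule eq_matI) (simp_all add: sum.distrib algebra_simps)
  have one: "mat_lincomb ?n (k2_tensor k2_one k2_one) W = 1\<^sub>m ?n"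
    by (simp add: tensor Rep_act[OF V] Rep_act[OF X] kronecker_one)
  have K: "mat_lincomb ?n comult_K W = ?A"
    by (simp add: comult_K_def tensor)
  have xi: "mat_lincomb ?n (comult_xi x) W = kronecker (opK V) (act X x) + kronecker (act V x) (1\<^sub>m (vdim X))" for x
    by (simp add: comult_xi_def add tensor Rep_act[OF X])
  have "mat_lincomb ?n (comult x) W = mat_lincomb ?n x (monomial ?n ?A ?B ?C)" for x
    unfolding comult_def mat_lincomb_compose
    by (rule mat_lincomb_cong[OF refl])
      (auto simp: monomial_def mult K xi one split: prod.split)
  then show "tensor_module V X = generator_module ?n ?A ?B ?C"
    by (simp add: tensor_module_def generator_module_monomial W_def)
  show "relations ?n ?A ?B ?C"
    unfolding relations_def
    by (simp add: mat_ring kronecker_mult kronecker_linear kronecker_one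
        relations_rules[OF Rep_relations[OF V]] relations_rules[OF Rep_relations[OF X]])
      (auto intro!: eq_matI simp: kronecker_linear mat_ring simp del: kronecker_index)
qed

lemma tensor_module:
  assumes V: "V \<in> Rep" and X: "X \<in> Rep"
  shows "tensor_module V X \<in> Rep" "vdim (tensor_module V X) = vdim V * vdim X"
    "opK (tensor_module V X) = kronecker (opK V) (opK X)"
    "op1 (tensor_module V X) = kronecker (opK V) (op1 X) + kronecker (op1 V) (1\<^sub>m (vdim X))"
    "op2 (tensor_module V X) = kronecker (opK V) (op2 X) + kronecker (op2 V) (1\<^sub>m (vdim X))"
  unfolding tensor_module_generators(1)[OF assms]
  using tensor_module_generators(2)[OF assms]
  by (simp_all add: op_generator_module generator_module_Rep)

subsection \<open>Direct sums and retracts\<close>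

text \<open>Inclusions and projections stand in for block matrices: a block computation becomes
  rewriting with \<open>mat_ring\<close> and the biproduct identities \<open>in_pr\<close>.\<close>

definition in1 :: "nat \<Rightarrow> nat \<Rightarrow> complex mat" where
  "in1 a b = mat (a + b) a (\<lambda>(i, j). if i = j then 1 else 0)"
definition in2 :: "nat \<Rightarrow> nat \<Rightarrow> complex mat" where
  "in2 a b = mat (a + b) b (\<lambda>(i, j). if i = a + j then 1 else 0)"
definition pr1 :: "nat \<Rightarrow> nat \<Rightarrow> complex mat" where
  "pr1 a b = mat a (a + b) (\<lambda>(i, j). if i = j then 1 else 0)"
definition pr2 :: "nat \<Rightarrow> nat \<Rightarrow> complex mat" where
  "pr2 a b = mat b (a + b) (\<lambda>(i, j). if a + i = j then 1 else 0)"

lemma in_pr_dim [simp]: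
  "dim_row (in1 a b) = a + b" "dim_col (in1 a b) = a" "dim_row (in2 a b) = a + b" "dim_col (in2 a b) = b"
  "dim_row (pr1 a b) = a" "dim_col (pr1 a b) = a + b" "dim_row (pr2 a b) = b" "dim_col (pr2 a b) = a + b"
  by (simp_all add: in1_def in2_def pr1_def pr2_def)

lemma in_mult_index:
  "dim_row A = a \<Longrightarrow> i < a + b \<Longrightarrow> j < dim_col A \<Longrightarrow> (in1 a b * A) $$ (i, j) = (if i < a then A $$ (i, j) else 0)"
  "dim_row A = b \<Longrightarrow> i < a + b \<Longrightarrow> j < dim_col A \<Longrightarrow> (in2 a b * A) $$ (i, j) = (if i < a then 0 else A $$ (i - a, j))"
  "dim_row A = a + b \<Longrightarrow> i < a \<Longrightarrow> j < dim_col A \<Longrightarrow> (pr1 a b * A) $$ (i, j) = A $$ (i, j)"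
  "dim_row A = a + b \<Longrightarrow> i < b \<Longrightarrow> j < dim_col A \<Longrightarrow> (pr2 a b * A) $$ (i, j) = A $$ (a + i, j)"
proof -
  have *: "(\<Sum>k = 0..<n. (if c = k then 1 else 0) * f k) = (if c < n then f c else 0)"
    for c n and f :: "nat \<Rightarrow> complex"
    by (simp add: if_distrib[of "\<lambda>x. x * _"] cong: if_cong)
  show "dim_row A = a \<Longrightarrow> i < a + b \<Longrightarrow> j < dim_col A \<Longrightarrow> (in1 a b * A) $$ (i, j) = (if i < a then A $$ (i, j) else 0)"
    by (simp add: in1_def scalar_prod_def *)
  show "(in2 a b * A) $$ (i, j) = (if i < a then 0 else A $$ (i - a, j))"
    if "dim_row A = b" "i < a + b" "j < dim_col A"
  proof (cases "i < a")
    case False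
    then have "(i = a + k) = (i - a = k)" for k by auto
    then show ?thesis using that False by (simp add: in2_def scalar_prod_def * less_diff_conv2)
  qed (use that in \<open>simp add: in2_def scalar_prod_def\<close>)
  show "dim_row A = a + b \<Longrightarrow> i < a \<Longrightarrow> j < dim_col A \<Longrightarrow> (pr1 a b * A) $$ (i, j) = A $$ (i, j)"
    by (simp add: pr1_def scalar_prod_def *)
  show "dim_row A = a + b \<Longrightarrow> i < b \<Longrightarrow> j < dim_col A \<Longrightarrow> (pr2 a b * A) $$ (i, j) = A $$ (a + i, j)"
    by (simp add: pr2_def scalar_prod_def *)
qed

lemma in_pr_eqs:
  "pr1 a b * in1 a b = 1\<^sub>m a" "pr2 a b * in2 a b = 1\<^sub>m b"
  "pr1 a b * in2 a b = 0\<^sub>m a b" "pr2 a b * in1 a b = 0\<^sub>m b a"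
  "in1 a b * pr1 a b + in2 a b * pr2 a b = 1\<^sub>m (a + b)"
  by (rule eq_matI; simp add: in_mult_index del: index_mult_mat(1); auto simp: in1_def in2_def pr1_def pr2_def)+

lemma mat_assoc_eq:
  fixes A B C X :: "'a::comm_ring_1 mat"
  assumes "A * B = C" "dim_col A = dim_row B"
  shows "dim_row X = dim_col B \<Longrightarrow> A * (B * X) = C * X"
  using assms by (simp add: mat_assoc[symmetric])

lemma in_pr:
  "pr1 a b * in1 a b = 1\<^sub>m a" "pr2 a b * in2 a b = 1\<^sub>m b"
  "pr1 a b * in2 a b = 0\<^sub>m a b" "pr2 a b * in1 a b = 0\<^sub>m b a"
  "dim_row X = a \<Longrightarrow> pr1 a b * (in1 a b * X) = X" "dim_row X = b \<Longrightarrow> pr2 a b * (in2 a b * X) = X"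
  "dim_row X = b \<Longrightarrow> pr1 a b * (in2 a b * X) = 0\<^sub>m a (dim_col X)"
  "dim_row X = a \<Longrightarrow> pr2 a b * (in1 a b * X) = 0\<^sub>m b (dim_col X)"
  by (simp_all add: in_pr_eqs mat_assoc_eq[OF in_pr_eqs(1)] mat_assoc_eq[OF in_pr_eqs(2)]
      mat_assoc_eq[OF in_pr_eqs(3)] mat_assoc_eq[OF in_pr_eqs(4)] mat_ring)

lemma mult_pr_index:
  "dim_col A = a \<Longrightarrow> i < dim_row A \<Longrightarrow> j < a + b \<Longrightarrow> (A * pr1 a b) $$ (i, j) = (if j < a then A $$ (i, j) else 0)"
  "dim_col A = b \<Longrightarrow> i < dim_row A \<Longrightarrow> j < a + b \<Longrightarrow> (A * pr2 a b) $$ (i, j) = (if j < a then 0 else A $$ (i, j - a))"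
proof -
  have t: "(A * B) $$ (i, j) = (B\<^sup>T * A\<^sup>T) $$ (j, i)" if "i < dim_row A" "j < dim_col B" "dim_col A = dim_row B" for A B :: "complex mat" and i j
    using that by (simp add: scalar_prod_def mult.commute)
  have tp: "(pr1 a b)\<^sup>T = in1 a b" "(pr2 a b)\<^sup>T = in2 a b"
    by (rule eq_matI; auto simp: in1_def in2_def pr1_def pr2_def)+
  show "dim_col A = a \<Longrightarrow> i < dim_row A \<Longrightarrow> j < a + b \<Longrightarrow> (A * pr1 a b) $$ (i, j) = (if j < a then A $$ (i, j) else 0)"
    by (subst t) (simp_all add: tp in_mult_index del: index_mult_mat(1))
  show "dim_col A = b \<Longrightarrow> i < dim_row A \<Longrightarrow> j < a + b \<Longrightarrow> (A * pr2 a b) $$ (i, j) = (if j < a then 0 else A $$ (i, j - a))"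
    by (subst t) (auto simp add: tp in_mult_index simp del: index_mult_mat(1))
qed

lemma four_block_in_pr:
  assumes [simp]: "dim_row A = a" "dim_col A = c" "dim_row D = b" "dim_col D = d"
    "dim_row B = a" "dim_col B = d" "dim_row C = b" "dim_col C = c"
  shows "four_block_mat A B C D = in1 a b * (A * pr1 c d) + in1 a b * (B * pr2 c d) +
    in2 a b * (C * pr1 c d) + in2 a b * (D * pr2 c d)"
  by (rule eq_matI) (auto simp: in_mult_index mult_pr_index simp del: index_mult_mat(1))

definition dsum :: "k2_module \<Rightarrow> k2_module \<Rightarrow> k2_module" where
  "dsum M N = K2_Module (vdim M + vdim N)
     (\<lambda>x. in1 (vdim M) (vdim N) * (act M x * pr1 (vdim M) (vdim N)) +
          in2 (vdim M) (vdim N) * (act N x * pr2 (vdim M) (vdim N)))"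

lemma vdim_dsum [simp]: "vdim (dsum M N) = vdim M + vdim N"
  by (simp add: dsum_def)

lemma act_dsum: "act (dsum M N) x = in1 (vdim M) (vdim N) * (act M x * pr1 (vdim M) (vdim N)) +
          in2 (vdim M) (vdim N) * (act N x * pr2 (vdim M) (vdim N))"
  by (simp add: dsum_def)

lemma dsum_Rep:
  assumes M: "M \<in> Rep" and N: "N \<in> Rep"
  shows "dsum M N \<in> Rep"
proof -
  note [simp] = Rep_act(1,2)[OF M] Rep_act(1,2)[OF N]
  show ?thesis
    unfolding Rep_def
    by (auto simp: dsum_def carrier_dim Rep_act(3-)[OF M] Rep_act(3-)[OF N] mat_ring in_pr in_pr_eqs)
qed

lemma direct_sum_Cons:
  assumes "M \<in> Rep" "set Ms \<subseteq> Rep"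
  shows "direct_sum (M # Ms) = dsum M (direct_sum Ms)"
proof -
  note [simp] = Rep_act(1,2)[OF assms(1)]
  have d: "dim_row (diag_block_mat (map (\<lambda>M. act M x) Ms)) = sum_list (map vdim Ms)"
    "dim_col (diag_block_mat (map (\<lambda>M. act M x) Ms)) = sum_list (map vdim Ms)" for x
    using assms(2) by (auto simp: dim_diag_block_mat o_def intro!: arg_cong[of _ _ sum_list] map_cong Rep_act(1,2))
  show ?thesis
    by (simp add: direct_sum_def dsum_def fun_eq_iff Let_def d)
      (subst four_block_in_pr, auto simp: d mat_ring)
qed

lemma direct_sum_Nil: "vdim (direct_sum []) = 0" "direct_sum [] \<in> Rep"
  by (auto simp: direct_sum_def Rep_def intro!: eq_matI)

lemma direct_sum_Rep: "set Ms \<subseteq> Rep \<Longrightarrow> direct_sum Ms \<in> Rep"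
  by (induction Ms) (auto simp: direct_sum_Nil direct_sum_Cons dsum_Rep)

lemma direct_sum_single:
  assumes "M \<in> Rep"
  shows "direct_sum [M] = M"
  by (cases M) (simp add: direct_sum_def del: diag_block_mat.simps)

lemma direct_sum_pair:
  assumes "M \<in> Rep" "N \<in> Rep"
  shows "direct_sum [M, N] = dsum M N"
  using assms direct_sum_single[OF assms(2)] by (simp add: direct_sum_Cons)

lemma dsum_Hom:
  assumes M: "M \<in> Rep" and N: "N \<in> Rep"
  shows "in1 (vdim M) (vdim N) \<in> Hom M (dsum M N)" "in2 (vdim M) (vdim N) \<in> Hom N (dsum M N)"
    "pr1 (vdim M) (vdim N) \<in> Hom (dsum M N) M" "pr2 (vdim M) (vdim N) \<in> Hom (dsum M N) N"
proof -
  note [simp] = Rep_act(1,2)[OF M] Rep_act(1,2)[OF N]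
  show "in1 (vdim M) (vdim N) \<in> Hom M (dsum M N)" "in2 (vdim M) (vdim N) \<in> Hom N (dsum M N)"
    "pr1 (vdim M) (vdim N) \<in> Hom (dsum M N) M" "pr2 (vdim M) (vdim N) \<in> Hom (dsum M N) N"
    by (auto simp: Hom_def carrier_dim act_dsum mat_ring in_pr)
qed

lemma biproduct_iso:
  assumes X: "X \<in> Rep" and M: "M \<in> Rep" and N: "N \<in> Rep"
    and i1: "i1 \<in> Hom M X" and p1: "p1 \<in> Hom X M" and i2: "i2 \<in> Hom N X" and p2: "p2 \<in> Hom X N"
    and eqs: "p1 * i1 = 1\<^sub>m (vdim M)" "p2 * i2 = 1\<^sub>m (vdim N)" "p1 * i2 = 0\<^sub>m (vdim M) (vdim N)"
      "p2 * i1 = 0\<^sub>m (vdim N) (vdim M)" "i1 * p1 + i2 * p2 = 1\<^sub>m (vdim X)"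
  shows "module_iso X (dsum M N)"
proof -
  note [simp] = Rep_act(1,2)[OF M] Rep_act(1,2)[OF N] Rep_act(1,2)[OF X]
    HomD(1,2)[OF i1] HomD(1,2)[OF p1] HomD(1,2)[OF i2] HomD(1,2)[OF p2]
  let ?i = "in1 (vdim M) (vdim N)" and ?j = "in2 (vdim M) (vdim N)"
    and ?p = "pr1 (vdim M) (vdim N)" and ?q = "pr2 (vdim M) (vdim N)"
  have e: "p1 * (i1 * Y) = Y" if "dim_row Y = vdim M" for Y
    using that by (simp_all add: mat_assoc_eq[OF eqs(1)] mat_ring)
  have e2: "p2 * (i2 * Y) = Y" if "dim_row Y = vdim N" for Y
    using that by (simp_all add: mat_assoc_eq[OF eqs(2)] mat_ring)
  have e3: "p1 * (i2 * Y) = 0\<^sub>m (vdim M) (dim_col Y)" if "dim_row Y = vdim N" for Y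
    using that by (simp_all add: mat_assoc_eq[OF eqs(3)] mat_ring)
  have e4: "p2 * (i1 * Y) = 0\<^sub>m (vdim N) (dim_col Y)" if "dim_row Y = vdim M" for Y
    using that by (simp_all add: mat_assoc_eq[OF eqs(4)] mat_ring)
  have lift: "T * (act A x * Y) = act B x * (T * Y)"
    if "T * act A x = act B x * T" "dim_col T = dim_row (act A x)" "dim_col (act A x) = dim_row Y"
      "dim_col (act B x) = dim_row T" "dim_row Y = dim_col T" for T A B Y x
    using mat_assoc_eq[OF that(1,2), of Y] that(3-) by (simp add: mat_assoc)
  have S: "?i * p1 + ?j * p2 \<in> Hom X (dsum M N)"
    by (auto simp: Hom_def carrier_dim act_dsum mat_ring in_pr HomD(3)[OF p1] HomD(3)[OF p2])
  have T: "i1 * ?p + i2 * ?q \<in> Hom (dsum M N) X"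
    by (auto simp: Hom_def carrier_dim act_dsum mat_ring in_pr lift[OF HomD(3)[OF i1]] lift[OF HomD(3)[OF i2]])
  have "(?i * p1 + ?j * p2) * (i1 * ?p + i2 * ?q) = 1\<^sub>m (vdim (dsum M N))"
    by (simp add: mat_ring e e2 e3 e4 in_pr_eqs)
  moreover have "(i1 * ?p + i2 * ?q) * (?i * p1 + ?j * p2) = 1\<^sub>m (vdim X)"
    by (simp add: mat_ring in_pr eqs)
  ultimately show ?thesis unfolding module_iso_def using S T by blast
qed

text \<open>If k > n, padding \<open>Q\<close> with zero rows and \<open>P\<close> with zero columns
  gives square matrices with product 1. The product in the other order is then 1 as well, although
  its lower right corner is 0.\<close>

lemma retract_dim:
  fixes P Q :: "complex mat"
  assumes "P * Q = 1\<^sub>m k" and [simp]: "dim_row P = k" "dim_col P = n" "dim_row Q = n" "dim_col Q = k"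
  shows "k \<le> n"
proof (rule ccontr)
  assume "\<not> k \<le> n"
  then obtain d where k: "k = n + d" "d > 0" by (metis less_imp_add_positive not_le)
  let ?Q = "in1 n d * Q" and ?P = "P * pr1 n d"
  have "?P * ?Q = 1\<^sub>m k" by (simp add: mat_ring in_pr assms(1))
  then have "?Q * ?P = 1\<^sub>m k"
    by (rule mat_mult_left_right_inverse[rotated 2]) (simp_all add: carrier_dim k)
  then have "pr2 n d * (?Q * ?P * in2 n d) = pr2 n d * (1\<^sub>m k * in2 n d)"
    by simp
  then have "0\<^sub>m d d = (1\<^sub>m d :: complex mat)"
    by (simp add: mat_ring in_pr k)
  then have "(0\<^sub>m d d :: complex mat) $$ (0, 0) = 1\<^sub>m d $$ (0, 0)" by simp
  then show False using k by simp
qed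

text \<open>Vectors and functionals are kept as one-column and one-row matrices, so that the same
  rewrite rules govern them.\<close>

definition urow :: "nat \<Rightarrow> nat \<Rightarrow> complex mat" where
  "urow n i = mat 1 n (\<lambda>(_, j). if j = i then 1 else 0)"
definition ucol :: "nat \<Rightarrow> nat \<Rightarrow> complex mat" where
  "ucol n i = mat n 1 (\<lambda>(j, _). if j = i then 1 else 0)"

lemma unit_dim [simp]:
  "dim_row (urow n i) = Suc 0" "dim_col (urow n i) = n" "dim_row (ucol n i) = n" "dim_col (ucol n i) = Suc 0"
  by (simp_all add: urow_def ucol_def)

lemma urow_index: "dim_row A = n \<Longrightarrow> i < n \<Longrightarrow> j < dim_col A \<Longrightarrow> (urow n i * A) $$ (0, j) = A $$ (i, j)"
  by (simp add: urow_def scalar_prod_def if_distrib[of "\<lambda>x. x * _"] cong: if_cong)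

lemma ucol_index: "dim_col A = n \<Longrightarrow> j < n \<Longrightarrow> i < dim_row A \<Longrightarrow> (A * ucol n j) $$ (i, 0) = A $$ (i, j)"
  by (simp add: ucol_def scalar_prod_def if_distrib[of "\<lambda>x. _ * x"] cong: if_cong)

lemma entry_urow_ucol:
  assumes "dim_row A = n" "dim_col A = m" "i < n" "j < m"
  shows "urow n i * (A * ucol m j) = (A $$ (i, j)) \<cdot>\<^sub>m 1\<^sub>m (Suc 0)"
  using assms by (intro eq_matI) (simp_all add: urow_index ucol_index del: index_mult_mat(1))

text \<open>Take k maximal with some P G Q = 1. If the residue G - G Q P G had a nonzero entry (i,
  j), then P and Q could be enlarged by a row and a column built from i and j.\<close>

lemma rank_factorization:
  fixes G :: "complex mat"
  assumes [simp]: "dim_row G = a" "dim_col G = b"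
  obtains k P Q where "dim_row P = k" "dim_col P = a" "dim_row Q = b" "dim_col Q = k"
    "P * (G * Q) = 1\<^sub>m k" "G * (Q * (P * G)) = G"
proof -
  define S where "S = {k. \<exists>P Q. dim_row P = k \<and> dim_col P = a \<and> dim_row Q = b \<and> dim_col Q = k \<and> P * (G * Q) = 1\<^sub>m k}"
  have S: "S \<subseteq> {..a}"
    unfolding S_def by (auto intro: retract_dim)
  have "0 \<in> S"
    unfolding S_def mem_Collect_eq
    by (rule exI[of _ "0\<^sub>m 0 a"], rule exI[of _ "0\<^sub>m b 0"]) (simp, rule eq_matI, simp_all)
  have fin: "finite S" using S by (rule finite_subset) simp
  have "Max S \<in> S" using Max_in[OF fin] \<open>0 \<in> S\<close> by blast
  define k where "k = Max S"
  have "k \<in> S" using \<open>Max S \<in> S\<close> by (simp add: k_def)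
  then obtain P Q where d [simp]: "dim_row P = k" "dim_col P = a" "dim_row Q = b" "dim_col Q = k"
    and PGQ: "P * (G * Q) = 1\<^sub>m k" unfolding S_def by blast
  have PGQ': "P * (G * (Q * X)) = X" if "dim_row X = k" for X
    using mat_assoc_eq[OF PGQ, of X] that by (simp add: mat_ring)
  have "G * (Q * (P * G)) = G"
  proof (rule ccontr)
    assume ne: "G * (Q * (P * G)) \<noteq> G"
    define G' where "G' = G + (-1) \<cdot>\<^sub>m (G * (Q * (P * G)))"
    have G'd [simp]: "dim_row G' = a" "dim_col G' = b" by (simp_all add: G'_def)
    have "\<exists>i j. i < a \<and> j < b \<and> G' $$ (i, j) \<noteq> 0"
    proof (rule ccontr)
      assume "\<not> ?thesis"
      then have "G' $$ (i, j) = 0" if "i < a" "j < b" for i j using that by blast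
      then have "G * (Q * (P * G)) = G"
        by (intro eq_matI) (simp_all add: G'_def del: index_mult_mat(1))
      then show False using ne by simp
    qed
    then obtain i j where ij: "i < a" "j < b" "G' $$ (i, j) \<noteq> 0" by blast
    define c where "c = G' $$ (i, j)"
    \<comment> \<open>The i-th unit row and the j-th unit column, corrected so that L G Q = 0 and P
      G M = 0; the factor 1 / c normalises L G M to 1.\<close>
    define L where "L = (1 / c) \<cdot>\<^sub>m (urow a i * (1\<^sub>m a + (-1) \<cdot>\<^sub>m (G * (Q * P))))"
    define M where "M = (1\<^sub>m b + (-1) \<cdot>\<^sub>m (Q * (P * G))) * ucol b j"
    have [simp]: "dim_row L = Suc 0" "dim_col L = a" "dim_row M = b" "dim_col M = Suc 0"
      by (simp_all add: L_def M_def)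
    have GM: "G * M = G' * ucol b j"
      unfolding M_def G'_def by (simp add: mat_ring)
    have PGM: "P * (G * M) = 0\<^sub>m k (Suc 0)"
      unfolding M_def by (simp add: mat_ring PGQ') (rule eq_matI; simp del: index_mult_mat(1))
    have LGQ: "L * (G * Q) = 0\<^sub>m (Suc 0) k"
      unfolding L_def by (simp add: mat_ring PGQ) (rule eq_matI; simp del: index_mult_mat(1))
    have "L * (G * M) = (1 / c) \<cdot>\<^sub>m (urow a i * (G * M))"
      unfolding L_def by (simp add: mat_ring PGM)
    also have "\<dots> = 1\<^sub>m (Suc 0)"
      unfolding GM using ij by (simp add: entry_urow_ucol mat_ring c_def)
    finally have LGM: "L * (G * M) = 1\<^sub>m (Suc 0)" .
    let ?P = "in1 k (Suc 0) * P + in2 k (Suc 0) * L" and ?Q = "Q * pr1 k (Suc 0) + M * pr2 k (Suc 0)"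
    have LGM': "L * (G * (M * X)) = X" if "dim_row X = Suc 0" for X
      using mat_assoc_eq[OF LGM, of X] that by (simp add: mat_ring)
    have PGM': "P * (G * (M * X)) = 0\<^sub>m k (dim_col X)" if "dim_row X = Suc 0" for X
      using mat_assoc_eq[OF PGM, of X] that by (simp add: mat_ring)
    have LGQ': "L * (G * (Q * X)) = 0\<^sub>m (Suc 0) (dim_col X)" if "dim_row X = k" for X
      using mat_assoc_eq[OF LGQ, of X] that by (simp add: mat_ring)
    have "?P * (G * ?Q) = 1\<^sub>m (Suc k)"
      using in_pr_eqs(5)[of k "Suc 0"]
      by (simp add: mat_ring PGQ' LGM' PGM' LGQ')
    then have "Suc k \<in> S"
      unfolding S_def mem_Collect_eq by (intro exI[of _ ?P] exI[of _ ?Q]) simp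
    then have "Suc k \<le> k"
      unfolding k_def using Max_ge[OF fin] by blast
    then show False by simp
  qed
  then show ?thesis using that[OF d PGQ] by blast
qed

text \<open>A rank factorization of \<open>e\<close> provides coordinates on its image. The
  compressed matrices p x i satisfy the defining relations because \<open>e\<close> commutes with
  the action.\<close>

lemma idempotent_split:
  assumes X: "X \<in> Rep" and e: "e \<in> Hom X X" "e * e = e"
  obtains Y i p where "Y \<in> Rep" "i \<in> Hom Y X" "p \<in> Hom X Y" "p * i = 1\<^sub>m (vdim Y)" "i * p = e"
proof -
  let ?n = "vdim X" and ?A = "opK X" and ?B = "op1 X" and ?C = "op2 X"
  note [simp] = Rep_act(1,2)[OF X] HomD(1,2)[OF e(1)]
  obtain k P Q where d [simp]: "dim_row P = k" "dim_col P = ?n" "dim_row Q = ?n" "dim_col Q = k"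
    and PQ: "P * (e * Q) = 1\<^sub>m k" "e * (Q * (P * e)) = e"
    by (rule rank_factorization[of e ?n ?n]) simp_all
  define i where "i = e * Q"
  define p where "p = P * e"
  have [simp]: "dim_row i = ?n" "dim_col i = k" "dim_row p = k" "dim_col p = ?n"
    by (simp_all add: i_def p_def)
  have ee: "e * (e * Y) = e * Y" if "dim_row Y = ?n" for Y
    using mat_assoc_eq[OF e(2), of Y] that by simp
  have ip: "i * p = e" using PQ(2) by (simp add: i_def p_def mat_ring)
  have pi: "p * i = 1\<^sub>m k" using PQ(1) by (simp add: i_def p_def mat_ring ee)
  have ei: "e * i = i" and pe: "p * e = p" by (simp_all add: i_def p_def mat_ring ee e(2))
  have ip': "i * (p * Y) = e * Y" if "dim_row Y = ?n" for Y
    using mat_assoc_eq[OF ip, of Y] that by simp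
  have pe': "p * (e * Y) = p * Y" if "dim_row Y = ?n" for Y
    using mat_assoc_eq[OF pe, of Y] that by simp
  have swap: "e * act X x = act X x * e" for x by (rule HomD(3)[OF e(1)])
  have swap': "act X x * (e * Y) = e * (act X x * Y)" if "dim_row Y = ?n" for x Y
    using mat_assoc_eq[OF swap, of x Y] that by (simp add: mat_assoc)
  note r = relations_rules[OF Rep_relations[OF X]]
  have rel: "relations k (p * (?A * i)) (p * (?B * i)) (p * (?C * i))"
    unfolding relations_def
    by (simp add: mat_ring ip' swap' pe' r pi)
  let ?Y = "generator_module k (p * (?A * i)) (p * (?B * i)) (p * (?C * i))"
  have Y: "?Y \<in> Rep" by (rule generator_module_Rep[OF rel])
  note op = op_generator_module[OF rel]
  have ax: "e * (act X x * i) = act X x * i" for x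
    using swap'[of i x] ei by simp
  have "i \<in> Hom ?Y X"
    by (rule HomI[OF Y X]) (simp_all add: op mat_ring ip' ax)
  moreover have "p \<in> Hom X ?Y"
    by (rule HomI[OF X Y]) (simp_all add: op mat_ring ip swap[symmetric] pe')
  ultimately show ?thesis using that[OF Y] pi ip by simp
qed

lemma retract_complement:
  assumes X: "X \<in> Rep" and Y: "Y \<in> Rep" and i: "i \<in> Hom Y X" and p: "p \<in> Hom X Y" and pi: "p * i = 1\<^sub>m (vdim Y)"
  obtains Z where "Z \<in> Rep" "module_iso X (dsum Y Z)"
proof -
  note [simp] = Rep_act(1,2)[OF X] Rep_act(1,2)[OF Y] HomD(1,2)[OF i] HomD(1,2)[OF p]
  have pi': "p * (i * W) = W" if "dim_row W = vdim Y" for W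
    using mat_assoc_eq[OF pi, of W] that by (simp add: mat_ring)
  define f where "f = 1\<^sub>m (vdim X) + (-1) \<cdot>\<^sub>m (i * p)"
  have ipH: "i * p \<in> Hom X X" by (rule Hom_comp[OF X Y X i p])
  have [simp]: "dim_row f = vdim X" "dim_col f = vdim X" by (simp_all add: f_def)
  have fH: "f \<in> Hom X X"
    using HomD(3)[OF ipH] by (auto simp: Hom_def carrier_dim f_def mat_ring)
  have ff: "f * f = f"
    unfolding f_def by (simp add: mat_ring pi') (rule eq_matI; simp del: index_mult_mat(1))
  obtain Z j q where Z: "Z \<in> Rep" and j: "j \<in> Hom Z X" and q: "q \<in> Hom X Z"
    and qj: "q * j = 1\<^sub>m (vdim Z)" and jq: "j * q = f"
    by (rule idempotent_split[OF X fH ff])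
  note [simp] = HomD(1,2)[OF j] HomD(1,2)[OF q]
  have pf: "p * f = 0\<^sub>m (vdim Y) (vdim X)" and fi: "f * i = 0\<^sub>m (vdim X) (vdim Y)"
    unfolding f_def by (simp_all add: mat_ring pi' pi) (rule eq_matI; simp del: index_mult_mat(1))+
  have "p * j = p * (j * (q * j))" by (simp add: qj mat_ring)
  also have "\<dots> = (p * f) * j" by (simp add: mat_assoc jq[symmetric])
  finally have pj: "p * j = 0\<^sub>m (vdim Y) (vdim Z)" by (simp add: pf mat_ring)
  have "q * i = (q * j) * (q * i)" by (simp add: qj mat_ring)
  also have "\<dots> = q * (f * i)" by (simp add: mat_assoc jq[symmetric])
  finally have qi: "q * i = 0\<^sub>m (vdim Z) (vdim Y)" by (simp add: fi mat_ring)
  have "module_iso X (dsum Y Z)"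
    by (rule biproduct_iso[OF X Y Z i p j q pi qj pj qi])
      (simp add: jq f_def, rule eq_matI; simp del: index_mult_mat(1))
  then show ?thesis using that[OF Z] by simp
qed

section \<open>Isomorphisms of modules\<close>

lemma iso_vdim:
  assumes "module_iso X Y"
  shows "vdim X = vdim Y"
  using assms unfolding module_iso_def
  by (metis HomD(1,2) le_antisym retract_dim)

lemma iso_sym: "module_iso X Y \<Longrightarrow> module_iso Y X"
  unfolding module_iso_def by blast

lemma iso_refl: "X \<in> Rep \<Longrightarrow> module_iso X X"
  unfolding module_iso_def using Hom_one[of X] by (metis carrier_matI index_one_mat(2,3) left_mult_one_mat)

lemma iso_trans:
  assumes R: "X \<in> Rep" "Y \<in> Rep" "Z \<in> Rep" and "module_iso X Y" "module_iso Y Z"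
  shows "module_iso X Z"
proof -
  obtain S T where 1: "S \<in> Hom X Y" "T \<in> Hom Y X" "S * T = 1\<^sub>m (vdim Y)" "T * S = 1\<^sub>m (vdim X)"
    using assms(4) unfolding module_iso_def by blast
  obtain S' T' where 2: "S' \<in> Hom Y Z" "T' \<in> Hom Z Y" "S' * T' = 1\<^sub>m (vdim Z)" "T' * S' = 1\<^sub>m (vdim Y)"
    using assms(5) unfolding module_iso_def by blast
  note [simp] = HomD(1,2)[OF 1(1)] HomD(1,2)[OF 1(2)] HomD(1,2)[OF 2(1)] HomD(1,2)[OF 2(2)]
  have "S' * S * (T * T') = 1\<^sub>m (vdim Z)" "T * T' * (S' * S) = 1\<^sub>m (vdim X)"
    by (simp_all add: mat_assoc mat_assoc_eq[OF 1(3)] mat_assoc_eq[OF 2(4)] mat_ring 1 2)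
  then show ?thesis
    unfolding module_iso_def using Hom_comp[OF R 2(1) 1(1)] Hom_comp[OF R(3,2,1) 1(2) 2(2)] by blast
qed

lemma dsum_iso:
  assumes "X \<in> Rep" "X' \<in> Rep" "Y \<in> Rep" "Y' \<in> Rep" "module_iso X X'" "module_iso Y Y'"
  shows "module_iso (dsum X Y) (dsum X' Y')"
proof -
  obtain S T where 1: "S \<in> Hom X X'" "T \<in> Hom X' X" "S * T = 1\<^sub>m (vdim X')" "T * S = 1\<^sub>m (vdim X)"
    using assms(5) unfolding module_iso_def by blast
  obtain S' T' where 2: "S' \<in> Hom Y Y'" "T' \<in> Hom Y' Y" "S' * T' = 1\<^sub>m (vdim Y')" "T' * S' = 1\<^sub>m (vdim Y)"
    using assms(6) unfolding module_iso_def by blast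
  note [simp] = HomD(1,2)[OF 1(1)] HomD(1,2)[OF 1(2)] HomD(1,2)[OF 2(1)] HomD(1,2)[OF 2(2)]
  note h = dsum_Hom[OF assms(1,3)]
  note R = dsum_Rep[OF assms(1,3)]
  show ?thesis
  proof (rule biproduct_iso)
    show "in1 (vdim X) (vdim Y) * T \<in> Hom X' (dsum X Y)" "S * pr1 (vdim X) (vdim Y) \<in> Hom (dsum X Y) X'"
      "in2 (vdim X) (vdim Y) * T' \<in> Hom Y' (dsum X Y)" "S' * pr2 (vdim X) (vdim Y) \<in> Hom (dsum X Y) Y'"
      using Hom_comp[OF assms(2,1) R h(1) 1(2)] Hom_comp[OF R assms(1,2) 1(1) h(3)]
        Hom_comp[OF assms(4,3) R h(2) 2(2)] Hom_comp[OF R assms(3,4) 2(1) h(4)] by auto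
  qed (use assms R in \<open>simp_all add: mat_ring in_pr in_pr_eqs 1(3) 2(3) mat_assoc_eq[OF 1(4)] mat_assoc_eq[OF 2(4)]\<close>)
qed

subsection \<open>Nullity of points\<close>

definition tr :: "complex mat \<Rightarrow> complex" where
  "tr A = (\<Sum>i<dim_row A. A $$ (i, i))"

lemma tr_comm:
  assumes "dim_col A = dim_row B" "dim_col B = dim_row A"
  shows "tr (A * B) = tr (B * A)"
proof -
  have "tr (A * B) = (\<Sum>i<dim_row A. \<Sum>j<dim_row B. A $$ (i, j) * B $$ (j, i))"
    using assms by (simp add: tr_def scalar_prod_def lessThan_atLeast0)
  also have "\<dots> = (\<Sum>j<dim_row B. \<Sum>i<dim_row A. A $$ (i, j) * B $$ (j, i))"
    by (rule sum.swap)
  also have "\<dots> = tr (B * A)"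
    using assms by (simp add: tr_def scalar_prod_def lessThan_atLeast0 mult.commute)
  finally show ?thesis .
qed

lemma tr_linear:
  "dim_row A = dim_row B \<Longrightarrow> dim_col A = dim_row A \<Longrightarrow> dim_col B = dim_row B \<Longrightarrow> tr (A + B) = tr A + tr B"
  "dim_col A = dim_row A \<Longrightarrow> tr (c \<cdot>\<^sub>m A) = c * tr A"
  "tr (0\<^sub>m n n) = 0" "tr (1\<^sub>m n) = of_nat n"
  by (simp_all add: tr_def sum.distrib sum_distrib_left)

definition lin :: "complex \<times> complex \<Rightarrow> k2_module \<Rightarrow> complex mat" where
  "lin c M = fst c \<cdot>\<^sub>m op1 M + snd c \<cdot>\<^sub>m op2 M"

definition ac :: "complex mat \<Rightarrow> complex mat \<Rightarrow> complex mat" where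
  "ac A B = A * B + B * A"

text \<open>\<open>H (Suc m)\<close> is the coefficient of \<open>t\<^sup>m\<close> in the homotopy \<open>h(t)\<close>, for \<open>\<xi>(t) = lin a X + t lin b X\<close>;
  the shift of the index, with \<open>H 0 = 0\<close>, avoids a case distinction.\<close>

definition null :: "complex \<times> complex \<Rightarrow> complex \<times> complex \<Rightarrow> nat \<Rightarrow> k2_module \<Rightarrow> bool" where
  "null a b n X \<longleftrightarrow> (\<exists>H. H 0 = 0\<^sub>m (vdim X) (vdim X) \<and>
     (\<forall>m. dim_row (H m) = vdim X \<and> dim_col (H m) = vdim X) \<and>
     (\<forall>m\<le>n. ac (lin a X) (H (Suc m)) + ac (lin b X) (H m) =
        (if m = n then 1\<^sub>m (vdim X) else 0\<^sub>m (vdim X) (vdim X))))"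

lemma ac_dim [simp]: "dim_row (ac A B) = dim_row B" "dim_col (ac A B) = dim_col A"
  by (simp_all add: ac_def)

lemma lin_dim [simp]:
  assumes "M \<in> Rep" shows "dim_row (lin c M) = vdim M" "dim_col (lin c M) = vdim M"
  by (simp_all add: lin_def Rep_act[OF assms])

lemma lin_Hom:
  assumes "M \<in> Rep" "N \<in> Rep" "T \<in> Hom M N"
  shows "T * lin c M = lin c N * T"
  using HomD[OF assms(3)] by (simp add: lin_def mat_ring Rep_act[OF assms(1)] Rep_act[OF assms(2)])

lemma lin_K:
  assumes "M \<in> Rep"
  shows "opK M * lin c M = (-1) \<cdot>\<^sub>m (lin c M * opK M)"
  by (simp add: lin_def mat_ring Rep_act[OF assms] relations_rules[OF Rep_relations[OF assms]])

lemma null_zero: "X \<in> Rep \<Longrightarrow> vdim X = 0 \<Longrightarrow> null a b n X"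
  unfolding null_def
  by (intro exI[of _ "\<lambda>_. 0\<^sub>m 0 0"]) (auto intro!: eq_matI)

lemma ac_zero: "dim_row A = n \<Longrightarrow> dim_col A = n \<Longrightarrow> ac A (0\<^sub>m n n) = 0\<^sub>m n n"
  by (simp add: ac_def mat_ring)

text \<open>Multiplying h(t) by t raises the order by one. On coefficients this is the shift to
  \<open>m - 1\<close>, where truncated subtraction at 0 returns \<open>H 0\<close>, which is zero
  as required.\<close>

lemma null_mono:
  assumes X: "X \<in> Rep" and "null a b n X" "n \<le> n'"
  shows "null a b n' X"
  using assms(3)
proof (induction n' rule: dec_induct)
  case base
  show ?case by (rule assms(2))
next
  case (step n')
  then obtain H where H: "H 0 = 0\<^sub>m (vdim X) (vdim X)" "\<And>m. dim_row (H m) = vdim X" "\<And>m. dim_col (H m) = vdim X"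
    "\<And>m. m \<le> n' \<Longrightarrow> ac (lin a X) (H (Suc m)) + ac (lin b X) (H m) =
        (if m = n' then 1\<^sub>m (vdim X) else 0\<^sub>m (vdim X) (vdim X))"
    unfolding null_def by blast
  have "ac (lin a X) (H m) + ac (lin b X) (H (m - 1)) =
        (if m = Suc n' then 1\<^sub>m (vdim X) else 0\<^sub>m (vdim X) (vdim X))" if "m \<le> Suc n'" for m
    using that H(4)[of "m - 1"] H(1) X by (cases m) (simp_all add: ac_zero mat_ring)
  then show ?case
    unfolding null_def using H(1,2,3)
    by (intro exI[of _ "\<lambda>m. H (m - 1)"]) simp
qed

text \<open>Common scheme for retracts and for both tensor factors: \<open>S\<close> carries the
  coefficients of the homotopy over, and \<open>T\<close> carries their anticommutators
  over.\<close>

lemma null_transfer: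
  assumes X: "X \<in> Rep" and "null a b n X"
    and S: "\<And>H. dim_row H = vdim X \<Longrightarrow> dim_col H = vdim X \<Longrightarrow> dim_row (S H) = vdim Y \<and> dim_col (S H) = vdim Y"
      "S (0\<^sub>m (vdim X) (vdim X)) = 0\<^sub>m (vdim Y) (vdim Y)"
    and T: "\<And>A B. dim_row A = vdim X \<Longrightarrow> dim_col A = vdim X \<Longrightarrow> dim_row B = vdim X \<Longrightarrow> dim_col B = vdim X \<Longrightarrow> T (A + B) = T A + T B"
      "T (1\<^sub>m (vdim X)) = 1\<^sub>m (vdim Y)" "T (0\<^sub>m (vdim X) (vdim X)) = 0\<^sub>m (vdim Y) (vdim Y)"
    and ST: "\<And>c H. dim_row H = vdim X \<Longrightarrow> dim_col H = vdim X \<Longrightarrow> ac (lin c Y) (S H) = T (ac (lin c X) H)"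
  shows "null a b n Y"
proof -
  obtain H where H: "H 0 = 0\<^sub>m (vdim X) (vdim X)" and [simp]: "\<And>m. dim_row (H m) = vdim X" "\<And>m. dim_col (H m) = vdim X"
    and eq: "\<And>m. m \<le> n \<Longrightarrow> ac (lin a X) (H (Suc m)) + ac (lin b X) (H m) =
        (if m = n then 1\<^sub>m (vdim X) else 0\<^sub>m (vdim X) (vdim X))"
    using assms(2) unfolding null_def by blast
  have "ac (lin a Y) (S (H (Suc m))) + ac (lin b Y) (S (H m)) = T (ac (lin a X) (H (Suc m)) + ac (lin b X) (H m))" for m
    by (simp add: ST T(1) lin_dim[OF X])
  then show ?thesis
    unfolding null_def by (intro exI[of _ "\<lambda>m. S (H m)"]) (simp add: H S eq T(2,3))
qed

lemma null_retract:
  assumes X: "X \<in> Rep" and Y: "Y \<in> Rep" and i: "i \<in> Hom Y X" and p: "p \<in> Hom X Y"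
    and pi: "p * i = 1\<^sub>m (vdim Y)" and "null a b n X"
  shows "null a b n Y"
proof -
  note [simp] = lin_dim[OF X] lin_dim[OF Y] HomD(1,2)[OF i] HomD(1,2)[OF p]
  show ?thesis
    by (rule null_transfer[OF X assms(6), where S = "\<lambda>H. p * (H * i)" and T = "\<lambda>H. p * (H * i)"])
      (simp_all add: mat_ring pi ac_def lin_Hom[OF Y X i] mat_assoc_eq[OF lin_Hom[OF X Y p]])
qed

lemma null_dsum:
  assumes M: "M \<in> Rep" and N: "N \<in> Rep" and "null a b n M" "null a b n N"
  shows "null a b n (dsum M N)"
proof -
  note R = dsum_Rep[OF M N] and h = dsum_Hom[OF M N]
  note [simp] = lin_dim[OF M] lin_dim[OF N] lin_dim[OF R, simplified]
  let ?i = "in1 (vdim M) (vdim N)" and ?j = "in2 (vdim M) (vdim N)"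
    and ?p = "pr1 (vdim M) (vdim N)" and ?q = "pr2 (vdim M) (vdim N)"
  let ?X = "dsum M N"
  obtain F where F: "F 0 = 0\<^sub>m (vdim M) (vdim M)" and [simp]: "\<And>m. dim_row (F m) = vdim M" "\<And>m. dim_col (F m) = vdim M"
    and eqF: "\<And>m. m \<le> n \<Longrightarrow> ac (lin a M) (F (Suc m)) + ac (lin b M) (F m) =
        (if m = n then 1\<^sub>m (vdim M) else 0\<^sub>m (vdim M) (vdim M))"
    using assms(3) unfolding null_def by blast
  obtain G where G: "G 0 = 0\<^sub>m (vdim N) (vdim N)" and [simp]: "\<And>m. dim_row (G m) = vdim N" "\<And>m. dim_col (G m) = vdim N"
    and eqG: "\<And>m. m \<le> n \<Longrightarrow> ac (lin a N) (G (Suc m)) + ac (lin b N) (G m) =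
        (if m = n then 1\<^sub>m (vdim N) else 0\<^sub>m (vdim N) (vdim N))"
    using assms(4) unfolding null_def by blast
  define H where "H m = ?i * (F m * ?p) + ?j * (G m * ?q)" for m
  have c: "ac (lin c ?X) (H m) = ?i * (ac (lin c M) (F m) * ?p) + ?j * (ac (lin c N) (G m) * ?q)" for c m
    using mat_assoc_eq[OF lin_Hom[OF M R h(1), of c, symmetric], of "F m * ?p"]
      mat_assoc_eq[OF lin_Hom[OF N R h(2), of c, symmetric], of "G m * ?q"]
      lin_Hom[OF R M h(3), of c] lin_Hom[OF R N h(4), of c]
    by (simp add: ac_def H_def mat_ring) (rule eq_matI; simp add: algebra_simps del: index_mult_mat(1))
  have "ac (lin a ?X) (H (Suc m)) + ac (lin b ?X) (H m) =
      (if m = n then 1\<^sub>m (vdim ?X) else 0\<^sub>m (vdim ?X) (vdim ?X))" if "m \<le> n" for m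
  proof -
    have "ac (lin a ?X) (H (Suc m)) + ac (lin b ?X) (H m) =
      ?i * ((ac (lin a M) (F (Suc m)) + ac (lin b M) (F m)) * ?p) +
      ?j * ((ac (lin a N) (G (Suc m)) + ac (lin b N) (G m)) * ?q)"
      by (simp add: c mat_ring) (rule eq_matI; simp add: algebra_simps del: index_mult_mat(1))
    also have "\<dots> = (if m = n then 1\<^sub>m (vdim ?X) else 0\<^sub>m (vdim ?X) (vdim ?X))"
      unfolding eqF[OF that] eqG[OF that] by (simp add: mat_ring in_pr_eqs)
    finally show ?thesis .
  qed
  then show ?thesis
    unfolding null_def by (intro exI[of _ H]) (simp add: H_def F G mat_ring)
qed

lemma lin_tensor:
  assumes V: "V \<in> Rep" and X: "X \<in> Rep"
  shows "lin c (tensor_module V X) = kronecker (opK V) (lin c X) + kronecker (lin c V) (1\<^sub>m (vdim X))"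
  unfolding lin_def tensor_module[OF V X]
  by (simp add: kronecker_linear mat_ring Rep_act[OF V] Rep_act[OF X])
    (rule eq_matI; simp add: Rep_act[OF V] Rep_act[OF X] algebra_simps del: kronecker_index)

text \<open>The homotopy is K \<otimes> H. The cross terms (\<xi> K + K \<xi>) \<otimes> H cancel,
  and K^2 = 1 leaves the anticommutator on the second factor.\<close>

lemma null_tensor:
  assumes V: "V \<in> Rep" and X: "X \<in> Rep" and "null a b n X"
  shows "null a b n (tensor_module V X)"
proof (rule null_transfer[OF X assms(3)])
  note [simp] = lin_dim[OF V] lin_dim[OF X] Rep_act(1,2)[OF V] Rep_act(1,2)[OF X] tensor_module(2)[OF V X]
  note K = relations_rules(1)[OF Rep_relations[OF V]]
  show "ac (lin c (tensor_module V X)) (kronecker (opK V) H) = kronecker (1\<^sub>m (vdim V)) (ac (lin c X) H)"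
    if [simp]: "dim_row H = vdim X" "dim_col H = vdim X" for c H
    unfolding lin_tensor[OF V X] ac_def
    by (simp add: mat_ring kronecker_mult kronecker_linear K lin_K[OF V])
      (rule eq_matI; simp add: algebra_simps del: kronecker_index)
qed (simp_all add: kronecker_linear kronecker_one tensor_module(2)[OF V X] Rep_act[OF V])

text \<open>Cyclicity moves \<xi> around the trace, past K with a minus sign and past the
  endomorphism \<open>t\<close> without one, so that tr(K t (\<xi> F + F \<xi>)) = 0. Nullity writes
  the identity as a sum of two such anticommutators.\<close>

lemma null_trace:
  assumes X: "X \<in> Rep" and "null a b n X" and t: "t \<in> Hom X X"
  shows "tr (opK X * t) = 0"
proof -
  note [simp] = lin_dim[OF X] Rep_act(1,2)[OF X] HomD(1,2)[OF t]
  obtain H where [simp]: "\<And>m. dim_row (H m) = vdim X" "\<And>m. dim_col (H m) = vdim X"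
    and eq: "ac (lin a X) (H (Suc n)) + ac (lin b X) (H n) = 1\<^sub>m (vdim X)"
    using assms(2) unfolding null_def by (metis order_refl)
  have c: "tr (opK X * (t * ac (lin c X) F)) = 0" if [simp]: "dim_row F = vdim X" "dim_col F = vdim X" for c F
  proof -
    have "tr (opK X * (t * (F * lin c X))) = tr ((opK X * (t * F)) * lin c X)"
      by (simp add: mat_ring)
    also have "\<dots> = tr (lin c X * (opK X * (t * F)))"
      by (rule tr_comm) simp_all
    also have "lin c X * (opK X * (t * F)) = (-1) \<cdot>\<^sub>m (opK X * (t * (lin c X * F)))"
      using mat_assoc_eq[OF lin_K[OF X, of c], of "t * F"] mat_assoc_eq[OF lin_Hom[OF X X t, of c], of F]
      by (simp add: mat_ring)
    finally show ?thesis by (simp add: ac_def mat_ring tr_linear)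
  qed
  have "tr (opK X * t) = tr (opK X * (t * (ac (lin a X) (H (Suc n)) + ac (lin b X) (H n))))"
    unfolding eq by (simp add: mat_ring)
  also have "\<dots> = tr (opK X * (t * ac (lin a X) (H (Suc n)))) + tr (opK X * (t * ac (lin b X) (H n)))"
    by (simp add: mat_ring tr_linear)
  finally show ?thesis by (simp add: c)
qed

text \<open>With \<open>w(t) = \<Sum> w\<^sub>m t\<^sup>m\<close>, the hypotheses say that \<open>\<xi>(t) v = 0\<close> and \<open>w(t) \<xi>(t) = 0\<close> modulo \<open>t\<^bsup>n+1\<^esup>\<close>; then
  \<open>w(t) (\<xi>(t) h(t) + h(t) \<xi>(t)) v\<close> vanishes modulo \<open>t\<^bsup>n+1\<^esup>\<close>.\<close>

lemma null_obstruction: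
  assumes X: "X \<in> Rep" and "null a b n X"
    and v: "dim_row v = vdim X" "dim_col v = Suc 0" "op1 X * v = 0\<^sub>m (vdim X) (Suc 0)" "op2 X * v = 0\<^sub>m (vdim X) (Suc 0)"
    and w: "\<And>m. dim_row (w m) = Suc 0" "\<And>m. dim_col (w m) = vdim X" "w 0 * lin a X = 0\<^sub>m (Suc 0) (vdim X)"
      "\<And>m. m < n \<Longrightarrow> w (Suc m) * lin a X = (-1) \<cdot>\<^sub>m (w m * lin b X)"
  shows "w 0 * v = 0\<^sub>m (Suc 0) (Suc 0)"
proof -
  note [simp] = lin_dim[OF X] Rep_act(1,2)[OF X] v(1,2) w(1,2)
  obtain H where H: "H 0 = 0\<^sub>m (vdim X) (vdim X)" and [simp]: "\<And>m. dim_row (H m) = vdim X" "\<And>m. dim_col (H m) = vdim X"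
    and eq: "\<And>m. m \<le> n \<Longrightarrow> ac (lin a X) (H (Suc m)) + ac (lin b X) (H m) =
        (if m = n then 1\<^sub>m (vdim X) else 0\<^sub>m (vdim X) (vdim X))"
    using assms(2) unfolding null_def by blast
  have lv: "lin c X * v = 0\<^sub>m (vdim X) (Suc 0)" for c
    by (simp add: lin_def mat_ring v(3,4))
  have eqv: "lin a X * (H (Suc m) * v) + lin b X * (H m * v) = (if m = n then v else 0\<^sub>m (vdim X) (Suc 0))" if "m \<le> n" for m
  proof -
    have "lin a X * (H (Suc m) * v) + lin b X * (H m * v) = (ac (lin a X) (H (Suc m)) + ac (lin b X) (H m)) * v"
      by (simp add: ac_def mat_ring lv)
    also have "\<dots> = (if m = n then v else 0\<^sub>m (vdim X) (Suc 0))"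
      unfolding eq[OF that] by (simp add: mat_ring)
    finally show ?thesis .
  qed
  have eqw: "w k * (lin a X * (H (Suc m) * v)) + w k * (lin b X * (H m * v)) = (if m = n then w k * v else 0\<^sub>m (Suc 0) (Suc 0))" if "m \<le> n" for m k
    using arg_cong[OF eqv[OF that], of "\<lambda>x. w k * x"] by (simp add: mat_ring split: if_splits)
  \<comment> \<open>Induction along the antidiagonal: the equation of index m, paired with
    \<open>w (n - m)\<close>, kills the term with \<open>lin a X\<close>, and the recursion for
    \<open>w\<close> converts that term into the next one with \<open>lin b X\<close>.\<close>
  have T: "w (n - m) * (lin b X * (H m * v)) = 0\<^sub>m (Suc 0) (Suc 0)" if "m \<le> n" for m
    using that
  proof (induction m)
    case 0
    show ?case by (simp add: H mat_ring)
  next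
    case (Suc m)
    have "w (n - m) * (lin a X * (H (Suc m) * v)) = (-1) \<cdot>\<^sub>m (w (n - Suc m) * (lin b X * (H (Suc m) * v)))"
      using mat_assoc_eq[OF w(4)[of "n - Suc m"], of "H (Suc m) * v"] Suc.prems
      by (simp add: Suc_diff_Suc mat_ring)
    then have "0\<^sub>m (Suc 0) (Suc 0) = (-1) \<cdot>\<^sub>m (w (n - Suc m) * (lin b X * (H (Suc m) * v)))"
      using eqw[of m "n - m"] Suc by (simp add: mat_ring)
    then have "(-1) \<cdot>\<^sub>m 0\<^sub>m (Suc 0) (Suc 0) = (-1) \<cdot>\<^sub>m ((-1) \<cdot>\<^sub>m (w (n - Suc m) * (lin b X * (H (Suc m) * v))))"
      by simp
    then show ?case by (simp add: mat_ring)
  qed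
  have "w 0 * (lin a X * (H (Suc n) * v)) = 0\<^sub>m (Suc 0) (Suc 0)"
    using mat_assoc_eq[OF w(3), of "H (Suc n) * v"] by (simp add: mat_ring)
  then show ?thesis using eqw[of n 0] T[of n] by (simp add: mat_ring)
qed

subsection \<open>Duals and retracts of tensor products\<close>

lemma relations_transpose:
  assumes "relations n A B C"
  shows "relations n (A\<^sup>T) (B\<^sup>T) (C\<^sup>T)"
proof -
  note d [simp] = relations_dims[OF assms]
  note r = relations_rules[OF assms]
  have t: "X\<^sup>T * Y\<^sup>T = (Y * X)\<^sup>T" if "dim_row X = n" "dim_col Y = n" for X Y :: "complex mat"
    using that by (intro transpose_mult[symmetric, of _ "dim_row Y" n _ "dim_col X"]) (simp_all add: carrier_dim)
  have s: "(c \<cdot>\<^sub>m X)\<^sup>T = c \<cdot>\<^sub>m X\<^sup>T" for c and X :: "complex mat"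
    by (rule eq_matI) simp_all
  show ?thesis
    unfolding relations_def
    by (simp add: t r s mat_ring)
qed

lemma relations_twist:
  assumes "relations n A B C"
  shows "relations n A (A * B) (A * C)"
  using relations_dims[OF assms] relations_rules[OF assms]
  unfolding relations_def by (simp add: mat_ring)

text \<open>The antipode sends \<open>\<xi>\<^sub>i\<close> to \<open>- K \<xi>\<^sub>i = \<xi>\<^sub>i K\<close>.\<close>

definition dual :: "k2_module \<Rightarrow> k2_module" where
  "dual X = generator_module (vdim X) ((opK X)\<^sup>T) ((opK X)\<^sup>T * (op1 X)\<^sup>T) ((opK X)\<^sup>T * (op2 X)\<^sup>T)"

lemma dual:
  assumes "X \<in> Rep"
  shows "dual X \<in> Rep" "vdim (dual X) = vdim X" "opK (dual X) = (opK X)\<^sup>T"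
    "op1 (dual X) = (opK X)\<^sup>T * (op1 X)\<^sup>T" "op2 (dual X) = (opK X)\<^sup>T * (op2 X)\<^sup>T"
  using relations_twist[OF relations_transpose[OF Rep_relations[OF assms]]]
  unfolding dual_def by (simp_all add: generator_module_Rep op_generator_module)

text \<open>Row-major order matches \<open>kronecker\<close>: vectors of a tensor product become
  matrices U, and A \<otimes> B acts on them by A U B^T.\<close>

definition vec_of :: "complex mat \<Rightarrow> complex mat" where
  "vec_of U = mat (dim_row U * dim_col U) (Suc 0) (\<lambda>(k, _). U $$ (k div dim_col U, k mod dim_col U))"

lemma vec_of_dim [simp]: "dim_row (vec_of U) = dim_row U * dim_col U" "dim_col (vec_of U) = Suc 0"
  by (simp_all add: vec_of_def)

lemma kronecker_vec_of:
  assumes [simp]: "dim_row U = dim_col A" "dim_col U = dim_col B"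
  shows "kronecker A B * vec_of U = vec_of (A * (U * B\<^sup>T))"
proof (rule eq_matI)
  fix i j assume "i < dim_row (vec_of (A * (U * B\<^sup>T)))" "j < dim_col (vec_of (A * (U * B\<^sup>T)))"
  then have i: "i < dim_row A * dim_row B" and [simp]: "j = 0" by simp_all
  note [simp] = i div_mod_less[OF i]
  have "(kronecker A B * vec_of U) $$ (i, j) =
    (\<Sum>k<dim_col A * dim_col B. (\<lambda>a b. A $$ (i div dim_row B, a) * B $$ (i mod dim_row B, b) * U $$ (a, b)) (k div dim_col B) (k mod dim_col B))"
    by (simp add: scalar_prod_def vec_of_def lessThan_atLeast0)
  also have "\<dots> = (\<Sum>a<dim_col A. \<Sum>b<dim_col B. A $$ (i div dim_row B, a) * B $$ (i mod dim_row B, b) * U $$ (a, b))"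
    by (rule sum_div_mod)
  also have "\<dots> = (A * (U * B\<^sup>T)) $$ (i div dim_row B, i mod dim_row B)"
    by (simp add: scalar_prod_def lessThan_atLeast0 sum_distrib_left mult_ac)
  finally show "(kronecker A B * vec_of U) $$ (i, j) = vec_of (A * (U * B\<^sup>T)) $$ (i, j)"
    by (simp add: vec_of_def)
qed simp_all

lemma vec_of_linear:
  "dim_row U = dim_row W \<Longrightarrow> dim_col U = dim_col W \<Longrightarrow> vec_of (U + W) = vec_of U + vec_of W"
  by (rule eq_matI) (auto simp: vec_of_def div_mod_less)

lemma vec_of_zero: "vec_of (0\<^sub>m n m) = 0\<^sub>m (n * m) (Suc 0)"
  by (rule eq_matI) (auto simp: vec_of_def div_mod_less)

lemma kronecker_transpose: "(kronecker A B)\<^sup>T = kronecker (A\<^sup>T) (B\<^sup>T)"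
  by (rule eq_matI) (auto simp: div_mod_less)

section \<open>Evaluation, coevaluation and the supertrace\<close>

definition ev :: "nat \<Rightarrow> complex mat" where
  "ev n = (vec_of (1\<^sub>m n))\<^sup>T"

lemma ev_dim [simp]: "dim_row (ev n) = Suc 0" "dim_col (ev n) = n * n"
  by (simp_all add: ev_def)

lemma ev_kronecker:
  assumes [simp]: "dim_row A = n" "dim_row B = n" "dim_col A = n" "dim_col B = n"
  shows "ev n * kronecker A B = (vec_of (A\<^sup>T * B))\<^sup>T"
proof -
  have "ev n * kronecker A B = ((kronecker A B)\<^sup>T * vec_of (1\<^sub>m n))\<^sup>T"
    unfolding ev_def by (subst transpose_mult[of _ "n * n" "n * n" _ "Suc 0"]) (simp_all add: carrier_dim)
  also have "\<dots> = (vec_of (A\<^sup>T * B))\<^sup>T"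
    by (simp add: kronecker_transpose kronecker_vec_of mat_ring)
  finally show ?thesis .
qed

lemma ev_vec_of:
  assumes [simp]: "dim_row U = n" "dim_col U = n"
  shows "ev n * vec_of U = tr U \<cdot>\<^sub>m 1\<^sub>m (Suc 0)"
proof (rule eq_matI)
  fix i j assume "i < dim_row (tr U \<cdot>\<^sub>m 1\<^sub>m (Suc 0))" "j < dim_col (tr U \<cdot>\<^sub>m 1\<^sub>m (Suc 0))"
  then have [simp]: "i = 0" "j = 0" by simp_all
  have "(ev n * vec_of U) $$ (i, j) = (\<Sum>k<n * n. (\<lambda>a b. (if a = b then 1 else 0) * U $$ (a, b)) (k div n) (k mod n))"
    by (simp add: scalar_prod_def ev_def vec_of_def lessThan_atLeast0 div_mod_less)
  also have "\<dots> = (\<Sum>a<n. \<Sum>b<n. (if a = b then 1 else 0) * U $$ (a, b))"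
    by (rule sum_div_mod)
  also have "\<dots> = tr U"
    by (simp add: tr_def if_distrib[of "\<lambda>x. x * _"] cong: if_cong)
  finally show "(ev n * vec_of U) $$ (i, j) = (tr U \<cdot>\<^sub>m 1\<^sub>m (Suc 0)) $$ (i, j)" by simp
qed simp_all

lemma relations_simple: "relations (Suc 0) ((-1)^r \<cdot>\<^sub>m 1\<^sub>m (Suc 0)) (0\<^sub>m (Suc 0) (Suc 0)) (0\<^sub>m (Suc 0) (Suc 0))"
  by (auto simp: relations_def mat_ring power_add[symmetric] power_mult_distrib[symmetric])

lemma simple_V:
  "simple_V r \<in> Rep" "vdim (simple_V r) = Suc 0" "opK (simple_V r) = (-1)^r \<cdot>\<^sub>m 1\<^sub>m (Suc 0)"
  "op1 (simple_V r) = 0\<^sub>m (Suc 0) (Suc 0)" "op2 (simple_V r) = 0\<^sub>m (Suc 0) (Suc 0)"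
  unfolding simple_V_def One_nat_def
  by (simp_all add: op_generator_module[OF relations_simple] generator_module_Rep[OF relations_simple])

lemma ev_Hom:
  assumes X: "X \<in> Rep"
  shows "ev (vdim X) \<in> Hom (tensor_module (dual X) X) (simple_V 0)"
proof -
  note [simp] = Rep_act(1,2)[OF X]
  note r = relations_rules[OF Rep_relations[OF X]]
  note t = tensor_module[OF dual(1)[OF X] X, unfolded dual[OF X]]
  have s: "(vec_of A)\<^sup>T + (vec_of B)\<^sup>T = (vec_of (A + B))\<^sup>T" if "dim_row A = dim_row B" "dim_col A = dim_col B" for A B
    using that by (intro eq_matI) (auto simp: vec_of_linear)
  have tt: "(X\<^sup>T * Y\<^sup>T)\<^sup>T = Y * X" if "dim_col Y = dim_row X" for X Y :: "complex mat"
    using that by (subst transpose_mult[symmetric, of _ "dim_row Y" "dim_row X" _ "dim_col X"]) (auto simp add: carrier_dim)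
  have z: "op1 X * opK X + (- 1) \<cdot>\<^sub>m (op1 X * opK X) = 0\<^sub>m (vdim X) (vdim X)" 
     "op2 X * opK X + (- 1) \<cdot>\<^sub>m (op2 X * opK X) = 0\<^sub>m (vdim X) (vdim X)"
     "(- 1) \<cdot>\<^sub>m (op1 X * opK X) + op1 X * opK X = 0\<^sub>m (vdim X) (vdim X)" 
     "(- 1) \<cdot>\<^sub>m (op2 X * opK X) + op2 X * opK X = 0\<^sub>m (vdim X) (vdim X)"
    by (rule eq_matI; simp del: index_mult_mat(1))+
  show ?thesis
  proof (rule HomI[OF t(1) simple_V(1)])
  qed (simp_all add: t simple_V mat_ring ev_kronecker r tt s z vec_of_zero, simp add: ev_def)
qed

text \<open>In the order X^* \<otimes> X the vector made from \<open>h\<close> alone is not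
  invariant in general: the square of the antipode is conjugation by K, and the factor K compensates
  for this.\<close>

lemma coev_Hom:
  assumes X: "X \<in> Rep" and h: "h \<in> Hom X X"
  shows "vec_of ((h * opK X)\<^sup>T) \<in> Hom (simple_V 0) (tensor_module (dual X) X)"
proof -
  note [simp] = Rep_act(1,2)[OF X] HomD(1,2)[OF h]
  note r = relations_rules[OF Rep_relations[OF X]]
  note t = tensor_module[OF dual(1)[OF X] X, unfolded dual[OF X]]
  have tt: "X\<^sup>T * Y\<^sup>T = (Y * X)\<^sup>T" if "dim_col Y = dim_row X" for X Y :: "complex mat"
    using that by (intro transpose_mult[symmetric, of _ "dim_row Y" "dim_row X" _ "dim_col X"]) (auto simp add: carrier_dim)
  have hs: "act X x * h = h * act X x" "dim_row Y = vdim X \<Longrightarrow> act X x * (h * Y) = h * (act X x * Y)" for x Y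
    using HomD(3)[OF h, of x, symmetric] mat_assoc_eq[OF HomD(3)[OF h, of x, symmetric], of Y] by (simp_all add: mat_ring)
  have s: "vec_of (A\<^sup>T) + vec_of (B\<^sup>T) = vec_of ((A + B)\<^sup>T)" if "dim_row A = dim_row B" "dim_col A = dim_col B" for A B
    using that by (subst vec_of_linear[symmetric]) (auto intro!: arg_cong[of _ _ vec_of] eq_matI)
  have z: "h * act X x + (- 1) \<cdot>\<^sub>m (h * act X x) = 0\<^sub>m (vdim X) (vdim X)" for x
    by (rule eq_matI; simp del: index_mult_mat(1))
  show ?thesis
  proof (rule HomI[OF simple_V(1) t(1)])
  qed (simp_all add: t simple_V mat_ring kronecker_vec_of tt hs r s z vec_of_zero)
qed

text \<open>Evaluation after coevaluation is the scalar tr(K h), by which the evaluation is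
  divided.\<close>

lemma unit_retract:
  assumes X: "X \<in> Rep" and h: "h \<in> Hom X X" "tr (opK X * h) \<noteq> 0"
  obtains i p where "i \<in> Hom (simple_V 0) (tensor_module (dual X) X)"
    "p \<in> Hom (tensor_module (dual X) X) (simple_V 0)" "p * i = 1\<^sub>m (vdim (simple_V 0))"
proof -
  note [simp] = Rep_act(1,2)[OF X] HomD(1,2)[OF h(1)]
  note R = tensor_module(1)[OF dual(1)[OF X] X]
  let ?c = "tr (opK X * h)"
  have "tr ((h * opK X)\<^sup>T) = tr (h * opK X)" by (simp add: tr_def)
  also have "\<dots> = ?c" by (rule tr_comm) simp_all
  finally have c: "tr ((h * opK X)\<^sup>T) = ?c" .
  have "ev (vdim X) * vec_of ((h * opK X)\<^sup>T) = ?c \<cdot>\<^sub>m 1\<^sub>m (Suc 0)"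
    by (subst ev_vec_of) (simp_all add: c)
  then have "((1 / ?c) \<cdot>\<^sub>m ev (vdim X)) * vec_of ((h * opK X)\<^sup>T) = 1\<^sub>m (vdim (simple_V 0))"
    using h(2) by (simp add: mat_ring simple_V)
  moreover have "(1 / ?c) \<cdot>\<^sub>m ev (vdim X) \<in> Hom (tensor_module (dual X) X) (simple_V 0)"
    using HomD[OF ev_Hom[OF X]] by (auto simp: Hom_def carrier_dim mat_ring Rep_act[OF R] Rep_act[OF simple_V(1)])
  ultimately show ?thesis using that coev_Hom[OF X h(1)] by blast
qed

lemma surjectiveI:
  assumes "T * R = 1\<^sub>m n" "dim_row T = n" "dim_col T = dim_row R"
  shows "surjective T"
  unfolding surjective_def
proof
  fix v :: "complex vec" assume v: "v \<in> carrier_vec (dim_row T)"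
  have "dim_col R = n" using assms(1) by (metis index_mult_mat(3) index_one_mat(3))
  then have "T *\<^sub>v (R *\<^sub>v v) = v"
    using assoc_mult_mat_vec[of T n "dim_row R" R n v] assms v by (simp add: carrier_dim)
  moreover have "R *\<^sub>v v \<in> carrier_vec (dim_col T)" by (metis assms(3) carrier_vecI dim_mult_mat_vec)
  ultimately show "\<exists>u\<in>carrier_vec (dim_col T). T *\<^sub>v u = v" by blast
qed

text \<open>The module map 1 \<otimes> r from P \<otimes> Y to P is onto, having 1 \<otimes> y as a
  linear section. Projectivity of P lifts the identity through it.\<close>

lemma projective_retract:
  assumes P: "projective P" and Y: "Y \<in> Rep" and r: "r \<in> Hom Y (simple_V 0)"
    and y: "r * y = 1\<^sub>m (Suc 0)" "dim_row y = vdim Y"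
  obtains i p where "i \<in> Hom P (tensor_module P Y)" "p \<in> Hom (tensor_module P Y) P" "p * i = 1\<^sub>m (vdim P)"
proof -
  have R: "P \<in> Rep" using P by (simp add: projective_def)
  note t = tensor_module[OF R Y]
  note [simp] = Rep_act(1,2)[OF R] Rep_act(1,2)[OF Y] HomD(1,2)[OF r, unfolded simple_V]
  have [simp]: "dim_col y = Suc 0" using y(1) by (metis index_mult_mat(3) index_one_mat(3))
  let ?p = "kronecker (1\<^sub>m (vdim P)) r"
  have rK: "r * opK Y = r" "r * op1 Y = 0\<^sub>m (Suc 0) (vdim Y)" "r * op2 Y = 0\<^sub>m (Suc 0) (vdim Y)"
    using HomD(3)[OF r] by (simp_all add: simple_V mat_ring)
  have k: "kronecker A r = A * ?p" if "dim_col A = vdim P" for A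
    using that kronecker_mult[of A "1\<^sub>m (vdim P)" "1\<^sub>m (Suc 0)" r] by (simp add: mat_ring kronecker_one)
  have "?p \<in> Hom (tensor_module P Y) P"
  proof (rule HomI[OF t(1) R])
  qed (simp_all add: t mat_ring kronecker_mult kronecker_linear rK, simp_all add: k[symmetric])
  moreover have "surjective ?p"
    by (rule surjectiveI[where R = "kronecker (1\<^sub>m (vdim P)) y"])
      (simp_all add: kronecker_mult y mat_ring kronecker_one)
  ultimately have "\<exists>k\<in>Hom P (tensor_module P Y). ?p * k = 1\<^sub>m (vdim P)"
    using P R t(1) Hom_one[OF R] unfolding projective_def by blast
  then show ?thesis using that \<open>?p \<in> _\<close> by blast
qed

subsection \<open>Ideals\<close>

lemma ideal_retract:
  assumes I: "tensor_ideal I" and X: "X \<in> I" and Y: "Y \<in> Rep"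
    and i: "i \<in> Hom Y X" and p: "p \<in> Hom X Y" and pi: "p * i = 1\<^sub>m (vdim Y)"
  shows "Y \<in> I"
proof -
  have R: "X \<in> Rep" using I X by (auto simp: tensor_ideal_def subcategory_def)
  obtain Z where Z: "Z \<in> Rep" "module_iso X (dsum Y Z)"
    by (rule retract_complement[OF R Y i p pi])
  then have "dsum Y Z \<in> I"
    using I X dsum_Rep[OF Y Z(1)] unfolding tensor_ideal_def subcategory_def by blast
  then show ?thesis
    using I Y Z(1) unfolding tensor_ideal_def direct_sum_pair[OF Y Z(1), symmetric] by blast
qed

lemma tensor_unit:
  assumes "W \<in> Rep"
  shows "tensor_module W (simple_V 0) = W"
  by (rule Rep_eqI) (simp_all add: tensor_module[OF assms simple_V(1)] assms simple_V kronecker_one kronecker_linear mat_ring Rep_act[OF assms])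

lemma proper_ideal_trace:
  assumes I: "tensor_ideal I" "proper I" and X: "X \<in> I" and h: "h \<in> Hom X X"
  shows "tr (opK X * h) = 0"
proof (rule ccontr)
  assume "tr (opK X * h) \<noteq> 0"
  have R: "I \<subseteq> Rep" using I by (auto simp: tensor_ideal_def subcategory_def)
  then have XR: "X \<in> Rep" using X by blast
  obtain i p where "i \<in> Hom (simple_V 0) (tensor_module (dual X) X)"
    "p \<in> Hom (tensor_module (dual X) X) (simple_V 0)" "p * i = 1\<^sub>m (vdim (simple_V 0))"
    using unit_retract[OF XR h \<open>tr _ \<noteq> 0\<close>] by blast
  moreover have "tensor_module (dual X) X \<in> I"
    using I(1) X dual(1)[OF XR] unfolding tensor_ideal_def by blast
  ultimately have "simple_V 0 \<in> I"
    using ideal_retract[OF I(1)] simple_V(1) by blast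
  then have "W \<in> I" if "W \<in> Rep" for W
    using that I(1) tensor_unit[OF that] unfolding tensor_ideal_def by metis
  then show False using I(2) R unfolding proper_def by blast
qed

text \<open>Evaluation X^* \<otimes> X to the unit object is onto for nonzero X, with the matrix
  unit \<open>?U\<close> of trace 1 mapping to 1. Hence P is a retract of P \<otimes> X^* \<otimes>
  X, which lies in the ideal.\<close>

lemma projective_in_ideal:
  assumes I: "tensor_ideal I" and X: "X \<in> I" "vdim X \<noteq> 0" and P: "projective P"
  shows "P \<in> I"
proof -
  have XR: "X \<in> Rep" using I X by (auto simp: tensor_ideal_def subcategory_def)
  have PR: "P \<in> Rep" using P by (simp add: projective_def)
  let ?n = "vdim X"
  let ?U = "mat ?n ?n (\<lambda>(i, j). if i = 0 \<and> j = 0 then 1 else 0) :: complex mat"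
  have "tr ?U = (\<Sum>i<?n. if i = 0 then 1 else 0)"
    by (simp add: tr_def)
  then have "tr ?U = 1" using X(2) by simp
  then have y: "ev ?n * vec_of ?U = 1\<^sub>m (Suc 0)" by (subst ev_vec_of) (simp_all add: mat_ring)
  note R = tensor_module(1)[OF dual(1)[OF XR] XR]
  obtain i p where ip: "i \<in> Hom P (tensor_module P (tensor_module (dual X) X))"
    "p \<in> Hom (tensor_module P (tensor_module (dual X) X)) P" "p * i = 1\<^sub>m (vdim P)"
    using projective_retract[OF P R ev_Hom[OF XR] y] by (auto simp: tensor_module[OF dual(1)[OF XR] XR] dual[OF XR])
  have "tensor_module (dual X) X \<in> I"
    using I(1) X dual(1)[OF XR] unfolding tensor_ideal_def by blast
  then have "tensor_module P (tensor_module (dual X) X) \<in> I"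
    using I(1) PR unfolding tensor_ideal_def by blast
  then show ?thesis using ideal_retract[OF I _ PR ip] by blast
qed

lemma direct_sum_iff:
  assumes "tensor_ideal I" "additive_ideal I" "set Xs \<subseteq> Rep"
  shows "direct_sum Xs \<in> I \<longleftrightarrow> set Xs \<subseteq> I"
  using assms(3)
proof (induction Xs)
  case Nil
  show ?case using assms(2) unfolding additive_ideal_def by simp
next
  case (Cons X Xs)
  have X: "X \<in> Rep" "direct_sum Xs \<in> Rep" using Cons.prems by (auto intro: direct_sum_Rep)
  have "X \<in> I \<and> direct_sum Xs \<in> I" if "direct_sum (X # Xs) \<in> I"
    using that assms(1) X direct_sum_pair[OF X] direct_sum_Cons[OF X(1), of Xs] Cons.prems
    unfolding tensor_ideal_def by auto
  moreover have "set Xs \<subseteq> Rep" using Cons.prems by simp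
  ultimately have "direct_sum (X # Xs) \<in> I \<Longrightarrow> set (X # Xs) \<subseteq> I"
    using Cons.IH by simp
  moreover have "set (X # Xs) \<subseteq> I \<Longrightarrow> direct_sum (X # Xs) \<in> I"
    using assms(2) unfolding additive_ideal_def by blast
  ultimately show ?case by blast
qed

lemma Hom_mult:
  assumes "M \<in> Rep" "N \<in> Rep" "T \<in> Hom M N" "dim_row Y = vdim M"
  shows "T * (act M x * Y) = act N x * (T * Y)"
proof -
  have "T * (act M x * Y) = (T * act M x) * Y"
    by (rule mat_assoc[symmetric]) (simp_all only: HomD[OF assms(3)] Rep_act[OF assms(1)] assms(4))
  also have "\<dots> = act N x * (T * Y)"
    unfolding HomD(3)[OF assms(3)]
    by (rule mat_assoc) (simp_all only: HomD[OF assms(3)] Rep_act[OF assms(2)] assms(4))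
  finally show ?thesis .
qed

subsection \<open>The projective modules\<close>

lemma urow_ucol: "i < n \<Longrightarrow> urow n i * ucol n j = (if i = j then 1\<^sub>m (Suc 0) else 0\<^sub>m (Suc 0) (Suc 0))"
  by (rule eq_matI) (auto simp: urow_index simp del: index_mult_mat(1), auto simp: ucol_def)

lemma urow_ucol_mult:
  "i < n \<Longrightarrow> dim_row A = Suc 0 \<Longrightarrow> urow n i * (ucol n j * A) = (if i = j then A else 0\<^sub>m (Suc 0) (dim_col A))"
  by (simp add: mat_assoc[symmetric] urow_ucol mat_one_zero)

lemma unit4_complete:
  "ucol 4 0 * urow 4 0 + ucol 4 (Suc 0) * urow 4 (Suc 0) + ucol 4 2 * urow 4 2 + ucol 4 3 * urow 4 3 = 1\<^sub>m 4"
  by (rule eq_matI) (auto simp: ucol_def urow_def scalar_prod_def)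

definition E4 :: "nat \<Rightarrow> nat \<Rightarrow> complex mat" where
  "E4 i j = ucol 4 i * urow 4 j"

lemma E4_dim [simp]: "dim_row (E4 i j) = 4" "dim_col (E4 i j) = 4"
  by (simp_all add: E4_def)

lemma urow_E4: "i < 4 \<Longrightarrow> urow 4 i * E4 k j = (if i = k then urow 4 j else 0\<^sub>m (Suc 0) 4)"
  "i < 4 \<Longrightarrow> dim_row A = 4 \<Longrightarrow> urow 4 i * (E4 k j * A) = (if i = k then urow 4 j * A else 0\<^sub>m (Suc 0) (dim_col A))"
  by (simp_all add: E4_def mat_assoc urow_ucol_mult)

lemma E4_ucol: "j < 4 \<Longrightarrow> E4 k j * ucol 4 i = (if i = j then ucol 4 k else 0\<^sub>m 4 (Suc 0))"
  "j < 4 \<Longrightarrow> dim_row A = Suc 0 \<Longrightarrow> E4 k j * (ucol 4 i * A) = (if i = j then ucol 4 k * A else 0\<^sub>m 4 (dim_col A))"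
  by (auto simp add: E4_def mat_assoc urow_ucol urow_ucol_mult mat_one_zero)

lemma E4_E4: "j < 4 \<Longrightarrow> E4 i j * E4 k l = (if j = k then E4 i l else 0\<^sub>m 4 4)"
  by (simp add: E4_def mat_assoc urow_ucol_mult mat_one_zero)

text \<open>The basis is \<open>v, \<xi>\<^sub>1 v, \<xi>\<^sub>2 v, \<xi>\<^sub>1 \<xi>\<^sub>2 v\<close>.\<close>

definition P_K :: "nat \<Rightarrow> complex mat" where
  "P_K r = (-1)^r \<cdot>\<^sub>m E4 0 0 + (-((-1)^r)) \<cdot>\<^sub>m E4 (Suc 0) (Suc 0) + (-((-1)^r)) \<cdot>\<^sub>m E4 2 2 + (-1)^r \<cdot>\<^sub>m E4 3 3"
definition P_xi1 :: "complex mat" where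
  "P_xi1 = E4 (Suc 0) 0 + E4 3 2"
definition P_xi2 :: "complex mat" where
  "P_xi2 = E4 2 0 + (-1) \<cdot>\<^sub>m E4 3 (Suc 0)"

definition module_P :: "nat \<Rightarrow> k2_module" where
  "module_P r = generator_module 4 (P_K r) P_xi1 P_xi2"

lemma sign_square: "(-1)^r * (-1)^r = (1 :: complex)"
  by (simp add: power_add[symmetric] power_mult_distrib[symmetric])

lemma relations_P: "relations 4 (P_K r) P_xi1 P_xi2"
proof -
  have one: "1\<^sub>m 4 = E4 0 0 + E4 (Suc 0) (Suc 0) + E4 2 2 + E4 3 3"
    using unit4_complete by (simp add: E4_def)
  show ?thesis
    unfolding relations_def one P_K_def P_xi1_def P_xi2_def
    by (simp add: mat_ring E4_E4 sign_square)
qed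

lemma module_P:
  "module_P r \<in> Rep" "vdim (module_P r) = 4" "opK (module_P r) = P_K r"
  "op1 (module_P r) = P_xi1" "op2 (module_P r) = P_xi2"
  unfolding module_P_def
  by (simp_all add: op_generator_module[OF relations_P] generator_module_Rep[OF relations_P])

lemma P_dim [simp]:
  "dim_row (P_K r) = 4" "dim_col (P_K r) = 4" "dim_row P_xi1 = 4" "dim_col P_xi1 = 4" "dim_row P_xi2 = 4" "dim_col P_xi2 = 4"
  by (simp_all add: P_K_def P_xi1_def P_xi2_def)

lemma P_rules:
  "urow 4 0 * P_K r = (-1)^r \<cdot>\<^sub>m urow 4 0" "urow 4 (Suc 0) * P_K r = (-((-1)^r)) \<cdot>\<^sub>m urow 4 (Suc 0)"
  "urow 4 2 * P_K r = (-((-1)^r)) \<cdot>\<^sub>m urow 4 2" "urow 4 3 * P_K r = (-1)^r \<cdot>\<^sub>m urow 4 3"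
  "urow 4 0 * P_xi1 = 0\<^sub>m (Suc 0) 4" "urow 4 (Suc 0) * P_xi1 = urow 4 0" "urow 4 2 * P_xi1 = 0\<^sub>m (Suc 0) 4"
  "urow 4 3 * P_xi1 = urow 4 2"
  "urow 4 0 * P_xi2 = 0\<^sub>m (Suc 0) 4" "urow 4 (Suc 0) * P_xi2 = 0\<^sub>m (Suc 0) 4" "urow 4 2 * P_xi2 = urow 4 0"
  "urow 4 3 * P_xi2 = (-1) \<cdot>\<^sub>m urow 4 (Suc 0)"
  "P_K r * ucol 4 0 = (-1)^r \<cdot>\<^sub>m ucol 4 0" "P_K r * ucol 4 (Suc 0) = (-((-1)^r)) \<cdot>\<^sub>m ucol 4 (Suc 0)"
  "P_K r * ucol 4 2 = (-((-1)^r)) \<cdot>\<^sub>m ucol 4 2" "P_K r * ucol 4 3 = (-1)^r \<cdot>\<^sub>m ucol 4 3"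
  "P_xi1 * ucol 4 0 = ucol 4 (Suc 0)" "P_xi1 * ucol 4 (Suc 0) = 0\<^sub>m 4 (Suc 0)" "P_xi1 * ucol 4 2 = ucol 4 3"
  "P_xi1 * ucol 4 3 = 0\<^sub>m 4 (Suc 0)"
  "P_xi2 * ucol 4 0 = ucol 4 2" "P_xi2 * ucol 4 (Suc 0) = (-1) \<cdot>\<^sub>m ucol 4 3" "P_xi2 * ucol 4 2 = 0\<^sub>m 4 (Suc 0)"
  "P_xi2 * ucol 4 3 = 0\<^sub>m 4 (Suc 0)"
  by (simp_all add: P_K_def P_xi1_def P_xi2_def mat_ring urow_E4 E4_ucol)

lemma P_rules_mult:
  assumes "dim_row A = Suc 0"
  shows "P_K r * (ucol 4 0 * A) = (-1)^r \<cdot>\<^sub>m (ucol 4 0 * A)" "P_K r * (ucol 4 (Suc 0) * A) = (-((-1)^r)) \<cdot>\<^sub>m (ucol 4 (Suc 0) * A)"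
  "P_K r * (ucol 4 2 * A) = (-((-1)^r)) \<cdot>\<^sub>m (ucol 4 2 * A)" "P_K r * (ucol 4 3 * A) = (-1)^r \<cdot>\<^sub>m (ucol 4 3 * A)"
  "P_xi1 * (ucol 4 0 * A) = ucol 4 (Suc 0) * A" "P_xi1 * (ucol 4 (Suc 0) * A) = 0\<^sub>m 4 (dim_col A)" "P_xi1 * (ucol 4 2 * A) = ucol 4 3 * A"
  "P_xi1 * (ucol 4 3 * A) = 0\<^sub>m 4 (dim_col A)"
  "P_xi2 * (ucol 4 0 * A) = ucol 4 2 * A" "P_xi2 * (ucol 4 (Suc 0) * A) = (-1) \<cdot>\<^sub>m (ucol 4 3 * A)" "P_xi2 * (ucol 4 2 * A) = 0\<^sub>m 4 (dim_col A)"
  "P_xi2 * (ucol 4 3 * A) = 0\<^sub>m 4 (dim_col A)"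
  using assms by (simp_all add: P_K_def P_xi1_def P_xi2_def mat_ring E4_ucol)

text \<open>The map sending the generator v to \<open>m\<close>, and hence xi_1 v to xi_1 m and so
  on. Together, \<open>from_P_Hom\<close> and \<open>from_P_unique\<close> are Frobenius
  reciprocity: P(r) is induced from a character of the subalgebra generated by K.\<close>

definition from_P :: "k2_module \<Rightarrow> complex mat \<Rightarrow> complex mat" where
  "from_P M m = m * urow 4 0 + op1 M * (m * urow 4 (Suc 0)) + op2 M * (m * urow 4 2) + op1 M * (op2 M * (m * urow 4 3))"

lemma from_P_Hom:
  assumes M: "M \<in> Rep" and m: "dim_row m = vdim M" "dim_col m = Suc 0" "opK M * m = (-1)^r \<cdot>\<^sub>m m"
  shows "from_P M m \<in> Hom (module_P r) M"
proof (rule HomI[OF module_P(1) M])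
  note [simp] = Rep_act(1,2)[OF M] m(1,2)
  note rr = relations_rules[OF Rep_relations[OF M]]
  have mK: "opK M * (m * A) = (-1)^r \<cdot>\<^sub>m (m * A)" if "dim_row A = Suc 0" for A
    using mat_assoc_eq[OF m(3), of A] that by (simp add: mat_ring)
  show "dim_row (from_P M m) = vdim M" "dim_col (from_P M m) = vdim (module_P r)"
    by (simp_all add: from_P_def module_P)
  show "from_P M m * opK (module_P r) = opK M * from_P M m"
    by (simp add: from_P_def module_P mat_ring P_rules rr mK)
  show "from_P M m * op1 (module_P r) = op1 M * from_P M m"
    by (simp add: from_P_def module_P mat_ring P_rules rr)
  show "from_P M m * op2 (module_P r) = op2 M * from_P M m"
    by (simp add: from_P_def module_P mat_ring P_rules rr)
qed

lemma from_P_unique: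
  assumes M: "M \<in> Rep" and h: "h \<in> Hom (module_P r) M"
  shows "h = from_P M (h * ucol 4 0)"
proof -
  note [simp] = Rep_act(1,2)[OF M] HomD(1)[OF h] HomD(2)[OF h, unfolded module_P]
  have e1: "op1 M * (h * A) = h * (P_xi1 * A)" "op2 M * (h * A) = h * (P_xi2 * A)" if A: "dim_row A = 4" for A
    using Hom_mult[OF module_P(1) M h, of A k2_xi1, unfolded module_P(2,4), OF A]
      Hom_mult[OF module_P(1) M h, of A k2_xi2, unfolded module_P(2,5), OF A] by simp_all
  have "h = h * 1\<^sub>m 4" by (simp add: mat_ring)
  also have "\<dots> = from_P M (h * ucol 4 0)"
    unfolding unit4_complete[symmetric] from_P_def
    by (simp add: mat_ring e1 P_rules_mult)
  finally show ?thesis .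
qed

lemma surjective_col:
  assumes "surjective T" "dim_row w = dim_row T" "dim_col w = Suc 0"
  obtains m where "dim_row m = dim_col T" "dim_col m = Suc 0" "T * m = w"
proof -
  have "col w 0 \<in> carrier_vec (dim_row T)" by (rule carrier_vecI) (simp add: assms(2))
  then obtain u where u: "u \<in> carrier_vec (dim_col T)" "T *\<^sub>v u = col w 0"
    using assms(1) unfolding surjective_def by blast
  let ?m = "mat (dim_col T) (Suc 0) (\<lambda>(i, _). u $ i)"
  have c: "col ?m 0 = u" using carrier_vecD[OF u(1)] by (intro eq_vecI) auto
  have "T * ?m = w"
  proof (rule eq_matI)
    fix i j assume "i < dim_row w" "j < dim_col w"
    then have "i < dim_row T" "j = 0" using assms by simp_all
    then have "(T * ?m) $$ (i, j) = (T *\<^sub>v u) $ i" by (simp add: c)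
    then show "(T * ?m) $$ (i, j) = w $$ (i, j)"
      using u(2) \<open>i < dim_row w\<close> \<open>j = 0\<close> assms(3) by simp
  qed (use assms in simp_all)
  then show ?thesis using that[of ?m] by simp
qed

lemma module_P_projective: "projective (module_P r)"
  unfolding projective_def
proof (intro conjI ballI impI)
  show "module_P r \<in> Rep" by (rule module_P)
  fix M N g h
  assume M: "M \<in> Rep" and N: "N \<in> Rep" and g: "g \<in> Hom M N" and h: "h \<in> Hom (module_P r) N" and "surjective g"
  note [simp] = Rep_act(1,2)[OF M] Rep_act(1,2)[OF N] HomD(1,2)[OF g] HomD(1)[OF h] HomD(2)[OF h, unfolded module_P]
  let ?s = "(-1)^r :: complex"
  let ?w = "h * ucol 4 0"
  obtain m0 where m0 [simp]: "dim_row m0 = vdim M" "dim_col m0 = Suc 0" and gm0: "g * m0 = ?w"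
    using surjective_col[OF \<open>surjective g\<close>, of ?w] by auto
  \<comment> \<open>Averaging over K turns the preimage into an eigenvector for (-1)^r. Its image is
    unchanged because \<open>?w\<close> is already such an eigenvector.\<close>
  define m where "m = (1/2) \<cdot>\<^sub>m (m0 + ?s \<cdot>\<^sub>m (opK M * m0))"
  have [simp]: "dim_row m = vdim M" "dim_col m = Suc 0" by (simp_all add: m_def)
  have swap: "g * (act M x * Y) = act N x * (g * Y)" if "dim_row Y = vdim M" for x Y
    by (rule Hom_mult[OF M N g that])
  have K: "opK M * m = ?s \<cdot>\<^sub>m m"
    unfolding m_def by (simp add: mat_ring relations_rules[OF Rep_relations[OF M]])
      (rule eq_matI; simp add: sign_square algebra_simps flip: mult.assoc del: index_mult_mat(1))
  have hK: "opK N * ?w = ?s \<cdot>\<^sub>m ?w"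
    using Hom_mult[OF module_P(1) N h, of "ucol 4 0" k2_K]
    by (simp add: module_P mat_ring P_rules)
  have gm: "g * m = ?w"
    unfolding m_def by (simp add: mat_ring swap gm0 hK sign_square)
      (rule eq_matI; simp add: algebra_simps del: index_mult_mat(1))
  have "g * from_P M m = from_P N (g * m)"
    by (simp add: from_P_def mat_ring swap)
  also have "\<dots> = h" using from_P_unique[OF N h] by (simp add: gm)
  finally show "\<exists>k\<in>Hom (module_P r) M. g * k = h"
    using from_P_Hom[OF M _ _ K] by auto
qed

lemma one_by_one: "dim_row (A :: complex mat) = Suc 0 \<Longrightarrow> dim_col A = Suc 0 \<Longrightarrow> A = (A $$ (0, 0)) \<cdot>\<^sub>m 1\<^sub>m (Suc 0)"
  by (rule eq_matI) simp_all

lemma urow_P_Hom: "urow 4 0 \<in> Hom (module_P r) (simple_V r)"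
  by (rule HomI[OF module_P(1) simple_V(1)]) (simp_all add: module_P simple_V P_rules mat_ring)

lemma module_P_cover: "projective_cover (module_P r) (simple_V r)"
proof -
  have "surjective (urow 4 0)"
    by (rule surjectiveI[where R = "ucol 4 0"]) (simp_all add: urow_ucol)
  moreover have "surjective h"
    if N: "N \<in> Rep" and h: "h \<in> Hom N (module_P r)" and s: "surjective (urow 4 0 * h)" for N h
  proof -
    note [simp] = Rep_act(1,2)[OF N] HomD(1)[OF h, unfolded module_P] HomD(2)[OF h]
    obtain u where [simp]: "dim_row u = vdim N" "dim_col u = Suc 0" and u: "urow 4 0 * h * u = 1\<^sub>m (Suc 0)"
      using surjective_col[OF s, of "1\<^sub>m (Suc 0)"] by auto
    have swap: "h * (op1 N * Y) = P_xi1 * (h * Y)" "h * (op2 N * Y) = P_xi2 * (h * Y)" if "dim_row Y = vdim N" for Y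
      using Hom_mult[OF N module_P(1) h that] module_P(4,5) by metis+
    define w where "w = h * u"
    have [simp]: "dim_row w = 4" "dim_col w = Suc 0" by (simp_all add: w_def)
    define c where "c i = (urow 4 i * w) $$ (0, 0)" for i
    have c: "urow 4 i * w = c i \<cdot>\<^sub>m 1\<^sub>m (Suc 0)" for i
      unfolding c_def by (rule one_by_one) simp_all
    have "1\<^sub>m 4 * w = ucol 4 0 + c (Suc 0) \<cdot>\<^sub>m ucol 4 (Suc 0) + c 2 \<cdot>\<^sub>m ucol 4 2 + c 3 \<cdot>\<^sub>m ucol 4 3"
      unfolding unit4_complete[symmetric] using u by (simp add: mat_ring w_def[symmetric] c)
    then have w: "w = ucol 4 0 + c (Suc 0) \<cdot>\<^sub>m ucol 4 (Suc 0) + c 2 \<cdot>\<^sub>m ucol 4 2 + c 3 \<cdot>\<^sub>m ucol 4 3"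
      by (simp add: mat_ring)
    \<comment> \<open>Since w is v plus higher terms, w, xi_1 w, xi_2 w and xi_1 xi_2 w are
      unitriangular in the basis. Back substitution, starting with the socle vector, gives preimages
      of all four basis vectors.\<close>
    define u3 where "u3 = op1 N * (op2 N * u)"
    define u1 where "u1 = op1 N * u + (- c 2) \<cdot>\<^sub>m u3"
    define u2 where "u2 = op2 N * u + c (Suc 0) \<cdot>\<^sub>m u3"
    define u0 where "u0 = u + (- c (Suc 0)) \<cdot>\<^sub>m u1 + (- c 2) \<cdot>\<^sub>m u2 + (- c 3) \<cdot>\<^sub>m u3"
    have [simp]: "dim_row u3 = vdim N" "dim_col u3 = Suc 0" "dim_row u1 = vdim N" "dim_col u1 = Suc 0"
      "dim_row u2 = vdim N" "dim_col u2 = Suc 0" "dim_row u0 = vdim N" "dim_col u0 = Suc 0"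
      by (simp_all add: u3_def u1_def u2_def u0_def)
    have h3: "h * u3 = ucol 4 3"
      unfolding u3_def by (simp add: swap w_def[symmetric]) (simp add: w mat_ring P_rules P_rules_mult)
    have h1: "h * u1 = ucol 4 (Suc 0)"
      unfolding u1_def by (simp add: swap mat_ring w_def[symmetric] h3) (simp add: w mat_ring P_rules, rule eq_matI; simp)
    have h2: "h * u2 = ucol 4 2"
      unfolding u2_def by (simp add: swap mat_ring w_def[symmetric] h3) (simp add: w mat_ring P_rules, rule eq_matI; simp)
    have h0: "h * u0 = ucol 4 0"
      unfolding u0_def by (simp add: mat_ring w_def[symmetric] h1 h2 h3) (simp add: w, rule eq_matI; simp)
    have "h * (u0 * urow 4 0 + u1 * urow 4 (Suc 0) + u2 * urow 4 2 + u3 * urow 4 3) = 1\<^sub>m 4"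
      unfolding unit4_complete[symmetric]
      by (simp add: mat_distrib mat_assoc[symmetric] h0 h1 h2 h3)
    then show ?thesis by (rule surjectiveI) simp_all
  qed
  ultimately show ?thesis
    unfolding projective_cover_def essential_epi_def
    using module_P_projective[of r] urow_P_Hom[of r] by blast
qed

text \<open>P(r) is an exterior algebra on two generators on which \<open>lin a\<close> multiplies
  by the vector a. \<open>?D\<close> is contraction with c, and by the Koszul identity the
  anticommutator is the pairing of a and c.\<close>

lemma module_P_null:
  assumes "fst a * fst c + snd a * snd c = 1"
  shows "null a b 0 (module_P r)"
proof -
  let ?D = "fst c \<cdot>\<^sub>m (E4 0 (Suc 0) + E4 2 3) + snd c \<cdot>\<^sub>m (E4 0 2 + (-1) \<cdot>\<^sub>m E4 (Suc 0) 3)"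
  have one: "1\<^sub>m 4 = E4 0 0 + E4 (Suc 0) (Suc 0) + E4 2 2 + E4 3 3"
    using unit4_complete by (simp add: E4_def)
  have s: "snd a * snd c = 1 - fst a * fst c" using assms by (simp add: algebra_simps)
  have "ac (lin a (module_P r)) ?D = 1\<^sub>m 4"
    unfolding one lin_def ac_def module_P P_xi1_def P_xi2_def
    by (simp add: mat_ring E4_E4) (rule eq_matI; simp add: s algebra_simps)
  then show ?thesis
    unfolding null_def module_P using lin_dim[OF module_P(1), of _ r, unfolded module_P]
    by (intro exI[of _ "\<lambda>m. if m = 0 then 0\<^sub>m 4 4 else ?D"]) (simp add: ac_zero mat_ring)
qed

subsection \<open>Matrix pencils\<close>

definition pencil_module :: "nat \<Rightarrow> nat \<Rightarrow> complex mat \<Rightarrow> complex mat \<Rightarrow> k2_module" where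
  "pencil_module n r A B = generator_module (2 * n) (M_K n r) (e_to_f n A) (e_to_f n B)"

definition pencil_K :: "nat \<Rightarrow> nat \<Rightarrow> complex mat" where
  "pencil_K n r = (-((-1)^r)) \<cdot>\<^sub>m (in1 n n * pr1 n n) + (-1)^r \<cdot>\<^sub>m (in2 n n * pr2 n n)"

lemma pencil_K_dim [simp]: "dim_row (pencil_K n r) = n + n" "dim_col (pencil_K n r) = n + n"
  by (simp_all add: pencil_K_def)

lemma M_K_eq: "M_K n r = pencil_K n r"
  unfolding M_K_def pencil_K_def
  by (subst four_block_in_pr[of _ n n _ n n]) (simp_all add: mat_ring)

lemma e_to_f_eq:
  assumes "dim_row A = n" "dim_col A = n"
  shows "e_to_f n A = in2 n n * (A * pr1 n n)"
  unfolding e_to_f_def using assms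
  by (subst four_block_in_pr[of _ n n _ n n]) (simp_all add: mat_ring)

lemma relations_pencil:
  assumes [simp]: "dim_row A = n" "dim_col A = n" "dim_row B = n" "dim_col B = n"
  shows "relations (2 * n) (M_K n r) (e_to_f n A) (e_to_f n B)"
  unfolding relations_def M_K_eq mult_2 pencil_K_def
  by (simp add: e_to_f_eq mat_ring in_pr in_pr_eqs sign_square)

lemma pencil_module:
  assumes [simp]: "dim_row A = n" "dim_col A = n" "dim_row B = n" "dim_col B = n"
  shows "pencil_module n r A B \<in> Rep" "vdim (pencil_module n r A B) = n + n"
    "opK (pencil_module n r A B) = pencil_K n r"
    "op1 (pencil_module n r A B) = in2 n n * (A * pr1 n n)" "op2 (pencil_module n r A B) = in2 n n * (B * pr1 n n)"
proof -
  have rel: "relations (n + n) (pencil_K n r) (in2 n n * (A * pr1 n n)) (in2 n n * (B * pr1 n n))"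
    using relations_pencil[of A n B r] by (simp add: M_K_eq e_to_f_eq mult_2)
  show "pencil_module n r A B \<in> Rep" "vdim (pencil_module n r A B) = n + n"
    "opK (pencil_module n r A B) = pencil_K n r"
    "op1 (pencil_module n r A B) = in2 n n * (A * pr1 n n)" "op2 (pencil_module n r A B) = in2 n n * (B * pr1 n n)"
    unfolding pencil_module_def
    by (simp_all add: M_K_eq e_to_f_eq mult_2 op_generator_module[OF rel] generator_module_Rep[OF rel])
qed

lemma pencil_Hom:
  assumes [simp]: "dim_row A = n" "dim_col A = n" "dim_row B = n" "dim_col B = n"
    "dim_row A' = n" "dim_col A' = n" "dim_row B' = n" "dim_col B' = n"
    "dim_row P = n" "dim_col P = n" "dim_row Q = n" "dim_col Q = n"
    and eq: "Q * A = A' * P" "Q * B = B' * P"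
  shows "in1 n n * (P * pr1 n n) + in2 n n * (Q * pr2 n n) \<in> Hom (pencil_module n r A B) (pencil_module n r A' B')"
proof -
  have e: "Q * (A * X) = A' * (P * X)" "Q * (B * X) = B' * (P * X)" if "dim_row X = n" for X
    using that by (simp_all add: mat_assoc_eq[OF eq(1)] mat_assoc_eq[OF eq(2)] mat_assoc)
  show ?thesis
    by (rule HomI) (simp_all add: pencil_module pencil_K_def mat_ring in_pr e)
qed

lemma pencil_iso:
  assumes [simp]: "dim_row A = n" "dim_col A = n" "dim_row B = n" "dim_col B = n"
    "dim_row A' = n" "dim_col A' = n" "dim_row B' = n" "dim_col B' = n"
    "dim_row P = n" "dim_col P = n" "dim_row Q = n" "dim_col Q = n"
    "dim_row P' = n" "dim_col P' = n" "dim_row Q' = n" "dim_col Q' = n"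
    and eq: "Q * A = A' * P" "Q * B = B' * P" and PP: "P * P' = 1\<^sub>m n" and QQ: "Q * Q' = 1\<^sub>m n"
  shows "module_iso (pencil_module n r A B) (pencil_module n r A' B')"
proof -
  have P'P: "P' * P = 1\<^sub>m n" and Q'Q: "Q' * Q = 1\<^sub>m n"
    using PP QQ by (auto intro: mat_mult_left_right_inverse simp: carrier_dim)
  have inv: "Q' * C' = C * P'" if "Q * C = C' * P" "dim_row C = n" "dim_col C = n" "dim_row C' = n" "dim_col C' = n" for C C'
  proof -
    have "Q' * C' = Q' * (C' * (P * P'))" using that(2-) by (simp add: PP mat_ring)
    also have "\<dots> = Q' * ((C' * P) * P')" using that(2-) by (simp add: mat_assoc)
    also have "\<dots> = Q' * (Q * (C * P'))" unfolding that(1)[symmetric] using that(2-) by (simp add: mat_assoc)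
    also have "\<dots> = C * P'" using that(2-) by (simp add: mat_assoc_eq[OF Q'Q] mat_ring)
    finally show ?thesis .
  qed
  let ?S = "in1 n n * (P * pr1 n n) + in2 n n * (Q * pr2 n n)"
  let ?T = "in1 n n * (P' * pr1 n n) + in2 n n * (Q' * pr2 n n)"
  have "?S \<in> Hom (pencil_module n r A B) (pencil_module n r A' B')"
    by (rule pencil_Hom) (simp_all add: eq)
  moreover have "?T \<in> Hom (pencil_module n r A' B') (pencil_module n r A B)"
    by (rule pencil_Hom) (simp_all add: inv[OF eq(1)] inv[OF eq(2)])
  moreover have "?S * ?T = 1\<^sub>m (n + n)"
    by (simp add: mat_ring in_pr mat_assoc_eq[OF PP] mat_assoc_eq[OF QQ] in_pr_eqs)
  moreover have "?T * ?S = 1\<^sub>m (n + n)"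
    by (simp add: mat_ring in_pr mat_assoc_eq[OF P'P] mat_assoc_eq[OF Q'Q] in_pr_eqs)
  ultimately show ?thesis
    unfolding module_iso_def by (auto simp: pencil_module)
qed

lemma lin_pencil:
  assumes [simp]: "dim_row A = n" "dim_col A = n" "dim_row B = n" "dim_col B = n"
  shows "lin c (pencil_module n r A B) = in2 n n * ((fst c \<cdot>\<^sub>m A + snd c \<cdot>\<^sub>m B) * pr1 n n)"
  by (simp add: lin_def pencil_module mat_ring)

subsection \<open>The points of the modules \<open>M\<^sub>n(r, \<eta>)\<close>\<close>

text \<open>The signs make \<xi>(t) act on M_n(r, \<eta>) by the block N - t at every point, N being
  the nilpotent shift; see \<open>module_M_lin\<close>.\<close>

fun pt_a :: "cp1 \<Rightarrow> complex \<times> complex" where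
  "pt_a (Finite_Point c) = (- c, 1)" | "pt_a Infinite_Point = (1, 0)"
fun pt_b :: "cp1 \<Rightarrow> complex \<times> complex" where
  "pt_b (Finite_Point c) = (-1, 0)" | "pt_b Infinite_Point = (0, -1)"

abbreviation null_at :: "cp1 \<Rightarrow> nat \<Rightarrow> k2_module \<Rightarrow> bool" where
  "null_at \<eta> \<equiv> null (pt_a \<eta>) (pt_b \<eta>)"

text \<open>The k-th power of the nilpotent Jordan block of size n.\<close>

definition shift :: "nat \<Rightarrow> nat \<Rightarrow> complex mat" where
  "shift n k = mat n n (\<lambda>(i, j). if j = i + k then 1 else 0)"

lemma shift_dim [simp]: "dim_row (shift n k) = n" "dim_col (shift n k) = n"
  by (simp_all add: shift_def)

lemma shift_0: "shift n 0 = 1\<^sub>m n" and shift_n: "shift n n = 0\<^sub>m n n"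
  by (rule eq_matI; auto simp: shift_def)+

lemma shift_mult: "shift n k * shift n l = shift n (k + l)"
proof (rule eq_matI)
  fix i j assume "i < dim_row (shift n (k + l))" "j < dim_col (shift n (k + l))"
  then have ij: "i < n" "j < n" by simp_all
  show "(shift n k * shift n l) $$ (i, j) = shift n (k + l) $$ (i, j)"
    using ij by (auto simp add: scalar_prod_def shift_def if_distrib[of "\<lambda>x. x * _"] cong: if_cong)
qed simp_all

lemma jordan_block_shift: "jordan_block n c = shift n (Suc 0) + c \<cdot>\<^sub>m 1\<^sub>m n"
  by (rule eq_matI) (auto simp: shift_def)

lemma module_M_pencil:
  "module_M n r (Finite_Point c) = pencil_module n r (1\<^sub>m n) (jordan_block n c)"
  "module_M n r Infinite_Point = pencil_module n r (jordan_block n 0) (1\<^sub>m n)"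
  by (simp_all add: pencil_module_def)

lemma module_M:
  "module_M n r \<eta> \<in> Rep" "vdim (module_M n r \<eta>) = n + n" "opK (module_M n r \<eta>) = pencil_K n r"
  by (cases \<eta>; simp add: module_M_pencil pencil_module del: module_M.simps)+

lemma module_M_lin:
  "lin (pt_a \<eta>) (module_M n r \<eta>) = in2 n n * (shift n (Suc 0) * pr1 n n)"
  "lin (pt_b \<eta>) (module_M n r \<eta>) = (-1) \<cdot>\<^sub>m (in2 n n * pr1 n n)"
  by (cases \<eta>; simp add: module_M_pencil lin_pencil jordan_block_shift mat_ring del: module_M.simps;
      rule eq_matI; simp add: algebra_simps del: index_mult_mat(1))+

lemma det_nonzero_inverse:
  fixes A :: "complex mat"
  assumes "dim_row A = n" "dim_col A = n" "det A \<noteq> 0"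
  obtains B where "dim_row B = n" "dim_col B = n" "A * B = 1\<^sub>m n" "B * A = 1\<^sub>m n"
proof -
  have A: "A \<in> carrier_mat n n" using assms by (simp add: carrier_dim)
  obtain B where "B \<in> carrier_mat n n" "A * B = 1\<^sub>m n" "B * A = 1\<^sub>m n"
    using det_non_zero_imp_unit[OF A assms(3)] by (auto simp: Units_def ring_mat_def)
  then show ?thesis using that by (auto simp: carrier_dim)
qed

lemma triangular_inverse:
  fixes A :: "complex mat"
  assumes "dim_row A = n" "dim_col A = n" "\<And>i j. j < i \<Longrightarrow> i < n \<Longrightarrow> A $$ (i, j) = 0" "\<And>i. i < n \<Longrightarrow> A $$ (i, i) \<noteq> 0"
  obtains B where "dim_row B = n" "dim_col B = n" "A * B = 1\<^sub>m n" "B * A = 1\<^sub>m n"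
proof -
  have A: "A \<in> carrier_mat n n" using assms by (simp add: carrier_dim)
  have "det A = prod_list (diag_mat A)"
    by (rule det_upper_triangular[OF _ A]) (use assms in auto)
  also have "\<dots> \<noteq> 0"
    using assms by (auto simp: diag_mat_def prod_list_zero_iff)
  finally show ?thesis by (rule det_nonzero_inverse[OF assms(1,2)]) (rule that)
qed

text \<open>Away from \<eta> the constant term of the pencil is triangular with nonzero diagonal, so
  its inverse gives a homotopy at order 0.\<close>

lemma module_M_other_point:
  assumes "\<eta>' \<noteq> \<eta>"
  shows "null_at \<eta>' 0 (module_M n r \<eta>)"
proof -
  let ?M = "module_M n r \<eta>"
  have "\<exists>A. lin (pt_a \<eta>') ?M = in2 n n * (A * pr1 n n) \<and> dim_row A = n \<and> dim_col A = n \<and>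
    (\<forall>i j. j < i \<longrightarrow> i < n \<longrightarrow> A $$ (i, j) = 0) \<and> (\<forall>i<n. A $$ (i, i) \<noteq> 0)"
  proof (cases \<eta>)
    case (Finite_Point c)
    show ?thesis
      unfolding Finite_Point module_M_pencil lin_pencil[of "1\<^sub>m n" n "jordan_block n c", simplified]
      by (rule exI[of _ "fst (pt_a \<eta>') \<cdot>\<^sub>m 1\<^sub>m n + snd (pt_a \<eta>') \<cdot>\<^sub>m jordan_block n c"])
        (use assms Finite_Point in \<open>cases \<eta>'; auto\<close>)
  next
    case Infinite_Point
    show ?thesis
      unfolding Infinite_Point module_M_pencil lin_pencil[of "jordan_block n 0" n "1\<^sub>m n", simplified]
      by (rule exI[of _ "fst (pt_a \<eta>') \<cdot>\<^sub>m jordan_block n 0 + snd (pt_a \<eta>') \<cdot>\<^sub>m 1\<^sub>m n"])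
        (use assms Infinite_Point in \<open>cases \<eta>'; auto\<close>)
  qed
  then obtain A where A: "lin (pt_a \<eta>') ?M = in2 n n * (A * pr1 n n)" and [simp]: "dim_row A = n" "dim_col A = n"
    and "\<And>i j. j < i \<Longrightarrow> i < n \<Longrightarrow> A $$ (i, j) = 0" "\<And>i. i < n \<Longrightarrow> A $$ (i, i) \<noteq> 0" by blast
  then obtain B where [simp]: "dim_row B = n" "dim_col B = n" and B: "A * B = 1\<^sub>m n" "B * A = 1\<^sub>m n"
    using triangular_inverse[of A n] by metis
  let ?H = "in1 n n * (B * pr2 n n)"
  have "ac (lin (pt_a \<eta>') ?M) ?H = 1\<^sub>m (n + n)"
    unfolding A ac_def in_pr_eqs(5)[symmetric]
    by (simp add: mat_ring in_pr mat_assoc_eq[OF B(1)] mat_assoc_eq[OF B(2)])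
      (rule eq_matI; simp del: index_mult_mat(1))
  then show ?thesis
    unfolding null_def module_M using lin_dim[OF module_M(1), unfolded module_M]
    by (intro exI[of _ "\<lambda>m. if m = 0 then 0\<^sub>m (n + n) (n + n) else ?H"]) (simp add: ac_zero mat_ring)
qed

lemma module_M_null: "null_at \<eta> n (module_M n r \<eta>)"
proof -
  let ?M = "module_M n r \<eta>"
  \<comment> \<open>The coefficients of t^n (N - t)^(-1), which is minus the sum of N^i t^(n-1-i)
    over i < n.\<close>
  define h where "h m = (if m < n then (-1) \<cdot>\<^sub>m shift n (n - Suc m) else 0\<^sub>m n n)" for m
  have [simp]: "dim_row (h m) = n" "dim_col (h m) = n" for m by (simp_all add: h_def)
  define H where "H m = (case m of 0 \<Rightarrow> 0\<^sub>m (n + n) (n + n) | Suc m \<Rightarrow> in1 n n * (h m * pr2 n n))" for m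
  have [simp]: "dim_row (H m) = n + n" "dim_col (H m) = n + n" for m by (simp_all add: H_def split: nat.split)
  have a: "ac (lin (pt_a \<eta>) ?M) (H (Suc m)) =
      in2 n n * ((if m < n then (-1) \<cdot>\<^sub>m shift n (n - m) else 0\<^sub>m n n) * pr2 n n) +
      in1 n n * ((if m < n then (-1) \<cdot>\<^sub>m shift n (n - m) else 0\<^sub>m n n) * pr1 n n)" for m
    unfolding module_M_lin ac_def H_def h_def
    by (simp add: mat_ring in_pr mat_assoc_eq[OF shift_mult] Suc_diff_Suc)
  have b: "ac (lin (pt_b \<eta>) ?M) (H (Suc m)) =
      (-1) \<cdot>\<^sub>m (in2 n n * (h m * pr2 n n)) + (-1) \<cdot>\<^sub>m (in1 n n * (h m * pr1 n n))" for m
    unfolding module_M_lin ac_def H_def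
    by (simp add: mat_ring in_pr)
  have "ac (lin (pt_a \<eta>) ?M) (H (Suc m)) + ac (lin (pt_b \<eta>) ?M) (H m) =
      (if m = n then 1\<^sub>m (n + n) else 0\<^sub>m (n + n) (n + n))" if "m \<le> n" for m
  proof (cases m)
    case 0
    have "ac (lin (pt_b \<eta>) ?M) (H m) = 0\<^sub>m (n + n) (n + n)"
      using lin_dim[OF module_M(1), unfolded module_M] by (simp add: 0 H_def ac_zero)
    moreover have "ac (lin (pt_a \<eta>) ?M) (H (Suc m)) = 0\<^sub>m (n + n) (n + n)"
      unfolding a by (simp add: 0 shift_n mat_ring)
    moreover have "1\<^sub>m (n + n) = (0\<^sub>m (n + n) (n + n) :: complex mat)" if "m = n"
      using that 0 by (intro eq_matI) auto
    ultimately show ?thesis by (auto simp: mat_ring)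
  next
    case (Suc l)
    show ?thesis
    proof (cases "m = n")
      case True
      then show ?thesis
        unfolding Suc a b[of l] using Suc
        by (simp add: h_def shift_0 mat_ring in_pr_eqs(5)[symmetric]) (rule eq_matI; simp del: index_mult_mat(1))
    next
      case False
      then show ?thesis
        unfolding Suc a b[of l] using Suc that
        by (simp add: h_def mat_ring) (rule eq_matI; simp del: index_mult_mat(1))
    qed
  qed
  then show ?thesis
    unfolding null_def module_M
    by (intro exI[of _ H]) (simp add: H_def[of 0])
qed

text \<open>The data of \<open>null_obstruction\<close>, with the value \<open>w 0 * v\<close> that
  nullity forces to be 0 prescribed as 1. They are bundled because they multiply under tensor
  products, see \<open>tensor_cocycle\<close>.\<close>

definition cocycle :: "cp1 \<Rightarrow> nat \<Rightarrow> k2_module \<Rightarrow> complex mat \<Rightarrow> (nat \<Rightarrow> complex mat) \<Rightarrow> bool" where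
  "cocycle \<eta> n X v w \<longleftrightarrow> dim_row v = vdim X \<and> dim_col v = Suc 0 \<and> op1 X * v = 0\<^sub>m (vdim X) (Suc 0) \<and>
     op2 X * v = 0\<^sub>m (vdim X) (Suc 0) \<and>
     (\<forall>m. dim_row (w m) = Suc 0 \<and> dim_col (w m) = vdim X) \<and> w 0 * lin (pt_a \<eta>) X = 0\<^sub>m (Suc 0) (vdim X) \<and>
     (\<forall>m<n. w (Suc m) * lin (pt_a \<eta>) X = (-1) \<cdot>\<^sub>m (w m * lin (pt_b \<eta>) X)) \<and> w 0 * v = 1\<^sub>m (Suc 0)"

lemma cocycle_not_null:
  assumes "X \<in> Rep" "cocycle \<eta> n X v w"
  shows "\<not> null_at \<eta> n X"
proof
  assume "null_at \<eta> n X"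
  then have "w 0 * v = 0\<^sub>m (Suc 0) (Suc 0)"
    using assms unfolding cocycle_def by (intro null_obstruction[of X "pt_a \<eta>" "pt_b \<eta>" n]) auto
  then have "(1\<^sub>m (Suc 0) :: complex mat) $$ (0, 0) = 0\<^sub>m (Suc 0) (Suc 0) $$ (0, 0)"
    using assms(2) unfolding cocycle_def by simp
  then show False by simp
qed

lemma urow_shift: "i < n \<Longrightarrow> urow n i * shift n (Suc 0) = (if Suc i < n then urow n (Suc i) else 0\<^sub>m (Suc 0) n)"
  by (rule eq_matI) (auto simp: urow_index simp del: index_mult_mat(1), auto simp: urow_def shift_def)

text \<open>The last unit row is killed by N, and N carries every other unit row to the next one.
  Reading the k rows from the bottom up therefore gives w(t) (N - t) = 0 modulo t^k, which is why n
  < k is required; v is the last f_k.\<close>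

lemma module_M_cocycle:
  assumes "n < k"
  shows "cocycle \<eta> n (module_M k r \<eta>) (in2 k k * ucol k (k - 1)) (\<lambda>m. urow k (k - Suc m) * pr2 k k)"
proof -
  have z: "op1 (module_M k r \<eta>) * (in2 k k * ucol k (k - Suc 0)) = 0\<^sub>m (k + k) (Suc 0)"
    "op2 (module_M k r \<eta>) * (in2 k k * ucol k (k - Suc 0)) = 0\<^sub>m (k + k) (Suc 0)"
    by (cases \<eta>; simp add: module_M_pencil pencil_module mat_ring in_pr del: module_M.simps)+
  have s: "urow k (k - Suc (Suc m)) * shift k (Suc 0) = urow k (k - Suc m)" if "m < n" for m
    using that assms by (subst urow_shift) (auto simp: Suc_diff_Suc)
  have "urow k (k - Suc 0) * shift k (Suc 0) = 0\<^sub>m (Suc 0) k"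
    using assms by (subst urow_shift) auto
  then show ?thesis
    using assms
    unfolding cocycle_def module_M module_M_lin
    by (simp add: z mat_ring in_pr urow_ucol mat_assoc_eq[OF s])
       (simp add: mat_assoc[symmetric] mat_one_zero)
qed

text \<open>Starts with \<open>f 0\<close> rather than with a zero matrix, whose dimensions would
  have to be carried along.\<close>

primrec msum :: "(nat \<Rightarrow> complex mat) \<Rightarrow> nat \<Rightarrow> complex mat" where
  "msum f 0 = f 0" | "msum f (Suc n) = msum f n + f (Suc n)"

lemma msum_dim:
  assumes "\<And>m. dim_row (f m) = a" "\<And>m. dim_col (f m) = b"
  shows "dim_row (msum f n) = a" "dim_col (msum f n) = b"
  by (induction n) (simp_all add: assms)

lemma msum_mult:
  assumes "\<And>m. dim_row (f m) = a" "\<And>m. dim_col (f m) = b" "dim_row X = b"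
  shows "msum f n * X = msum (\<lambda>m. f m * X) n"
  by (induction n) (simp_all add: mat_distrib assms msum_dim[OF assms(1,2)])

lemma msum_smult:
  assumes "\<And>m. dim_row (f m) = a" "\<And>m. dim_col (f m) = b"
  shows "c \<cdot>\<^sub>m msum f n = msum (\<lambda>m. c \<cdot>\<^sub>m f m) n"
  by (induction n) (simp_all add: mat_one_zero assms msum_dim[OF assms(1,2)])

lemma msum_add:
  assumes "\<And>m. dim_row (f m) = a" "\<And>m. dim_col (f m) = b" "\<And>m. dim_row (g m) = a" "\<And>m. dim_col (g m) = b"
  shows "msum (\<lambda>m. f m + g m) n = msum f n + msum g n"
proof (induction n)
  case (Suc n)
  then show ?case
    by simp (rule eq_matI; simp add: assms msum_dim[OF assms(1,2)] msum_dim[OF assms(3,4)])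
qed simp

lemma msum_cong: "(\<And>m. m \<le> n \<Longrightarrow> f m = g m) \<Longrightarrow> msum f n = msum g n"
  by (induction n) auto

lemma msum_shift:
  assumes "\<And>m. dim_row (f m) = a" "\<And>m. dim_col (f m) = b"
  shows "msum f (Suc n) = f 0 + msum (\<lambda>m. f (Suc m)) n"
proof (induction n)
  case (Suc n)
  then show ?case
    by simp (rule eq_matI; simp add: assms msum_dim[of "\<lambda>m. f (Suc m)", OF assms])
qed simp

text \<open>Take the product w(t) \<otimes> w'(t) of power series. Each w_i is an eigenrow of K with
  the same eigenvalue s, so K \<otimes> \<xi> contributes s times the recursion of w' and \<xi>
  \<otimes> 1 the recursion of w.\<close>

lemma tensor_cocycle:
  assumes V: "V \<in> Rep" and X: "X \<in> Rep" and c1: "cocycle \<eta> n V v w" and c2: "cocycle \<eta> n X v' w'"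
    and K: "\<And>m. w m * opK V = s \<cdot>\<^sub>m w m"
  shows "cocycle \<eta> n (tensor_module V X) (kronecker v v') (\<lambda>m. msum (\<lambda>i. kronecker (w i) (w' (m - i))) m)"
proof -
  note t = tensor_module[OF V X]
  note [simp] = Rep_act(1,2)[OF V] Rep_act(1,2)[OF X] lin_dim[OF V] lin_dim[OF X]
  have [simp]: "dim_row v = vdim V" "dim_col v = Suc 0" "dim_row (w m) = Suc 0" "dim_col (w m) = vdim V"
    "dim_row v' = vdim X" "dim_col v' = Suc 0" "dim_row (w' m) = Suc 0" "dim_col (w' m) = vdim X" for m
    using c1 c2 by (simp_all add: cocycle_def)
  let ?a = "pt_a \<eta>" and ?b = "pt_b \<eta>" and ?N = "vdim V * vdim X"
  have c: "op1 V * v = 0\<^sub>m (vdim V) (Suc 0)" "op2 V * v = 0\<^sub>m (vdim V) (Suc 0)" "w 0 * lin ?a V = 0\<^sub>m (Suc 0) (vdim V)"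
     "w 0 * v = 1\<^sub>m (Suc 0)" "op1 X * v' = 0\<^sub>m (vdim X) (Suc 0)" "op2 X * v' = 0\<^sub>m (vdim X) (Suc 0)" "w' 0 * lin ?a X = 0\<^sub>m (Suc 0) (vdim X)"
     "w' 0 * v' = 1\<^sub>m (Suc 0)" using c1 c2 by (simp_all add: cocycle_def)
  have s1: "w (Suc m) * lin ?a V = (-1) \<cdot>\<^sub>m (w m * lin ?b V)" "w' (Suc m) * lin ?a X = (-1) \<cdot>\<^sub>m (w' m * lin ?b X)" if "m < n" for m
    using c1 c2 that by (simp_all add: cocycle_def)
  define W where "W m = msum (\<lambda>i. kronecker (w i) (w' (m - i))) m" for m
  have W_dim [simp]: "dim_row (W m) = Suc 0" "dim_col (W m) = ?N" for m
    unfolding W_def by (rule msum_dim; simp)+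
  have Wlin: "W m * lin d (tensor_module V X) =
      s \<cdot>\<^sub>m msum (\<lambda>i. kronecker (w i) (w' (m - i) * lin d X)) m + msum (\<lambda>i. kronecker (w i * lin d V) (w' (m - i))) m" for m d
  proof -
    have "W m * lin d (tensor_module V X) =
      msum (\<lambda>i. s \<cdot>\<^sub>m kronecker (w i) (w' (m - i) * lin d X) + kronecker (w i * lin d V) (w' (m - i))) m"
      unfolding W_def lin_tensor[OF V X]
      by (subst msum_mult[of _ "Suc 0" ?N])
        (simp_all add: mat_ring kronecker_mult K kronecker_linear)
    also have "\<dots> = s \<cdot>\<^sub>m msum (\<lambda>i. kronecker (w i) (w' (m - i) * lin d X)) m + msum (\<lambda>i. kronecker (w i * lin d V) (w' (m - i))) m"
      by (subst msum_add[of _ "Suc 0" ?N]) (simp_all add: msum_smult[of _ "Suc 0" ?N])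
    finally show ?thesis .
  qed
  have "W (Suc m) * lin ?a (tensor_module V X) = (-1) \<cdot>\<^sub>m (W m * lin ?b (tensor_module V X))" if m: "m < n" for m
  proof -
    have "msum (\<lambda>i. kronecker (w i) (w' (Suc m - i) * lin ?a X)) (Suc m) =
        msum (\<lambda>i. kronecker (w i) (w' (Suc m - i) * lin ?a X)) m"
      by (simp add: c kronecker_linear) (rule mat_one_zero(5); rule msum_dim; simp)
    also have "\<dots> = msum (\<lambda>i. (-1) \<cdot>\<^sub>m kronecker (w i) (w' (m - i) * lin ?b X)) m"
      using m by (intro msum_cong) (simp add: Suc_diff_le s1 kronecker_linear)
    finally have 1: "msum (\<lambda>i. kronecker (w i) (w' (Suc m - i) * lin ?a X)) (Suc m) =
      (-1) \<cdot>\<^sub>m msum (\<lambda>i. kronecker (w i) (w' (m - i) * lin ?b X)) m"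
      by (simp add: msum_smult[of _ "Suc 0" ?N])
    have "msum (\<lambda>i. kronecker (w i * lin ?a V) (w' (Suc m - i))) (Suc m) =
        msum (\<lambda>i. kronecker (w (Suc i) * lin ?a V) (w' (m - i))) m"
      by (subst msum_shift[of _ "Suc 0" ?N]) (simp_all add: c kronecker_linear mat_one_zero msum_dim[of _ "Suc 0" ?N])
    also have "\<dots> = msum (\<lambda>i. (-1) \<cdot>\<^sub>m kronecker (w i * lin ?b V) (w' (m - i))) m"
      using m by (intro msum_cong) (simp add: s1 kronecker_linear)
    finally have 2: "msum (\<lambda>i. kronecker (w i * lin ?a V) (w' (Suc m - i))) (Suc m) =
      (-1) \<cdot>\<^sub>m msum (\<lambda>i. kronecker (w i * lin ?b V) (w' (m - i))) m"
      by (simp add: msum_smult[of _ "Suc 0" ?N])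
    show ?thesis
      unfolding Wlin 1 2
      by (simp add: mat_one_zero msum_dim[of _ "Suc 0" ?N] mult.commute)
  qed
  moreover have "W 0 * lin ?a (tensor_module V X) = 0\<^sub>m (Suc 0) ?N"
    unfolding Wlin by (simp add: c kronecker_linear mat_one_zero)
  moreover have "W 0 * kronecker v v' = 1\<^sub>m (Suc 0)"
    by (simp add: W_def kronecker_mult c kronecker_one)
  ultimately show ?thesis
    unfolding cocycle_def W_def[symmetric] t
    by (simp add: mat_distrib kronecker_mult c kronecker_linear mat_one_zero)
qed

lemma tensor_MM_not_null:
  assumes "n < j" "n < k"
  shows "\<not> null_at \<eta> n (tensor_module (module_M j r \<eta>) (module_M k r' \<eta>))"
proof (rule cocycle_not_null)
  show "tensor_module (module_M j r \<eta>) (module_M k r' \<eta>) \<in> Rep" by (rule tensor_module(1)[OF module_M(1) module_M(1)])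
  show "cocycle \<eta> n (tensor_module (module_M j r \<eta>) (module_M k r' \<eta>))
     (kronecker (in2 j j * ucol j (j - 1)) (in2 k k * ucol k (k - 1)))
     (\<lambda>m. msum (\<lambda>i. kronecker (urow j (j - Suc i) * pr2 j j) (urow k (k - Suc (m - i)) * pr2 k k)) m)"
    by (rule tensor_cocycle[OF module_M(1) module_M(1) module_M_cocycle[OF assms(1)] module_M_cocycle[OF assms(2)], where s = "(-1)^r"])
      (simp add: module_M pencil_K_def mat_ring in_pr)
qed

lemma module_M_null_iff: "null_at \<eta> n (module_M k r \<eta>) \<longleftrightarrow> k \<le> n"
  using cocycle_not_null[OF module_M(1) module_M_cocycle] null_mono[OF module_M(1) module_M_null]
  by (metis not_le)

text \<open>The contraction on the left factor has to anticommute with \<open>K\<close>, so it is replaced by its odd part.\<close>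

lemma null_tensor_left:
  assumes V: "V \<in> Rep" and X: "X \<in> Rep" and "null a b n V"
  shows "null a b n (tensor_module V X)"
proof (rule null_transfer[OF V assms(3)])
  let ?K = "opK V"
  note [simp] = lin_dim[OF V] lin_dim[OF X] Rep_act(1,2)[OF V] Rep_act(1,2)[OF X]
  note KK = relations_rules(1,7)[OF Rep_relations[OF V]]
  define odd_part where "odd_part H = (1/2) \<cdot>\<^sub>m (H + (-1) \<cdot>\<^sub>m (?K * (H * ?K)))" for H
  define even_part where "even_part H = (1/2) \<cdot>\<^sub>m (H + ?K * (H * ?K))" for H
  have lK: "?K * (lin c V * Y) = (-1) \<cdot>\<^sub>m (lin c V * (?K * Y))" if "dim_row Y = vdim V" for c Y
    using mat_assoc_eq[OF lin_K[OF V, of c], of Y] that by (simp add: mat_ring)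
  show "ac (lin c (tensor_module V X)) (kronecker (odd_part H) (1\<^sub>m (vdim X))) = kronecker (even_part (ac (lin c V) H)) (1\<^sub>m (vdim X))"
    if [simp]: "dim_row H = vdim V" "dim_col H = vdim V" for c H
  proof -
    have [simp]: "dim_row (odd_part H) = vdim V" "dim_col (odd_part H) = vdim V" by (simp_all add: odd_part_def)
    have "?K * odd_part H = (-1) \<cdot>\<^sub>m (odd_part H * ?K)"
      unfolding odd_part_def by (simp add: mat_ring KK) (rule eq_matI; simp add: algebra_simps del: index_mult_mat(1))
    then have "ac (lin c (tensor_module V X)) (kronecker (odd_part H) (1\<^sub>m (vdim X))) = kronecker (ac (lin c V) (odd_part H)) (1\<^sub>m (vdim X))"
      unfolding lin_tensor[OF V X] ac_def
      by (simp add: mat_ring kronecker_mult kronecker_linear) (rule eq_matI; simp add: algebra_simps del: kronecker_index)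
    moreover have "ac (lin c V) (odd_part H) = even_part (ac (lin c V) H)"
      unfolding ac_def odd_part_def even_part_def
      by (simp add: mat_ring lin_K[OF V] lK) (rule eq_matI; simp add: algebra_simps del: index_mult_mat(1))
    ultimately show ?thesis by simp
  qed
  show "kronecker (even_part (A + B)) (1\<^sub>m (vdim X)) = kronecker (even_part A) (1\<^sub>m (vdim X)) + kronecker (even_part B) (1\<^sub>m (vdim X))"
    if [simp]: "dim_row A = vdim V" "dim_col A = vdim V" "dim_row B = vdim V" "dim_col B = vdim V" for A B
  proof -
    have "even_part (A + B) = even_part A + even_part B"
      unfolding even_part_def by (simp add: mat_ring) (rule eq_matI; simp add: algebra_simps del: index_mult_mat(1))
    moreover have "dim_row (even_part A) = dim_row (even_part B)" "dim_col (even_part A) = dim_col (even_part B)"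
      by (simp_all add: even_part_def)
    ultimately show ?thesis by (simp add: kronecker_linear)
  qed
  have "even_part (1\<^sub>m (vdim V)) = 1\<^sub>m (vdim V)"
    by (simp add: even_part_def mat_ring KK) (rule eq_matI; simp)
  then show "kronecker (even_part (1\<^sub>m (vdim V))) (1\<^sub>m (vdim X)) = 1\<^sub>m (vdim (tensor_module V X))"
    by (simp add: kronecker_one tensor_module(2)[OF V X])
qed (simp_all add: mat_ring kronecker_linear tensor_module(2)[OF V X] Rep_act[OF V])

text \<open>P is a retract of P \<otimes> P(0), because P(0) maps onto the unit object, and there
  nullity comes from the second factor.\<close>

lemma projective_null:
  assumes P: "projective P"
  shows "null_at \<eta> n P"
proof -
  have R: "P \<in> Rep" using P by (simp add: projective_def)
  note t = tensor_module(1)[OF R module_P(1)]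
  \<comment> \<open>The chosen vector pairs to 1 with \<open>pt_a\<close>: its first entry is 1 at
    infinity, and its second entry is 1 at finite points.\<close>
  have "null_at \<eta> 0 (module_P 0)"
    by (rule module_P_null[of _ "if \<eta> = Infinite_Point then (1, 0) else (0, 1)"]) (cases \<eta>; simp)
  then have "null_at \<eta> 0 (tensor_module P (module_P 0))"
    by (rule null_tensor[OF R module_P(1)])
  moreover obtain i p where "i \<in> Hom P (tensor_module P (module_P 0))" "p \<in> Hom (tensor_module P (module_P 0)) P" "p * i = 1\<^sub>m (vdim P)"
    by (rule projective_retract[OF P module_P(1) urow_P_Hom[of 0], of "ucol 4 0"])
      (simp_all add: urow_ucol module_P)
  ultimately have "null_at \<eta> 0 P" using null_retract[OF t R] by blast
  then show ?thesis using null_mono[OF R] by blast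
qed

subsection \<open>Singular pencils\<close>

text \<open>Induction on the columns. If some functional f0 kills the columns of J but not column j,
  applying it to the equation dictates the coefficient b / a of column j; otherwise column j imposes
  no condition beyond those of J and gets coefficient 0.\<close>

lemma fredholm_alternative:
  fixes g :: "'j \<Rightarrow> 'i \<Rightarrow> complex"
  assumes "finite J" "finite I"
    and "\<And>f. (\<forall>j\<in>J. (\<Sum>i\<in>I. f i * g j i) = 0) \<Longrightarrow> (\<Sum>i\<in>I. f i * v i) = 0"
  shows "\<exists>y. \<forall>i\<in>I. (\<Sum>j\<in>J. y j * g j i) = v i"
  using assms(1,3)
proof (induction J arbitrary: v rule: finite_induct)
  case empty
  have "v i = 0" if "i \<in> I" for i
    using empty[of "\<lambda>k. if k = i then 1 else 0"] that assms(2)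
    by (simp add: if_distrib[of "\<lambda>x. x * _"] cong: if_cong)
  then show ?case by auto
next
  case (insert j J)
  show ?case
  proof (cases "\<exists>f0. (\<forall>k\<in>J. (\<Sum>i\<in>I. f0 i * g k i) = 0) \<and> (\<Sum>i\<in>I. f0 i * g j i) \<noteq> 0")
    case True
    then obtain f0 where f0: "\<And>k. k \<in> J \<Longrightarrow> (\<Sum>i\<in>I. f0 i * g k i) = 0" "(\<Sum>i\<in>I. f0 i * g j i) \<noteq> 0"
      by blast
    define a where "a = (\<Sum>i\<in>I. f0 i * g j i)"
    define b where "b = (\<Sum>i\<in>I. f0 i * v i)"
    have a: "a \<noteq> 0" using f0(2) by (simp add: a_def)
    have "\<exists>y. \<forall>i\<in>I. (\<Sum>k\<in>J. y k * g k i) = v i - b / a * g j i"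
    proof (rule insert.IH)
      fix f assume f: "\<forall>k\<in>J. (\<Sum>i\<in>I. f i * g k i) = 0"
      define c where "c = (\<Sum>i\<in>I. f i * g j i) / a"
      have lin: "(\<Sum>i\<in>I. (f i - c * f0 i) * w i) = (\<Sum>i\<in>I. f i * w i) - c * (\<Sum>i\<in>I. f0 i * w i)" for w
        by (simp add: algebra_simps sum_subtractf sum_distrib_left)
      have "(\<Sum>i\<in>I. (f i - c * f0 i) * v i) = 0"
      proof (rule insert.prems, rule ballI)
        fix k assume "k \<in> insert j J"
        then show "(\<Sum>i\<in>I. (f i - c * f0 i) * g k i) = 0"
          using f f0 a unfolding lin by (auto simp: c_def a_def[symmetric])
      qed
      then have "(\<Sum>i\<in>I. f i * v i) = c * b" unfolding lin b_def by simp
      moreover have "(\<Sum>i\<in>I. f i * (v i - b / a * g j i)) = (\<Sum>i\<in>I. f i * v i) - b / a * (\<Sum>i\<in>I. f i * g j i)"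
        by (simp add: right_diff_distrib sum_subtractf sum_distrib_left mult_ac)
      ultimately show "(\<Sum>i\<in>I. f i * (v i - b / a * g j i)) = 0"
        by (simp add: c_def)
    qed
    then obtain y where y: "\<And>i. i \<in> I \<Longrightarrow> (\<Sum>k\<in>J. y k * g k i) = v i - b / a * g j i" by blast
    have "(\<Sum>k\<in>insert j J. (y(j := b / a)) k * g k i) = v i" if "i \<in> I" for i
    proof -
      have "(\<Sum>k\<in>J. (y(j := b / a)) k * g k i) = (\<Sum>k\<in>J. y k * g k i)"
        using insert.hyps by (intro sum.cong) auto
      then show ?thesis using insert.hyps y[OF that] by simp
    qed
    then show ?thesis by blast
  next
    case False
    have "\<exists>y. \<forall>i\<in>I. (\<Sum>k\<in>J. y k * g k i) = v i"
    proof (rule insert.IH)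
      fix f assume "\<forall>k\<in>J. (\<Sum>i\<in>I. f i * g k i) = 0"
      then show "(\<Sum>i\<in>I. f i * v i) = 0" using False insert.prems[of f] by blast
    qed
    then obtain y where y: "\<And>i. i \<in> I \<Longrightarrow> (\<Sum>k\<in>J. y k * g k i) = v i" by blast
    have "(\<Sum>k\<in>insert j J. (y(j := 0)) k * g k i) = v i" if "i \<in> I" for i
    proof -
      have "(\<Sum>k\<in>J. (y(j := 0)) k * g k i) = (\<Sum>k\<in>J. y k * g k i)"
        using insert.hyps by (intro sum.cong) auto
      then show ?thesis using insert.hyps y[OF that] by simp
    qed
    then show ?thesis by blast
  qed
qed

section \<open>Kernel polynomials and endomorphisms of singular pencils\<close>

text \<open>A chain is a polynomial vector \<open>x(t) = \<Sum> x\<^sub>i t\<^sup>i\<close> of degree at most \<open>d\<close> with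
  \<open>(A - t B) x(t) = 0\<close>.\<close>

definition chain :: "nat \<Rightarrow> complex mat \<Rightarrow> complex mat \<Rightarrow> nat \<Rightarrow> (nat \<Rightarrow> complex mat) \<Rightarrow> bool" where
  "chain n A B d x \<longleftrightarrow> (\<forall>i. dim_row (x i) = n \<and> dim_col (x i) = Suc 0) \<and>
     A * x 0 = 0\<^sub>m n (Suc 0) \<and> (\<forall>i<d. A * x (Suc i) = B * x i) \<and> B * x d = 0\<^sub>m n (Suc 0) \<and>
     (\<exists>i\<le>d. x i \<noteq> 0\<^sub>m n (Suc 0))"

text \<open>A chain with zero constant term could be divided by t.\<close>

lemma minimal_chain_start:
  assumes "chain n A B d x" "\<And>d' x'. d' < d \<Longrightarrow> \<not> chain n A B d' x'"
    "dim_row A = n" "dim_col A = n" "dim_row B = n" "dim_col B = n"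
  shows "x 0 \<noteq> 0\<^sub>m n (Suc 0)"
proof
  assume 0: "x 0 = 0\<^sub>m n (Suc 0)"
  obtain i where i: "i \<le> d" "x i \<noteq> 0\<^sub>m n (Suc 0)" using assms(1) by (auto simp: chain_def)
  then have "i \<noteq> 0" using 0 by auto
  then obtain j where j: "i = Suc j" by (cases i) auto
  then have "d > 0" using i by simp
  then obtain e where d: "d = Suc e" by (cases d) auto
  have "A * x (Suc 0) = B * x 0" using assms(1) \<open>d > 0\<close> by (auto simp: chain_def)
  also have "\<dots> = 0\<^sub>m n (Suc 0)" using assms(6) by (simp add: 0 mat_one_zero assms(5))
  finally have "chain n A B e (\<lambda>i. x (Suc i))"
    using assms(1) i j unfolding chain_def d by auto
  then show False using assms(2)[of e] d by blast
qed

text \<open>If no such functionals exist, the Fredholm alternative yields a shorter chain that also starts with \<open>x\<^sub>0\<close>.\<close>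

lemma minimal_chain_functional:
  assumes c: "chain n A B (Suc d) x" and min: "\<And>d' x'. d' < Suc d \<Longrightarrow> \<not> chain n A B d' x'"
    and dims [simp]: "dim_row A = n" "dim_col A = n" "dim_row B = n" "dim_col B = n"
  shows "\<exists>f. (\<forall>i. dim_row (f i) = Suc 0 \<and> dim_col (f i) = n) \<and> (\<forall>i<d. f i * A = f (Suc i) * B) \<and>
    (f 0 * (B * x 0)) $$ (0, 0) \<noteq> 0"
proof (rule ccontr)
  assume no: "\<not> ?thesis"
  have x [simp]: "dim_row (x i) = n" "dim_col (x i) = Suc 0" for i using c by (auto simp: chain_def)
  \<comment> \<open>A linear system for vectors \<open>Y 0\<close>, ..., \<open>Y (d - 1)\<close>: A
    Y_0 = B x_0, A Y_i = B Y_(i-1) and B Y_(d-1) = 0. Prefixed with x_0, a solution is a chain of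
    degree d; for d = 0 the system just reads B x_0 = 0.\<close>
  let ?I = "{..<Suc d} \<times> {..<n}" and ?J = "{..<d} \<times> {..<n}"
  let ?v = "\<lambda>(i, a). if i = 0 then (B * x 0) $$ (a, 0) else 0"
  let ?g = "\<lambda>(j, b) (i, a). (if i = j then A $$ (a, b) else 0) - (if i = Suc j then B $$ (a, b) else 0)"
  have "\<exists>y. \<forall>i\<in>?I. (\<Sum>j\<in>?J. y j * ?g j i) = ?v i"
  proof (rule fredholm_alternative)
    fix f :: "nat \<times> nat \<Rightarrow> complex"
    assume f: "\<forall>j\<in>?J. (\<Sum>i\<in>?I. f i * ?g j i) = 0"
    define F where "F i = mat (Suc 0) n (\<lambda>(_, a). f (i, a))" for i
    have [simp]: "dim_row (F i) = Suc 0" "dim_col (F i) = n" for i by (simp_all add: F_def)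
    have FM: "(F i * M) $$ (0, b) = (\<Sum>a<n. f (i, a) * M $$ (a, b))" if "dim_row M = n" "b < dim_col M" for i b M
      using that by (simp add: F_def scalar_prod_def lessThan_atLeast0)
    have "F j * A = F (Suc j) * B" if "j < d" for j
    proof (rule eq_matI)
      fix i b assume "i < dim_row (F (Suc j) * B)" "b < dim_col (F (Suc j) * B)"
      then have b: "i = 0" "b < n" by simp_all
      have "0 = (\<Sum>i\<in>?I. f i * ?g (j, b) i)" using f that b by auto
      also have "\<dots> = (\<Sum>i<Suc d. \<Sum>a<n. f (i, a) * ?g (j, b) (i, a))"
        by (rule sum.cartesian_product')
      also have "\<dots> = (\<Sum>i<Suc d. (if i = j then (\<Sum>a<n. f (i, a) * A $$ (a, b)) else 0) - (if i = Suc j then (\<Sum>a<n. f (i, a) * B $$ (a, b)) else 0))"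
        by (intro sum.cong refl) (auto simp: right_diff_distrib sum_subtractf sum_negf)
      also have "\<dots> = (\<Sum>a<n. f (j, a) * A $$ (a, b)) - (\<Sum>a<n. f (Suc j, a) * B $$ (a, b))"
        using that by (simp add: sum_subtractf del: sum.lessThan_Suc)
      finally show "(F j * A) $$ (i, b) = (F (Suc j) * B) $$ (i, b)"
        using b by (simp add: FM del: index_mult_mat(1))
    qed simp_all
    moreover have "\<forall>i. dim_row (F i) = Suc 0 \<and> dim_col (F i) = n" by simp
    ultimately have "(F 0 * (B * x 0)) $$ (0, 0) = 0" using no by blast
    then have "(\<Sum>a<n. f (0, a) * (B * x 0) $$ (a, 0)) = 0"
      by (subst (asm) FM) simp_all
    moreover have "(\<Sum>i\<in>?I. f i * ?v i) = (\<Sum>i<Suc d. \<Sum>a<n. f (i, a) * ?v (i, a))"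
      by (rule sum.cartesian_product')
    moreover have "\<dots> = (\<Sum>i<Suc d. if i = 0 then (\<Sum>a<n. f (0, a) * (B * x 0) $$ (a, 0)) else 0)"
      by (intro sum.cong refl) (auto simp del: index_mult_mat(1))
    ultimately show "(\<Sum>i\<in>?I. f i * ?v i) = 0" by (simp del: index_mult_mat(1) sum.lessThan_Suc)
  qed simp_all
  then obtain y where y: "\<And>i a. i < Suc d \<Longrightarrow> a < n \<Longrightarrow> (\<Sum>j\<in>?J. y j * ?g j (i, a)) = ?v (i, a)"
    by blast
  define Y where "Y j = mat n (Suc 0) (\<lambda>(b, _). y (j, b))" for j
  have [simp]: "dim_row (Y i) = n" "dim_col (Y i) = Suc 0" for i by (simp_all add: Y_def)
  have MY: "(M * Y j) $$ (a, 0) = (\<Sum>b<n. y (j, b) * M $$ (a, b))" if "dim_col M = n" "a < dim_row M" for j a M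
    using that by (simp add: Y_def scalar_prod_def lessThan_atLeast0 mult.commute)
  have eq: "(if i < d then (A * Y i) $$ (a, 0) else 0) - (if 0 < i then (B * Y (i - 1)) $$ (a, 0) else 0) =
      (if i = 0 then (B * x 0) $$ (a, 0) else 0)" if "i < Suc d" "a < n" for i a
  proof -
    have "(\<Sum>j\<in>?J. y j * ?g j (i, a)) = (\<Sum>j<d. \<Sum>b<n. y (j, b) * ?g (j, b) (i, a))"
      by (rule sum.cartesian_product')
    also have "\<dots> = (\<Sum>j<d. (if i = j then (A * Y j) $$ (a, 0) else 0) - (if i = Suc j then (B * Y j) $$ (a, 0) else 0))"
      using that by (intro sum.cong refl) (auto simp: right_diff_distrib sum_subtractf sum_negf MY simp del: index_mult_mat(1))
    also have "\<dots> = (if i < d then (A * Y i) $$ (a, 0) else 0) - (if 0 < i then (B * Y (i - 1)) $$ (a, 0) else 0)"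
      using that(1) by (cases i) (simp_all add: sum_subtractf del: index_mult_mat(1))
    finally show ?thesis using y[OF that] by simp
  qed
  define z where "z i = (case i of 0 \<Rightarrow> x 0 | Suc j \<Rightarrow> Y j)" for i
  have z_dim: "dim_row (z i) = n" "dim_col (z i) = Suc 0" for i by (simp_all add: z_def split: nat.split)
  have "A * z (Suc i) = B * z i" if "i < d" for i
  proof (rule eq_matI)
    fix a b assume "a < dim_row (B * z i)" "b < dim_col (B * z i)"
    then have "a < n" "b = 0" using z_dim by simp_all
    then show "(A * z (Suc i)) $$ (a, b) = (B * z i) $$ (a, b)"
      using eq[of i a] that by (cases i) (simp_all add: z_def del: index_mult_mat(1))
  qed (simp_all add: z_dim)
  moreover have "B * z d = 0\<^sub>m n (Suc 0)"
  proof (rule eq_matI)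
    fix a b assume "a < dim_row (0\<^sub>m n (Suc 0) :: complex mat)" "b < dim_col (0\<^sub>m n (Suc 0) :: complex mat)"
    then have "a < n" "b = 0" by simp_all
    then show "(B * z d) $$ (a, b) = 0\<^sub>m n (Suc 0) $$ (a, b)"
      using eq[of d a] by (cases d) (simp_all add: z_def del: index_mult_mat(1))
  qed (simp_all add: z_dim)
  moreover have "A * z 0 = 0\<^sub>m n (Suc 0)" using c by (simp add: z_def chain_def)
  moreover have "z 0 \<noteq> 0\<^sub>m n (Suc 0)"
    using minimal_chain_start[OF c min dims] by (simp add: z_def)
  ultimately have "chain n A B d z"
    unfolding chain_def using z_dim by blast
  then show False using min[of d] by blast
qed

lemma tr_msum:
  assumes "\<And>m. dim_row (f m) = a" "\<And>m. dim_col (f m) = a"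
  shows "tr (msum f n) = (\<Sum>m\<le>n. tr (f m))"
  by (induction n) (simp_all add: assms msum_dim[OF assms] tr_linear)

lemma tr_one_by_one: "dim_row A = Suc 0 \<Longrightarrow> tr A = A $$ (0, 0)"
  by (simp add: tr_def)

lemma mult_msum:
  assumes "\<And>m. dim_row (f m) = a" "\<And>m. dim_col (f m) = b" "dim_col X = a"
  shows "X * msum f n = msum (\<lambda>m. X * f m) n"
  by (induction n) (simp_all add: mat_distrib assms msum_dim[OF assms(1,2)])

text \<open>For a chain of minimal degree d + 1, \<open>E\<close> is the sum of d + 2 rank-one
  matrices x_i p_i and \<open>F\<close> the sum of d + 1 rank-one matrices B x_i f_i. All of them
  have the same trace f_0 B x_0, which is nonzero, so the extra summand separates the traces. In
  degree 0 a common kernel vector gives \<open>E\<close> of rank one and \<open>F\<close> =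
  0.\<close>

lemma chain_endomorphism:
  assumes c: "chain n A B d x"
    and dims [simp]: "dim_row A = n" "dim_col A = n" "dim_row B = n" "dim_col B = n"
  obtains E F where "dim_row E = n" "dim_col E = n" "dim_row F = n" "dim_col F = n"
    "F * A = A * E" "F * B = B * E" "tr E \<noteq> tr F"
proof -
  define e where "e = (LEAST d. \<exists>x. chain n A B d x)"
  have "\<exists>x. chain n A B e x" unfolding e_def by (rule LeastI[of _ d]) (use c in blast)
  then obtain x where c: "chain n A B e x" by blast
  have min: "\<not> chain n A B d' x'" if "d' < e" for d' x'
    using not_less_Least[of d' "\<lambda>d. \<exists>x. chain n A B d x"] that unfolding e_def by blast
  have x [simp]: "dim_row (x i) = n" "dim_col (x i) = Suc 0" for i using c by (auto simp: chain_def)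
  have x0: "x 0 \<noteq> 0\<^sub>m n (Suc 0)" by (rule minimal_chain_start[OF c min dims])
  have A0: "A * x 0 = 0\<^sub>m n (Suc 0)" and AB: "\<And>i. i < e \<Longrightarrow> A * x (Suc i) = B * x i" and Be: "B * x e = 0\<^sub>m n (Suc 0)"
    using c by (auto simp: chain_def)
  show ?thesis
  proof (cases e)
    case 0
    have "\<exists>a<n. x 0 $$ (a, 0) \<noteq> 0"
    proof (rule ccontr)
      assume "\<not> ?thesis"
      then have "x 0 = 0\<^sub>m n (Suc 0)" by (intro eq_matI) auto
      then show False using x0 by simp
    qed
    then obtain a where a: "a < n" "x 0 $$ (a, 0) \<noteq> 0" by blast
    have "tr (x 0 * urow n a) = tr (urow n a * x 0)" by (rule tr_comm) simp_all
    also have "\<dots> = x 0 $$ (a, 0)" using a(1) by (simp add: tr_one_by_one urow_index del: index_mult_mat(1))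
    finally have "tr (x 0 * urow n a) \<noteq> tr (0\<^sub>m n n)" using a(2) by (simp add: tr_linear)
    moreover have "A * (x 0 * urow n a) = 0\<^sub>m n n" "B * (x 0 * urow n a) = 0\<^sub>m n n"
      using A0 Be[unfolded 0] by (simp_all add: mat_assoc[symmetric] mat_one_zero)
    ultimately show ?thesis
      by (intro that[of "x 0 * urow n a" "0\<^sub>m n n"]) (simp_all add: mat_one_zero)
  next
    case (Suc d)
    obtain f where [simp]: "\<And>i. dim_row (f i) = Suc 0" "\<And>i. dim_col (f i) = n"
      and f: "\<And>i. i < d \<Longrightarrow> f i * A = f (Suc i) * B" and f0: "(f 0 * (B * x 0)) $$ (0, 0) \<noteq> 0"
      using minimal_chain_functional[OF c[unfolded Suc] min[unfolded Suc] dims] by blast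
    \<comment> \<open>By the recursion for f, p_i is both f_i B and f_(i-1) A wherever both make
      sense. The former computes B E and the latter A E.\<close>
    define p where "p i = (case i of 0 \<Rightarrow> f 0 * B | Suc j \<Rightarrow> f j * A)" for i
    have p_dim [simp]: "dim_row (p i) = Suc 0" "dim_col (p i) = n" for i by (simp_all add: p_def split: nat.split)
    have pB: "p i = f i * B" if "i \<le> d" for i using that f by (cases i) (simp_all add: p_def)
    have pA: "p (Suc i) = f i * A" for i by (simp add: p_def)
    define E where "E = msum (\<lambda>i. x i * p i) (Suc d)"
    define F where "F = msum (\<lambda>i. B * (x i * f i)) d"
    have E_dim: "dim_row E = n" "dim_col E = n" and F_dim: "dim_row F = n" "dim_col F = n"
      unfolding E_def F_def by (rule msum_dim; simp)+
    have "A * E = msum (\<lambda>i. A * (x i * p i)) (Suc d)"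
      unfolding E_def by (rule mult_msum[of _ n n]) simp_all
    also have "\<dots> = A * (x 0 * p 0) + msum (\<lambda>i. A * (x (Suc i) * p (Suc i))) d"
      by (rule msum_shift[of _ n n]) simp_all
    also have "A * (x 0 * p 0) = 0\<^sub>m n n"
      by (simp add: mat_assoc_eq[OF A0] mat_one_zero)
    also have "0\<^sub>m n n + msum (\<lambda>i. A * (x (Suc i) * p (Suc i))) d = msum (\<lambda>i. A * (x (Suc i) * p (Suc i))) d"
      by (rule mat_one_zero(6); rule msum_dim; simp)
    also have "\<dots> = msum (\<lambda>i. B * (x i * f i) * A) d"
      using Suc by (intro msum_cong) (simp add: mat_assoc_eq[OF AB] pA mat_assoc)
    also have "\<dots> = F * A"
      unfolding F_def by (rule msum_mult[symmetric, of _ n n]) simp_all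
    finally have FA: "F * A = A * E" by simp
    have "B * E = msum (\<lambda>i. B * (x i * p i)) (Suc d)"
      unfolding E_def by (rule mult_msum[of _ n n]) simp_all
    also have "\<dots> = msum (\<lambda>i. B * (x i * p i)) d"
      using mat_assoc_eq[OF Be, of "p e"] Suc by (simp add: mat_one_zero msum_dim[of _ n n])
    also have "\<dots> = msum (\<lambda>i. B * (x i * f i) * B) d"
      by (intro msum_cong) (simp add: pB mat_assoc)
    also have "\<dots> = F * B"
      unfolding F_def by (rule msum_mult[symmetric, of _ n n]) simp_all
    finally have FB: "F * B = B * E" by simp
    have px: "tr (x i * p i) = tr (p i * x i)" for i by (rule tr_comm) simp_all
    have trF: "tr F = (\<Sum>i\<le>d. tr (x i * p i))"
      unfolding F_def
    proof (subst tr_msum[of _ n], simp, simp, intro sum.cong refl)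
      fix i assume "i \<in> {..d}"
      have "tr (B * (x i * f i)) = tr ((B * x i) * f i)" by (simp add: mat_assoc)
      also have "\<dots> = tr (f i * (B * x i))" by (rule tr_comm) simp_all
      also have "\<dots> = tr (p i * x i)" using \<open>i \<in> {..d}\<close> by (simp add: pB mat_assoc)
      finally show "tr (B * (x i * f i)) = tr (x i * p i)" by (simp add: px)
    qed
    have trE: "tr E = (\<Sum>i\<le>Suc d. tr (x i * p i))"
      unfolding E_def by (rule tr_msum[of _ n]) simp_all
    have "tr (p i * x i) = tr (p 0 * x 0)" if "i \<le> Suc d" for i
      using that
    proof (induction i)
      case (Suc i)
      have "p (Suc i) * x (Suc i) = f i * (A * x (Suc i))" by (simp add: pA mat_assoc)
      also have "\<dots> = p i * x i" using Suc.prems \<open>e = Suc d\<close> by (simp add: AB pB mat_assoc)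
      finally show ?case using Suc by simp
    qed simp
    then have "tr (x (Suc d) * p (Suc d)) = tr (f 0 * (B * x 0))"
      by (simp add: px pB mat_assoc)
    also have "\<dots> \<noteq> 0" using f0 by (simp add: tr_one_by_one del: index_mult_mat(1))
    finally have "tr E \<noteq> tr F" unfolding trE trF by simp
    then show ?thesis using that[OF E_dim F_dim FA FB] by simp
  qed
qed

text \<open>If \<open>y\<^sub>t\<close> is in the kernel of \<open>A + t B\<close> for \<open>t = 0, \<dots>, n\<close>, these vectors are linearly
  dependent, say \<open>\<Sum> c\<^sub>t y\<^sub>t = 0\<close>, and then \<open>\<Sum> c\<^sub>t (\<Prod>\<^bsub>j \<noteq> t\<^esub> (s - j)) y\<^sub>t\<close> is in the kernel of \<open>A + s B\<close>.\<close>

lemma singular_pencil_chain: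
  assumes dims [simp]: "dim_row A = n" "dim_col A = n" "dim_row B = n" "dim_col B = n"
    and sing: "\<And>t :: nat. t \<le> n \<Longrightarrow> det (A + of_nat t \<cdot>\<^sub>m B) = 0"
  obtains x where "chain n A ((-1) \<cdot>\<^sub>m B) n x"
proof -
  have "\<exists>y. \<forall>t\<le>n. y t \<in> carrier_vec n \<and> y t \<noteq> 0\<^sub>v n \<and> (A + of_nat t \<cdot>\<^sub>m B) *\<^sub>v y t = 0\<^sub>v n"
  proof (rule choice, rule allI)
    fix t
    have "\<exists>v. v \<in> carrier_vec n \<and> v \<noteq> 0\<^sub>v n \<and> (A + of_nat t \<cdot>\<^sub>m B) *\<^sub>v v = 0\<^sub>v n" if "t \<le> n"
      using sing[OF that] det_0_iff_vec_prod_zero[of "A + of_nat t \<cdot>\<^sub>m B" n] by (simp add: carrier_dim)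
    then show "\<exists>v. t \<le> n \<longrightarrow> v \<in> carrier_vec n \<and> v \<noteq> 0\<^sub>v n \<and> (A + of_nat t \<cdot>\<^sub>m B) *\<^sub>v v = 0\<^sub>v n" by blast
  qed
  then obtain y where y: "\<And>t. t \<le> n \<Longrightarrow> y t \<in> carrier_vec n" "\<And>t. t \<le> n \<Longrightarrow> y t \<noteq> 0\<^sub>v n"
    "\<And>t. t \<le> n \<Longrightarrow> (A + of_nat t \<cdot>\<^sub>m B) *\<^sub>v y t = 0\<^sub>v n" by blast
  have y_dim: "dim_vec (y t) = n" if "t \<le> n" for t using carrier_vecD[OF y(1)[OF that]] .
  have Ay: "(\<Sum>b<n. A $$ (a, b) * y t $ b) = - of_nat t * (\<Sum>b<n. B $$ (a, b) * y t $ b)" if "t \<le> n" "a < n" for t a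
  proof -
    have "0 = ((A + of_nat t \<cdot>\<^sub>m B) *\<^sub>v y t) $ a" using that by (simp add: y(3))
    also have "\<dots> = (\<Sum>b<n. (A $$ (a, b) + of_nat t * B $$ (a, b)) * y t $ b)"
      using that y_dim[OF that(1)] by (simp add: scalar_prod_def lessThan_atLeast0)
    also have "\<dots> = (\<Sum>b<n. A $$ (a, b) * y t $ b) + of_nat t * (\<Sum>b<n. B $$ (a, b) * y t $ b)"
      by (simp add: algebra_simps sum.distrib sum_distrib_left)
    finally have "(\<Sum>b<n. A $$ (a, b) * y t $ b) + of_nat t * (\<Sum>b<n. B $$ (a, b) * y t $ b) = 0" by simp
    then show ?thesis by (simp add: eq_neg_iff_add_eq_0)
  qed
  \<comment> \<open>The columns are the n + 1 vectors y_t in dimension n; the zero bottom row makes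
    the matrix square and singular.\<close>
  let ?C = "mat (Suc n) (Suc n) (\<lambda>(a, t). if a < n then y t $ a else 0)"
  have C: "?C \<in> carrier_mat (Suc n) (Suc n)" by simp
  have "?C\<^sup>T *\<^sub>v unit_vec (Suc n) n = 0\<^sub>v (Suc n)"
    by (intro eq_vecI) (auto simp: scalar_prod_right_unit)
  moreover have "unit_vec (Suc n) n \<noteq> (0\<^sub>v (Suc n) :: complex vec)"
    using arg_cong[of "unit_vec (Suc n) n :: complex vec" "0\<^sub>v (Suc n)" "\<lambda>v. v $ n"] by auto
  ultimately have "det (?C\<^sup>T) = 0"
    using det_0_iff_vec_prod_zero[of "?C\<^sup>T" "Suc n"] unit_vec_carrier[of "Suc n" n, where 'a = complex]
    by (subst det_0_iff_vec_prod_zero[of _ "Suc n"]) (simp, blast)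
  then have "det ?C = 0" using det_transpose[OF C] by simp
  then obtain v where v: "v \<in> carrier_vec (Suc n)" "v \<noteq> 0\<^sub>v (Suc n)" "?C *\<^sub>v v = 0\<^sub>v (Suc n)"
    using det_0_iff_vec_prod_zero[OF C] by blast
  have v_dim: "dim_vec v = Suc n" using carrier_vecD[OF v(1)] .
  have dep: "(\<Sum>t\<le>n. v $ t * y t $ a) = 0" if "a < n" for a
  proof -
    have "0 = (?C *\<^sub>v v) $ a" using that by (simp add: v(3))
    also have "\<dots> = (\<Sum>t\<le>n. v $ t * y t $ a)"
      using that v_dim by (simp add: scalar_prod_def lessThan_atLeast0[symmetric] lessThan_Suc_atMost mult.commute)
    finally show ?thesis by simp
  qed
  obtain t0 where t0: "t0 \<le> n" "v $ t0 \<noteq> 0"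
  proof -
    have "\<exists>t<Suc n. v $ t \<noteq> 0"
    proof (rule ccontr)
      assume "\<not> ?thesis"
      then have "v = 0\<^sub>v (Suc n)" using v_dim by (intro eq_vecI) auto
      then show False using v(2) by simp
    qed
    then show ?thesis using that by (auto simp: less_Suc_eq_le)
  qed
  \<comment> \<open>Since (A + s B) y_t = (s - t) B y_t, applying A + s B to q_t(s) y_t replaces q_t
    by the common factor Q. The dependence of the y_t then annihilates the sum.\<close>
  define q :: "nat \<Rightarrow> complex poly" where "q t = (\<Prod>j\<in>{..n} - {t}. [:- of_nat j, 1:])" for t
  define Q :: "complex poly" where "Q = (\<Prod>j\<in>{..n}. [:- of_nat j, 1:])"
  have Qq: "[:- of_nat t, 1:] * q t = Q" if "t \<le> n" for t
    using that unfolding Q_def q_def by (subst prod.remove[of _ t]) simp_all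
  have degq: "degree (q t) = n" if "t \<le> n" for t
  proof -
    have "degree (q t) = (\<Sum>j\<in>{..n} - {t}. degree [:- of_nat j, 1 :: complex:])"
      unfolding q_def by (rule degree_prod_sum_eq) simp
    then show ?thesis using that by simp
  qed
  have coeffQ: "coeff Q k = - of_nat t * coeff (q t) k + (if k = 0 then 0 else coeff (q t) (k - 1))" if "t \<le> n" for t k
    unfolding Qq[OF that, symmetric] by (cases k) simp_all
  have coeffQ': "v $ t * coeff Q 0 * S = - (v $ t * coeff (q t) 0 * (of_nat t * S))" if "t \<le> n" for t S
    unfolding coeffQ[OF that] by simp
  have coeffQ'': "v $ t * coeff Q (Suc k) * S = v $ t * coeff (q t) k * S - v $ t * coeff (q t) (Suc k) * (of_nat t * S)" if "t \<le> n" for t k S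
    unfolding coeffQ[OF that] by (simp add: algebra_simps)
  define z where "z k = mat n (Suc 0) (\<lambda>(a, _). \<Sum>t\<le>n. v $ t * coeff (q t) k * y t $ a)" for k
  have z_dim [simp]: "dim_row (z k) = n" "dim_col (z k) = Suc 0" for k by (simp_all add: z_def)
  have Mz: "(M * z k) $$ (a, 0) = (\<Sum>t\<le>n. v $ t * coeff (q t) k * (\<Sum>b<n. M $$ (a, b) * y t $ b))"
    if "dim_col M = n" "a < dim_row M" for M k a
  proof -
    have "(M * z k) $$ (a, 0) = (\<Sum>b<n. \<Sum>t\<le>n. v $ t * coeff (q t) k * (M $$ (a, b) * y t $ b))"
      using that by (simp add: z_def scalar_prod_def lessThan_atLeast0 sum_distrib_left mult_ac)
    also have "\<dots> = (\<Sum>t\<le>n. \<Sum>b<n. v $ t * coeff (q t) k * (M $$ (a, b) * y t $ b))" by (rule sum.swap)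
    finally show ?thesis by (simp add: sum_distrib_left)
  qed
  have Bdep: "(\<Sum>t\<le>n. v $ t * (\<Sum>b<n. B $$ (a, b) * y t $ b)) = 0" for a
  proof -
    have "(\<Sum>t\<le>n. v $ t * (\<Sum>b<n. B $$ (a, b) * y t $ b)) = (\<Sum>t\<le>n. \<Sum>b<n. B $$ (a, b) * (v $ t * y t $ b))"
      by (simp add: sum_distrib_left mult_ac)
    also have "\<dots> = (\<Sum>b<n. \<Sum>t\<le>n. B $$ (a, b) * (v $ t * y t $ b))" by (rule sum.swap)
    also have "\<dots> = (\<Sum>b<n. B $$ (a, b) * (\<Sum>t\<le>n. v $ t * y t $ b))" by (simp add: sum_distrib_left)
    also have "\<dots> = 0" using dep by simp
    finally show ?thesis .
  qed
  have key: "(A * z k) $$ (a, 0) + (if k = 0 then 0 else (B * z (k - 1)) $$ (a, 0)) = 0" if "a < n" for k a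
  proof -
    have "(A * z k) $$ (a, 0) + (if k = 0 then 0 else (B * z (k - 1)) $$ (a, 0)) =
      (\<Sum>t\<le>n. v $ t * coeff Q k * (\<Sum>b<n. B $$ (a, b) * y t $ b))"
    proof (cases k)
      case 0
      show ?thesis
        using that by (simp add: 0 Mz del: index_mult_mat(1)) (intro sum.cong refl, simp add: Ay coeffQ')
    next
      case (Suc l)
      have "(A * z k) $$ (a, 0) + (if k = 0 then 0 else (B * z (k - 1)) $$ (a, 0)) =
        (\<Sum>t\<le>n. v $ t * coeff (q t) k * (\<Sum>b<n. A $$ (a, b) * y t $ b) + v $ t * coeff (q t) l * (\<Sum>b<n. B $$ (a, b) * y t $ b))"
        using that by (simp add: Suc Mz sum.distrib del: index_mult_mat(1))
      also have "\<dots> = (\<Sum>t\<le>n. v $ t * coeff Q k * (\<Sum>b<n. B $$ (a, b) * y t $ b))"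
        using that Suc by (intro sum.cong refl, subst Ay) (simp_all add: coeffQ'')
      finally show ?thesis .
    qed
    also have "\<dots> = coeff Q k * (\<Sum>t\<le>n. v $ t * (\<Sum>b<n. B $$ (a, b) * y t $ b))"
      by (simp add: sum_distrib_left mult_ac)
    finally show ?thesis by (simp only: Bdep mult_zero_right)
  qed
  have zSn: "z (Suc n) = 0\<^sub>m n (Suc 0)"
    by (rule eq_matI) (auto simp: z_def coeff_eq_0 degq intro!: sum.neutral)
  have "\<exists>k\<le>n. z k \<noteq> 0\<^sub>m n (Suc 0)"
  proof (rule ccontr)
    assume "\<not> ?thesis"
    then have z0: "z k = 0\<^sub>m n (Suc 0)" if "k \<le> n" for k using that by blast
    \<comment> \<open>The polynomial vector is evaluated at s = t0, where every q_t with t different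
      from t0 vanishes.\<close>
    have "y t0 $ a = 0" if a: "a < n" for a
    proof -
      have "(\<Sum>t\<le>n. v $ t * coeff (q t) k * y t $ a) = 0" if "k \<le> n" for k
        using arg_cong[OF z0[OF that], of "\<lambda>M. M $$ (a, 0)"] a by (simp add: z_def)
      then have "0 = (\<Sum>k\<le>n. (\<Sum>t\<le>n. v $ t * coeff (q t) k * y t $ a) * of_nat t0 ^ k)" by simp
      also have "\<dots> = (\<Sum>k\<le>n. \<Sum>t\<le>n. v $ t * y t $ a * (coeff (q t) k * of_nat t0 ^ k))"
        by (simp add: sum_distrib_left sum_distrib_right mult_ac)
      also have "\<dots> = (\<Sum>t\<le>n. \<Sum>k\<le>n. v $ t * y t $ a * (coeff (q t) k * of_nat t0 ^ k))" by (rule sum.swap)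
      also have "\<dots> = (\<Sum>t\<le>n. v $ t * y t $ a * poly (q t) (of_nat t0))"
        by (intro sum.cong refl) (simp add: poly_altdef degq sum_distrib_left)
      also have "\<dots> = (\<Sum>t\<le>n. if t = t0 then v $ t * y t $ a * poly (q t) (of_nat t0) else 0)"
        using t0(1) by (intro sum.cong refl) (auto simp: q_def poly_prod intro!: prod_zero)
      also have "\<dots> = v $ t0 * y t0 $ a * poly (q t0) (of_nat t0)" using t0(1) by simp
      finally have "v $ t0 * y t0 $ a * poly (q t0) (of_nat t0) = 0" by simp
      moreover have "poly (q t0) (of_nat t0) \<noteq> 0" by (auto simp: q_def poly_prod)
      ultimately show ?thesis using t0(2) by simp
    qed
    then have "y t0 = 0\<^sub>v n" using y_dim[OF t0(1)] by (intro eq_vecI) auto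
    then show False using y(2)[OF t0(1)] by simp
  qed
  moreover have "A * z 0 = 0\<^sub>m n (Suc 0)"
    using key[of _ 0] by (intro eq_matI) (simp_all del: index_mult_mat(1))
  moreover have "A * z (Suc k) = ((-1) \<cdot>\<^sub>m B) * z k" for k
    using key[of _ "Suc k"] by (intro eq_matI) (simp_all add: mat_smult_mult eq_neg_iff_add_eq_0 del: index_mult_mat(1))
  ultimately have "chain n A ((-1) \<cdot>\<^sub>m B) n z"
    using zSn unfolding chain_def by (metis dims(2) mat_one_zero(4) z_dim dims(1))
  then show ?thesis using that by blast
qed

lemma singular_pencil_endomorphism:
  assumes dims [simp]: "dim_row A = n" "dim_col A = n" "dim_row B = n" "dim_col B = n"
    and sing: "\<And>t :: nat. t \<le> n \<Longrightarrow> det (A + of_nat t \<cdot>\<^sub>m B) = 0"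
  obtains E F where "dim_row E = n" "dim_col E = n" "dim_row F = n" "dim_col F = n"
    "F * A = A * E" "F * B = B * E" "tr E \<noteq> tr F"
proof -
  obtain x where c: "chain n A ((-1) \<cdot>\<^sub>m B) n x" by (rule singular_pencil_chain[OF assms])
  obtain E F where [simp]: "dim_row E = n" "dim_col E = n" "dim_row F = n" "dim_col F = n"
    and eq: "F * A = A * E" "F * ((-1) \<cdot>\<^sub>m B) = ((-1) \<cdot>\<^sub>m B) * E" and "tr E \<noteq> tr F"
    by (rule chain_endomorphism[OF c]) simp_all
  have "(-1) \<cdot>\<^sub>m (F * ((-1) \<cdot>\<^sub>m B)) = (-1) \<cdot>\<^sub>m (((-1) \<cdot>\<^sub>m B) * E)" using eq(2) by simp
  then have "F * B = B * E" by (simp add: mat_ring)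
  then show ?thesis using that[of E F] eq(1) \<open>tr E \<noteq> tr F\<close> by simp
qed

subsection \<open>Classification of the modules of vanishing supertrace\<close>

lemma direct_sum_append:
  assumes "set Xs \<subseteq> Rep" "set Ys \<subseteq> Rep"
  shows "direct_sum (Xs @ Ys) = dsum (direct_sum Xs) (direct_sum Ys)"
proof -
  have d: "dim_row (diag_block_mat (map (\<lambda>M. act M x) Ms)) = sum_list (map vdim Ms)"
    "dim_col (diag_block_mat (map (\<lambda>M. act M x) Ms)) = sum_list (map vdim Ms)" if "set Ms \<subseteq> Rep" for x Ms
    using that by (auto simp: dim_diag_block_mat o_def intro!: arg_cong[of _ _ sum_list] map_cong Rep_act(1,2))
  note [simp] = d[OF assms(1)] d[OF assms(2)]
  show ?thesis
    by (simp add: direct_sum_def dsum_def fun_eq_iff Let_def diag_block_mat_append)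
      (subst four_block_in_pr, auto simp: mat_ring)
qed

definition standard_modules :: "k2_module set" where
  "standard_modules = {module_M k r \<eta> | k r \<eta>. 1 \<le> k \<and> r \<in> {0, 1}} \<union> {module_P 0, module_P 1}"

lemma standard_modules_Rep: "standard_modules \<subseteq> Rep"
  unfolding standard_modules_def by (auto simp: module_M(1) module_P(1) simp del: module_M.simps)

definition decomposes :: "k2_module \<Rightarrow> bool" where
  "decomposes X \<longleftrightarrow> (\<exists>Xs. set Xs \<subseteq> standard_modules \<and> module_iso X (direct_sum Xs))"

definition has_trace :: "k2_module \<Rightarrow> bool" where
  "has_trace X \<longleftrightarrow> (\<exists>h\<in>Hom X X. tr (opK X * h) \<noteq> 0)"

lemma has_trace_retract:
  assumes X: "X \<in> Rep" and Y: "Y \<in> Rep" and i: "i \<in> Hom Y X" and p: "p \<in> Hom X Y" and pi: "p * i = 1\<^sub>m (vdim Y)"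
    and "has_trace Y"
  shows "has_trace X"
proof -
  obtain h where h: "h \<in> Hom Y Y" "tr (opK Y * h) \<noteq> 0" using assms(6) by (auto simp: has_trace_def)
  note [simp] = Rep_act(1,2)[OF X] Rep_act(1,2)[OF Y] HomD(1,2)[OF i] HomD(1,2)[OF p] HomD(1,2)[OF h(1)]
  have "tr (opK X * (i * (h * p))) = tr ((opK X * i) * (h * p))" by (simp add: mat_assoc)
  also have "\<dots> = tr ((i * (opK Y * h)) * p)" unfolding HomD(3)[OF i, symmetric] by (simp add: mat_assoc)
  also have "\<dots> = tr (p * (i * (opK Y * h)))" by (rule tr_comm) simp_all
  also have "\<dots> = tr (opK Y * h)" by (simp add: mat_assoc_eq[OF pi] mat_ring)
  finally show ?thesis
    using h(2) Hom_comp[OF X Y X i Hom_comp[OF X Y Y h(1) p]] unfolding has_trace_def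
    by (intro bexI[of _ "i * (h * p)"]) simp_all
qed

lemma has_trace_iso:
  assumes "X \<in> Rep" "Y \<in> Rep" "module_iso X Y" "has_trace Y"
  shows "has_trace X"
  using assms has_trace_retract[OF assms(1,2)] unfolding module_iso_def by blast

lemma decomposes_iso:
  assumes "X \<in> Rep" "Y \<in> Rep" "module_iso X Y" "decomposes Y"
  shows "decomposes X"
proof -
  obtain Xs where "set Xs \<subseteq> standard_modules" "module_iso Y (direct_sum Xs)"
    using assms(4) by (auto simp: decomposes_def)
  then show ?thesis
    using iso_trans[OF assms(1,2) direct_sum_Rep assms(3)] standard_modules_Rep unfolding decomposes_def by blast
qed

lemma decomposes_single: "X \<in> standard_modules \<Longrightarrow> decomposes X"
  unfolding decomposes_def using iso_refl standard_modules_Rep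
  by (intro exI[of _ "[X]"]) (auto simp: direct_sum_single)

lemma dsum_trace_or_decomposes:
  assumes X: "X \<in> Rep" and Y: "Y \<in> Rep" and Z: "Z \<in> Rep" and iso: "module_iso X (dsum Y Z)"
    and "has_trace Y \<or> decomposes Y" "has_trace Z \<or> decomposes Z"
  shows "has_trace X \<or> decomposes X"
proof -
  note R = dsum_Rep[OF Y Z] and h = dsum_Hom[OF Y Z]
  have "has_trace Y \<Longrightarrow> has_trace (dsum Y Z)"
    by (rule has_trace_retract[OF R Y h(1,3)]) (simp_all add: in_pr)
  moreover have "has_trace Z \<Longrightarrow> has_trace (dsum Y Z)"
    by (rule has_trace_retract[OF R Z h(2,4)]) (simp_all add: in_pr)
  moreover have "decomposes (dsum Y Z)" if d: "decomposes Y" "decomposes Z"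
  proof -
    obtain Ys Zs where s: "set Ys \<subseteq> standard_modules" "module_iso Y (direct_sum Ys)"
      "set Zs \<subseteq> standard_modules" "module_iso Z (direct_sum Zs)"
      using d by (auto simp: decomposes_def)
    then have "set Ys \<subseteq> Rep" "set Zs \<subseteq> Rep" using standard_modules_Rep by auto
    then have "module_iso (dsum Y Z) (direct_sum (Ys @ Zs))"
      using dsum_iso[OF Y _ Z _ s(2,4)] by (simp add: direct_sum_append direct_sum_Rep)
    then show ?thesis unfolding decomposes_def using s by (intro exI[of _ "Ys @ Zs"]) simp
  qed
  ultimately show ?thesis
    using assms(5,6) has_trace_iso[OF X R iso] decomposes_iso[OF X R iso] by blast
qed

text \<open>\<open>P(r)\<close> is injective: a functional \<open>L\<close> with \<open>L (\<xi>\<^sub>1 \<xi>\<^sub>2 v) = 1\<close> determines a retraction of \<open>X\<close> onto the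
  submodule generated by \<open>v\<close>.\<close>

lemma projective_summand:
  assumes X: "X \<in> Rep" and ne: "op1 X * op2 X \<noteq> 0\<^sub>m (vdim X) (vdim X)"
  obtains r i p where "r \<in> {0, 1}" "i \<in> Hom (module_P r) X" "p \<in> Hom X (module_P r)" "p * i = 1\<^sub>m 4"
proof -
  let ?n = "vdim X" and ?K = "opK X" and ?B = "op1 X" and ?C = "op2 X"
  note [simp] = Rep_act(1,2)[OF X]
  note rr = relations_rules[OF Rep_relations[OF X]]
  have "\<exists>a b. a < ?n \<and> b < ?n \<and> (?B * ?C) $$ (a, b) \<noteq> 0"
  proof (rule ccontr)
    assume "\<not> ?thesis"
    then have "?B * ?C = 0\<^sub>m ?n ?n" by (intro eq_matI) (simp_all del: index_mult_mat(1))
    then show False using ne by simp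
  qed
  then obtain a b where ab: "a < ?n" "b < ?n" "(?B * ?C) $$ (a, b) \<noteq> 0" by blast
  \<comment> \<open>Projection onto the K-eigenspace for (-1)^r; some r keeps the nonzero entry of
    xi_1 xi_2.\<close>
  define e where "e r = (1/2) \<cdot>\<^sub>m (1\<^sub>m ?n + (-1)^r \<cdot>\<^sub>m ?K)" for r :: nat
  have [simp]: "dim_row (e r) = ?n" "dim_col (e r) = ?n" for r by (simp_all add: e_def)
  have sum: "?B * ?C = ?B * (?C * e 0) + ?B * (?C * e 1)"
    by (simp add: e_def mat_ring) (rule eq_matI; simp add: algebra_simps del: index_mult_mat(1))
  have "(?B * ?C) $$ (a, b) = (?B * (?C * e 0)) $$ (a, b) + (?B * (?C * e 1)) $$ (a, b)"
    by (subst sum) (simp add: ab(1,2) del: index_mult_mat(1))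
  then have "\<exists>r\<in>{0, 1}. (?B * (?C * e r)) $$ (a, b) \<noteq> 0"
    using ab(3) by (metis add.left_neutral insertCI)
  then obtain r :: nat where r: "r \<in> {0, 1}" "(?B * (?C * e r)) $$ (a, b) \<noteq> 0" by blast
  let ?s = "(-1)^r :: complex"
  let ?c = "(?B * (?C * e r)) $$ (a, b)"
  define v0 where "v0 = e r * ucol ?n b"
  define L where "L = (1 / ?c) \<cdot>\<^sub>m (urow ?n a * e r)"
  have [simp]: "dim_row v0 = ?n" "dim_col v0 = Suc 0" "dim_row L = Suc 0" "dim_col L = ?n" by (simp_all add: v0_def L_def)
  have Ke: "?K * e r = ?s \<cdot>\<^sub>m e r" and eK: "e r * ?K = ?s \<cdot>\<^sub>m e r"
    by (simp_all add: e_def mat_ring rr) (rule eq_matI; simp add: sign_square algebra_simps flip: mult.assoc del: index_mult_mat(1))+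
  have ee: "e r * e r = e r"
    by (subst (2) e_def) (simp add: mat_ring eK, rule eq_matI; simp add: sign_square algebra_simps flip: mult.assoc del: index_mult_mat(1))
  have eBC: "e r * (?B * (?C * Y)) = ?B * (?C * (e r * Y))" if "dim_row Y = ?n" for Y
    using that by (simp add: e_def mat_ring rr)
  have Kv0: "?K * v0 = ?s \<cdot>\<^sub>m v0"
    unfolding v0_def by (simp add: mat_assoc_eq[OF Ke] mat_ring)
  have LK: "L * ?K = ?s \<cdot>\<^sub>m L"
    unfolding L_def by (simp add: mat_ring eK mult.commute)
  have LBCv0: "L * (?B * (?C * v0)) = 1\<^sub>m (Suc 0)"
  proof -
    have "L * (?B * (?C * v0)) = (1 / ?c) \<cdot>\<^sub>m (urow ?n a * ((?B * (?C * e r)) * ucol ?n b))"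
      unfolding L_def v0_def by (simp add: mat_ring eBC mat_assoc_eq[OF ee])
    also have "\<dots> = 1\<^sub>m (Suc 0)"
      using ab r(2) by (subst entry_urow_ucol) (simp_all add: mat_ring)
    finally show ?thesis .
  qed
  \<comment> \<open>L and v0 belong to the same eigenvalue of K, so L kills the image of v0 under
    operators that anticommute with K.\<close>
  have odd: "L * (X' * v0) = 0\<^sub>m (Suc 0) (Suc 0)"
    if "?K * X' = (-1) \<cdot>\<^sub>m (X' * ?K)" "dim_row X' = ?n" "dim_col X' = ?n" for X'
  proof -
    have "?s \<cdot>\<^sub>m (L * (X' * v0)) = L * (?K * (X' * v0))"
      using that(2,3) by (simp add: mat_assoc_eq[OF LK] mat_ring)
    also have "\<dots> = (- ?s) \<cdot>\<^sub>m (L * (X' * v0))"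
      using that(2,3) by (simp add: mat_assoc_eq[OF that(1)] mat_ring Kv0)
    finally have eq: "?s \<cdot>\<^sub>m (L * (X' * v0)) = (- ?s) \<cdot>\<^sub>m (L * (X' * v0))" .
    have "(L * (X' * v0)) $$ (0, 0) = 0"
    proof -
      have "?s * (L * (X' * v0)) $$ (0, 0) = (- ?s) * (L * (X' * v0)) $$ (0, 0)"
        using arg_cong[OF eq, of "\<lambda>M. M $$ (0, 0)"] that(2,3) by (simp del: index_mult_mat(1))
      then show ?thesis by simp
    qed
    then show ?thesis using that(2,3) by (intro eq_matI) (simp_all del: index_mult_mat(1))
  qed
  note LB = odd[OF rr(4)] and LC = odd[OF rr(5)]
  define d where "d = (L * v0) $$ (0, 0)"
  have Lv0: "L * v0 = d \<cdot>\<^sub>m 1\<^sub>m (Suc 0)" unfolding d_def by (rule one_by_one) simp_all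
  \<comment> \<open>Subtracting d times xi_1 xi_2 v0 achieves L v = 0 without affecting xi_1 v, xi_2
    v or xi_1 xi_2 v.\<close>
  define v where "v = v0 + (- d) \<cdot>\<^sub>m (?B * (?C * v0))"
  have [simp]: "dim_row v = ?n" "dim_col v = Suc 0" by (simp_all add: v_def)
  have Kv: "?K * v = ?s \<cdot>\<^sub>m v"
    unfolding v_def by (simp add: mat_ring rr Kv0 mult.commute)
  have Lv: "L * v = 0\<^sub>m (Suc 0) (Suc 0)"
    unfolding v_def by (simp add: mat_ring LBCv0 Lv0) (rule eq_matI; simp)
  have LBv: "L * (?B * v) = 0\<^sub>m (Suc 0) (Suc 0)" and LCv: "L * (?C * v) = 0\<^sub>m (Suc 0) (Suc 0)"
    unfolding v_def by (simp_all add: mat_ring rr LB LC)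
  have LBCv: "L * (?B * (?C * v)) = 1\<^sub>m (Suc 0)"
    unfolding v_def by (simp add: mat_ring rr LBCv0)
  \<comment> \<open>The coordinates dual to v, xi_1 v, xi_2 v, xi_1 xi_2 v under the functional L,
    with the sign coming from xi_2 xi_1 = - xi_1 xi_2.\<close>
  define p where "p = ucol 4 3 * L + ucol 4 2 * (L * ?B) + (-1) \<cdot>\<^sub>m (ucol 4 (Suc 0) * (L * ?C)) + ucol 4 0 * (L * (?B * ?C))"
  have [simp]: "dim_row p = 4" "dim_col p = ?n" by (simp_all add: p_def)
  have LKY: "L * (?K * Y) = ?s \<cdot>\<^sub>m (L * Y)" if "dim_row Y = ?n" for Y
    using that by (simp add: mat_assoc_eq[OF LK] mat_ring)
  have BK: "?B * ?K = (-1) \<cdot>\<^sub>m (?K * ?B)" "?C * ?K = (-1) \<cdot>\<^sub>m (?K * ?C)"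
    by (simp_all add: rr mat_ring)
  have BKY: "?B * (?K * Y) = (-1) \<cdot>\<^sub>m (?K * (?B * Y))" "?C * (?K * Y) = (-1) \<cdot>\<^sub>m (?K * (?C * Y))" if "dim_row Y = ?n" for Y
    using that by (simp_all add: rr mat_ring)
  have p: "p \<in> Hom X (module_P r)"
  proof (rule HomI[OF X module_P(1)])
    show "p * ?K = opK (module_P r) * p"
      unfolding p_def module_P
      by (simp add: mat_ring P_rules_mult BK BKY LK LKY)
    show "p * ?B = op1 (module_P r) * p"
      unfolding p_def module_P
      by (simp add: mat_ring P_rules_mult rr)
    show "p * ?C = op2 (module_P r) * p"
      unfolding p_def module_P
      by (simp add: mat_ring P_rules_mult rr)
  qed (simp_all add: module_P)
  have "from_P X v \<in> Hom (module_P r) X" by (rule from_P_Hom[OF X _ _ Kv]) simp_all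
  moreover have "p * from_P X v = 1\<^sub>m 4"
  proof -
    have L': "L * (v * Y) = 0\<^sub>m (Suc 0) (dim_col Y)" "L * (?B * (v * Y)) = 0\<^sub>m (Suc 0) (dim_col Y)"
       "L * (?C * (v * Y)) = 0\<^sub>m (Suc 0) (dim_col Y)" "L * (?B * (?C * (v * Y))) = Y" if "dim_row Y = Suc 0" for Y
      using that mat_assoc_eq[OF Lv, of Y] mat_assoc_eq[OF LBv, of Y] mat_assoc_eq[OF LCv, of Y] mat_assoc_eq[OF LBCv, of Y]
      by (simp_all add: mat_ring)
    show ?thesis
      unfolding unit4_complete[symmetric] p_def from_P_def
      by (simp add: mat_ring rr L')
  qed
  ultimately show ?thesis using that[OF r(1) _ p] by blast
qed

definition indecomposable :: "k2_module \<Rightarrow> bool" where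
  "indecomposable X \<longleftrightarrow> (\<forall>e\<in>Hom X X. e * e = e \<longrightarrow> e = 0\<^sub>m (vdim X) (vdim X) \<or> e = 1\<^sub>m (vdim X))"

lemma indecomposable_iso:
  assumes R: "X \<in> Rep" "Y \<in> Rep" and "module_iso X Y" "indecomposable X"
  shows "indecomposable Y"
  unfolding indecomposable_def
proof (intro ballI impI)
  fix e assume e: "e \<in> Hom Y Y" "e * e = e"
  obtain S T where ST: "S \<in> Hom X Y" "T \<in> Hom Y X" "S * T = 1\<^sub>m (vdim Y)" "T * S = 1\<^sub>m (vdim X)"
    using assms(3) unfolding module_iso_def by blast
  note [simp] = HomD(1,2)[OF ST(1)] HomD(1,2)[OF ST(2)] HomD(1,2)[OF e(1)]
  have "T * (e * S) \<in> Hom X X" by (rule Hom_comp[OF R(1,2,1) ST(2) Hom_comp[OF R(1,2,2) e(1) ST(1)]])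
  moreover have "T * (e * S) * (T * (e * S)) = T * (e * S)"
    by (simp add: mat_assoc mat_assoc_eq[OF ST(3)] mat_one_zero mat_assoc_eq[OF e(2)])
  ultimately have "T * (e * S) = 0\<^sub>m (vdim X) (vdim X) \<or> T * (e * S) = 1\<^sub>m (vdim X)"
    using assms(4) unfolding indecomposable_def by blast
  moreover have "S * (T * (e * S)) * T = e"
    by (simp add: mat_assoc mat_assoc_eq[OF ST(3)] ST(3) mat_one_zero)
  moreover have "S * 0\<^sub>m (vdim X) (vdim X) * T = 0\<^sub>m (vdim Y) (vdim Y)" "S * 1\<^sub>m (vdim X) * T = 1\<^sub>m (vdim Y)"
    by (simp_all add: mat_one_zero ST(3))
  ultimately show "e = 0\<^sub>m (vdim Y) (vdim Y) \<or> e = 1\<^sub>m (vdim Y)" by auto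
qed

lemma inverse_Hom:
  assumes X: "X \<in> Rep" and Y: "Y \<in> Rep" and S: "S \<in> Hom X Y"
    and T: "dim_row T = vdim X" "dim_col T = vdim Y" "S * T = 1\<^sub>m (vdim Y)" "T * S = 1\<^sub>m (vdim X)"
  shows "module_iso X Y"
proof -
  note [simp] = Rep_act(1,2)[OF X] Rep_act(1,2)[OF Y] HomD(1,2)[OF S] T(1,2)
  have "T * act Y x = act X x * T" for x
  proof -
    have "T * act Y x = T * (act Y x * (S * T))" by (simp add: T(3) mat_one_zero)
    also have "\<dots> = T * ((act Y x * S) * T)" by (simp add: mat_assoc)
    also have "\<dots> = act X x * T"
      unfolding HomD(3)[OF S, symmetric] by (simp add: mat_assoc mat_assoc_eq[OF T(4)] mat_one_zero)
    finally show ?thesis .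
  qed
  then have "T \<in> Hom Y X" by (simp add: Hom_def carrier_dim)
  then show ?thesis unfolding module_iso_def using S T by blast
qed

text \<open>A \<open>K\<close>-equivariant projection onto the image of \<open>\<xi>\<^sub>1\<close> and \<open>\<xi>\<^sub>2\<close>.\<close>

lemma radical_projection:
  assumes X: "X \<in> Rep" and z: "op1 X * op2 X = 0\<^sub>m (vdim X) (vdim X)"
  obtains c where "dim_row c = vdim X" "dim_col c = vdim X" "opK X * c = c * opK X"
    "c * c = c" "c * op1 X = op1 X" "c * op2 X = op2 X"
    "op1 X * c = 0\<^sub>m (vdim X) (vdim X)" "op2 X * c = 0\<^sub>m (vdim X) (vdim X)"
proof -
  let ?n = "vdim X" and ?K = "opK X" and ?B = "op1 X" and ?C = "op2 X"
  note [simp] = Rep_act(1,2)[OF X]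
  note rr = relations_rules[OF Rep_relations[OF X]]
  have z': "?B * (?C * Y) = 0\<^sub>m ?n (dim_col Y)" if "dim_row Y = ?n" for Y
    using that by (simp add: mat_assoc_eq[OF z] mat_one_zero)
  define G where "G = ?B * pr1 ?n ?n + ?C * pr2 ?n ?n"
  have [simp]: "dim_row G = ?n" "dim_col G = ?n + ?n" by (simp_all add: G_def)
  obtain k P Q where [simp]: "dim_row P = k" "dim_col P = ?n" "dim_row Q = ?n + ?n" "dim_col Q = k"
    and PQ: "G * (Q * (P * G)) = G"
    by (rule rank_factorization[of G ?n "?n + ?n"]) simp_all
  define q where "q = G * (Q * P)"
  have [simp]: "dim_row q = ?n" "dim_col q = ?n" by (simp_all add: q_def)
  have qG: "q * G = G" using PQ by (simp add: q_def mat_assoc)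
  have GB: "G * in1 ?n ?n = ?B" and GC: "G * in2 ?n ?n = ?C" by (simp_all add: G_def mat_ring in_pr)
  have qB: "q * ?B = ?B" unfolding GB[symmetric] by (simp add: mat_assoc_eq[OF qG])
  have qC: "q * ?C = ?C" unfolding GC[symmetric] by (simp add: mat_assoc_eq[OF qG])
  have Bq: "?B * q = 0\<^sub>m ?n ?n" "?C * q = 0\<^sub>m ?n ?n"
    by (simp_all add: q_def G_def mat_ring rr z')
  have qq: "q * q = q" using qG by (simp add: q_def mat_assoc_eq)
  obtain H L where [simp]: "dim_row H = ?n" "dim_col H = ?n" "dim_row L = ?n" "dim_col L = ?n"
    and q: "q = ?B * H + ?C * L"
  proof
    show "q = ?B * (pr1 ?n ?n * (Q * P)) + ?C * (pr2 ?n ?n * (Q * P))"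
      by (simp add: q_def G_def mat_ring)
  qed simp_all
  have qKq: "q * (?K * q) = ?K * q"
    by (subst (2 3) q) (simp add: mat_ring rr mat_assoc_eq[OF qB] mat_assoc_eq[OF qC])
  have qKqY: "q * (?K * (q * Y)) = ?K * (q * Y)" if "dim_row Y = ?n" for Y
    using that mat_assoc_eq[OF qKq, of Y] by (simp add: mat_assoc)
  have BqY: "?B * (q * Y) = 0\<^sub>m ?n (dim_col Y)" "?C * (q * Y) = 0\<^sub>m ?n (dim_col Y)" if "dim_row Y = ?n" for Y
    using that by (simp_all add: mat_assoc_eq[OF Bq(1)] mat_assoc_eq[OF Bq(2)] mat_one_zero)
  \<comment> \<open>Averaging q over K. The image of q is K-stable, that is q K q = K q, which makes
    the average idempotent again.\<close>
  define c where "c = (1/2) \<cdot>\<^sub>m (q + ?K * (q * ?K))"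
  have BK: "?B * (?K * Y) = (-1) \<cdot>\<^sub>m (?K * (?B * Y))" "?C * (?K * Y) = (-1) \<cdot>\<^sub>m (?K * (?C * Y))" if "dim_row Y = ?n" for Y
    using that by (simp_all add: rr mat_ring)
  show ?thesis
  proof (rule that[of c])
    show "dim_row c = ?n" "dim_col c = ?n" by (simp_all add: c_def)
    show "?K * c = c * ?K"
      by (simp add: c_def mat_ring rr) (rule eq_matI; simp add: algebra_simps del: index_mult_mat(1))
    show "c * c = c"
      by (simp add: c_def mat_ring rr qq qKq qKqY mat_assoc_eq[OF qq]) (rule eq_matI; simp add: algebra_simps del: index_mult_mat(1))
    show "c * ?B = ?B" "c * ?C = ?C"
      by (simp_all add: c_def mat_ring rr qB qC mat_assoc_eq[OF qB] mat_assoc_eq[OF qC])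
        (rule eq_matI; simp add: algebra_simps del: index_mult_mat(1))+
    show "?B * c = 0\<^sub>m ?n ?n" "?C * c = 0\<^sub>m ?n ?n"
      by (simp_all add: c_def mat_ring BK Bq BqY)
  qed
qed

text \<open>xi_1 and xi_2 reverse the K-parity, so X splits into a part with odd top and even
  radical and a part of the opposite kind. The idempotent \<open>e\<close> projects onto the first:
  it is (1 + K) / 2 on the image of c and (1 - K) / 2 on its kernel.\<close>

lemma indecomposable_parity:
  assumes X: "X \<in> Rep" and z: "op1 X * op2 X = 0\<^sub>m (vdim X) (vdim X)" and ind: "indecomposable X"
  obtains r where "r \<in> {0, 1}" "opK X * op1 X = (-1)^r \<cdot>\<^sub>m op1 X" "opK X * op2 X = (-1)^r \<cdot>\<^sub>m op2 X"
proof -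
  let ?n = "vdim X" and ?K = "opK X" and ?B = "op1 X" and ?C = "op2 X"
  note [simp] = Rep_act(1,2)[OF X]
  note rr = relations_rules[OF Rep_relations[OF X]]
  obtain c where [simp]: "dim_row c = ?n" "dim_col c = ?n" and Kc: "?K * c = c * ?K"
    and c: "c * c = c" "c * ?B = ?B" "c * ?C = ?C" "?B * c = 0\<^sub>m ?n ?n" "?C * c = 0\<^sub>m ?n ?n"
    by (rule radical_projection[OF X z])
  define e where "e = (1/2) \<cdot>\<^sub>m 1\<^sub>m ?n + (-1/2) \<cdot>\<^sub>m ?K + c * ?K"
  have [simp]: "dim_row e = ?n" "dim_col e = ?n" by (simp_all add: e_def)
  have KcY: "?K * (c * Y) = c * (?K * Y)" "c * (c * Y) = c * Y" if "dim_row Y = ?n" for Y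
    using that mat_assoc_eq[OF Kc, of Y] mat_assoc_eq[OF c(1), of Y] by (simp_all add: mat_assoc)
  have e: "?B * e = (1/2) \<cdot>\<^sub>m (?B + (-1) \<cdot>\<^sub>m (?B * ?K))" "?C * e = (1/2) \<cdot>\<^sub>m (?C + (-1) \<cdot>\<^sub>m (?C * ?K))"
    unfolding e_def by (simp_all add: mat_ring mat_assoc_eq[OF c(4)] mat_assoc_eq[OF c(5)])
  have e': "e * ?B = (1/2) \<cdot>\<^sub>m (?B + (-1) \<cdot>\<^sub>m (?B * ?K))" "e * ?C = (1/2) \<cdot>\<^sub>m (?C + (-1) \<cdot>\<^sub>m (?C * ?K))"
    unfolding e_def by (simp_all add: mat_ring rr mat_assoc_eq[OF c(2)] mat_assoc_eq[OF c(3)])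
      (rule eq_matI; simp add: algebra_simps del: index_mult_mat(1))+
  have eK: "e * ?K = ?K * e"
    unfolding e_def by (simp add: mat_ring rr Kc KcY)
  have "e \<in> Hom X X"
    by (rule HomI[OF X X]) (simp_all add: eK e e')
  moreover have "e * e = e"
    unfolding e_def by (simp add: mat_ring rr Kc KcY c) (rule eq_matI; simp add: algebra_simps del: index_mult_mat(1))
  ultimately consider "e = 0\<^sub>m ?n ?n" | "e = 1\<^sub>m ?n" using ind unfolding indecomposable_def by blast
  then show ?thesis
  proof cases
    case 1
    have f: "?K * Y = (-1) \<cdot>\<^sub>m Y" if "0\<^sub>m ?n ?n = (1/2) \<cdot>\<^sub>m (Y + (-1) \<cdot>\<^sub>m (Y * ?K))" "dim_row Y = ?n" "dim_col Y = ?n"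
      "?K * Y = (-1) \<cdot>\<^sub>m (Y * ?K)" for Y
    proof -
      have "2 \<cdot>\<^sub>m 0\<^sub>m ?n ?n = 2 \<cdot>\<^sub>m ((1/2) \<cdot>\<^sub>m (Y + ?K * Y))" using that(1,4) by simp
      then have "0\<^sub>m ?n ?n = Y + ?K * Y" using that(2,3) by (simp add: mat_ring)
      then have "(-1) \<cdot>\<^sub>m Y + 0\<^sub>m ?n ?n = (-1) \<cdot>\<^sub>m Y + (Y + ?K * Y)" by simp
      also have "\<dots> = ?K * Y" using that(2,3) by (intro eq_matI) (simp_all del: index_mult_mat(1))
      finally show ?thesis using that(2,3) by (simp add: mat_ring)
    qed
    have "?B * e = 0\<^sub>m ?n ?n" "?C * e = 0\<^sub>m ?n ?n" by (simp_all add: 1 mat_one_zero)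
    note f[OF trans[OF this(1)[symmetric] e(1)] _ _ rr(4)] f[OF trans[OF this(2)[symmetric] e(2)] _ _ rr(5)]
    then show ?thesis using that[of 1] by simp
  next
    case 2
    have f: "?K * Y = Y" if "Y = (1/2) \<cdot>\<^sub>m (Y + (-1) \<cdot>\<^sub>m (Y * ?K))" "dim_row Y = ?n" "dim_col Y = ?n"
      "?K * Y = (-1) \<cdot>\<^sub>m (Y * ?K)" for Y
    proof -
      have "2 \<cdot>\<^sub>m Y = 2 \<cdot>\<^sub>m ((1/2) \<cdot>\<^sub>m (Y + ?K * Y))" using that(1,4) by simp
      then have "2 \<cdot>\<^sub>m Y = Y + ?K * Y" using that(2,3) by (simp add: mat_ring)
      then have "(-1) \<cdot>\<^sub>m Y + 2 \<cdot>\<^sub>m Y = (-1) \<cdot>\<^sub>m Y + (Y + ?K * Y)" by simp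
      also have "\<dots> = ?K * Y" using that(2,3) by (intro eq_matI) (simp_all del: index_mult_mat(1))
      also have "(-1) \<cdot>\<^sub>m Y + 2 \<cdot>\<^sub>m Y = Y" by (intro eq_matI) simp_all
      finally show ?thesis by simp
    qed
    have "?B * e = ?B" "?C * e = ?C" by (simp_all add: 2 mat_one_zero)
    note f[OF trans[OF this(1)[symmetric] e(1)] _ _ rr(4)] f[OF trans[OF this(2)[symmetric] e(2)] _ _ rr(5)]
    then show ?thesis using that[of 0] by (simp add: mat_one_zero)
  qed
qed

text \<open>\<open>f\<close> and \<open>g\<close> project onto the K-eigenspaces that contain the
  images and the sources of xi_1 and xi_2. The identity endomorphism has supertrace (-1)^r (l - m),
  so the absence of a trace forces both to have the same dimension.\<close>

lemma parity_pencil: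
  assumes X: "X \<in> Rep" and K: "opK X * op1 X = (-1)^r \<cdot>\<^sub>m op1 X" "opK X * op2 X = (-1)^r \<cdot>\<^sub>m op2 X"
    and no_trace: "\<not> has_trace X"
  obtains n A B where "dim_row A = n" "dim_col A = n" "dim_row B = n" "dim_col B = n"
    "module_iso X (pencil_module n r A B)"
proof -
  let ?n = "vdim X" and ?K = "opK X" and ?B = "op1 X" and ?C = "op2 X" and ?s = "(-1)^r :: complex"
  note [simp] = Rep_act(1,2)[OF X]
  note rr = relations_rules[OF Rep_relations[OF X]]
  have idem: "\<exists>k i p. dim_row i = ?n \<and> dim_col i = k \<and> dim_row p = k \<and> dim_col p = ?n \<and> p * i = 1\<^sub>m k \<and> i * p = e
      \<and> e * i = i \<and> p * e = p"
    if "e * e = e" and [simp]: "dim_row e = ?n" "dim_col e = ?n" for e :: "complex mat"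
  proof -
    obtain k P Q where [simp]: "dim_row P = k" "dim_col P = ?n" "dim_row Q = ?n" "dim_col Q = k"
      and PQ: "P * (e * Q) = 1\<^sub>m k" "e * (Q * (P * e)) = e"
      by (rule rank_factorization[of e ?n ?n]) simp_all
    have ee: "e * (e * Y) = e * Y" if "dim_row Y = ?n" for Y
      using mat_assoc_eq[OF \<open>e * e = e\<close>, of Y] that by simp
    show ?thesis
      by (intro exI[of _ k] exI[of _ "e * Q"] exI[of _ "P * e"])
        (simp add: mat_assoc ee PQ \<open>e * e = e\<close>)
  qed
  define f where "f = (1/2) \<cdot>\<^sub>m (1\<^sub>m ?n + ?s \<cdot>\<^sub>m ?K)"
  define g where "g = (1/2) \<cdot>\<^sub>m (1\<^sub>m ?n + (- ?s) \<cdot>\<^sub>m ?K)"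
  have [simp]: "dim_row f = ?n" "dim_col f = ?n" "dim_row g = ?n" "dim_col g = ?n" by (simp_all add: f_def g_def)
  have ff: "f * f = f" and gg: "g * g = g" and fg: "f * g = 0\<^sub>m ?n ?n" and gf: "g * f = 0\<^sub>m ?n ?n"
    by (simp_all add: f_def g_def mat_ring rr)
      (rule eq_matI; simp add: sign_square algebra_simps del: index_mult_mat(1))+
  have gf1: "g + f = 1\<^sub>m ?n"
    unfolding f_def g_def by (rule eq_matI) (simp_all add: algebra_simps)
  obtain l i2 p2 where [simp]: "dim_row i2 = ?n" "dim_col i2 = l" "dim_row p2 = l" "dim_col p2 = ?n"
    and 2: "p2 * i2 = 1\<^sub>m l" "i2 * p2 = f" "f * i2 = i2" "p2 * f = p2"
    using idem[OF ff] by auto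
  obtain m i1 p1 where [simp]: "dim_row i1 = ?n" "dim_col i1 = m" "dim_row p1 = m" "dim_col p1 = ?n"
    and 1: "p1 * i1 = 1\<^sub>m m" "i1 * p1 = g" "g * i1 = i1" "p1 * g = p1"
    using idem[OF gg] by auto
  have Kf: "?K * f = ?s \<cdot>\<^sub>m f" "f * ?K = ?s \<cdot>\<^sub>m f" and Kg: "?K * g = (- ?s) \<cdot>\<^sub>m g" "g * ?K = (- ?s) \<cdot>\<^sub>m g"
    by (simp_all add: f_def g_def mat_ring rr)
      (rule eq_matI; simp add: sign_square algebra_simps del: index_mult_mat(1))+
  have "tr ?K = tr (?s \<cdot>\<^sub>m f + (- ?s) \<cdot>\<^sub>m g)"
    by (rule arg_cong[of _ _ tr], rule eq_matI) (simp_all add: f_def g_def sign_square algebra_simps)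
  also have "\<dots> = ?s * tr f - ?s * tr g" by (simp add: tr_linear)
  also have "tr f = of_nat l" unfolding 2(2)[symmetric] by (subst tr_comm) (simp_all add: 2 tr_linear)
  also have "tr g = of_nat m" unfolding 1(2)[symmetric] by (subst tr_comm) (simp_all add: 1 tr_linear)
  finally have "tr (?K * 1\<^sub>m ?n) = ?s * (of_nat l - of_nat m)" by (simp add: algebra_simps mat_one_zero)
  then have lm: "l = m"
    using no_trace Hom_one[OF X] unfolding has_trace_def by auto
  have p1K: "p1 * ?K = (- ?s) \<cdot>\<^sub>m p1" using mat_assoc_eq[OF 1(4), of ?K] by (simp add: Kg mat_smult_mult 1(4))
  have p2K: "p2 * ?K = ?s \<cdot>\<^sub>m p2" using mat_assoc_eq[OF 2(4), of ?K] by (simp add: Kf mat_smult_mult 2(4))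
  have p1i2: "p1 * i2 = 0\<^sub>m m m"
  proof -
    have "p1 * i2 = (p1 * g) * (f * i2)" by (simp add: 1 2)
    also have "\<dots> = p1 * (g * f * i2)" by (simp add: mat_assoc)
    finally show ?thesis by (simp add: gf mat_one_zero lm)
  qed
  have p2i1: "p2 * i1 = 0\<^sub>m m m"
  proof -
    have "p2 * i1 = (p2 * f) * (g * i1)" by (simp add: 1 2)
    also have "\<dots> = p2 * (f * g * i1)" by (simp add: mat_assoc)
    finally show ?thesis by (simp add: fg mat_one_zero lm)
  qed
  have BK: "?B * ?K = (- ?s) \<cdot>\<^sub>m ?B" "?C * ?K = (- ?s) \<cdot>\<^sub>m ?C"
    using rr(4,5) K by (simp_all add: mat_one_zero) (metis mat_one_zero(8,9) mult_minus1 minus_minus)+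
  have Bg: "Y * g = Y" "f * Y = Y" if "Y * ?K = (- ?s) \<cdot>\<^sub>m Y" "?K * Y = ?s \<cdot>\<^sub>m Y" "dim_row Y = ?n" "dim_col Y = ?n" for Y
    using that by (simp_all add: f_def g_def mat_ring sign_square) (rule eq_matI; simp)+
  have p1Y: "p1 * Y = 0\<^sub>m m ?n" if "f * Y = Y" "dim_row Y = ?n" "dim_col Y = ?n" for Y
  proof -
    have "p1 * Y = p1 * (i2 * (p2 * Y))" using that by (simp add: mat_assoc_eq[OF 2(2)])
    also have "\<dots> = 0\<^sub>m m ?n" using that by (simp add: mat_assoc_eq[OF p1i2] lm mat_one_zero)
    finally show ?thesis .
  qed
  have p2Y: "p2 * Y = p2 * (Y * (i1 * p1))" if "Y * g = Y" for Y by (simp add: 1 that)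
  let ?A = "p2 * (?B * i1)" and ?D = "p2 * (?C * i1)"
  let ?S = "in1 m m * p1 + in2 m m * p2" and ?T = "i1 * pr1 m m + i2 * pr2 m m"
  note [simp] = lm
  note pm = pencil_module[of ?A m ?D r, simplified]
  have "?S \<in> Hom X (pencil_module m r ?A ?D)"
    by (rule HomI[OF X pm(1)])
      (simp_all add: pm pencil_K_def mat_ring in_pr p1K p2K p1Y[OF Bg(2)[OF BK(1) K(1)]] p1Y[OF Bg(2)[OF BK(2) K(2)]]
        p2Y[OF Bg(1)[OF BK(1) K(1)]] p2Y[OF Bg(1)[OF BK(2) K(2)]])
  moreover have "?S * ?T = 1\<^sub>m (m + m)"
    using 1(1) 2(1) by (simp add: mat_ring mat_assoc_eq[OF 1(1)] mat_assoc_eq[OF 2(1)] mat_assoc_eq[OF p1i2] mat_assoc_eq[OF p2i1] in_pr_eqs)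
  moreover have "?T * ?S = 1\<^sub>m ?n"
    by (simp add: mat_ring in_pr 1 2 gf1)
  ultimately have "module_iso X (pencil_module m r ?A ?D)"
    by (intro inverse_Hom[OF X pm(1), of ?S ?T]) (simp_all add: pm)
  then show ?thesis using that[of ?A m ?D] by simp
qed

text \<open>The projection onto the first Jordan block commutes with C and is nonzero, hence it is
  the identity and there is no other block.\<close>

lemma single_jordan_block:
  fixes C :: "complex mat"
  assumes [simp]: "dim_row C = n" "dim_col C = n" and n: "n > 0"
    and ind: "\<And>E. dim_row E = n \<Longrightarrow> dim_col E = n \<Longrightarrow> E * E = E \<Longrightarrow> E * C = C * E \<Longrightarrow> E = 0\<^sub>m n n \<or> E = 1\<^sub>m n"
  obtains P Q a where "dim_row P = n" "dim_col P = n" "dim_row Q = n" "dim_col Q = n"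
    "P * Q = 1\<^sub>m n" "Q * P = 1\<^sub>m n" "C = P * (jordan_block n a * Q)"
proof -
  have C: "C \<in> carrier_mat n n" by (simp add: carrier_dim)
  obtain as where "char_poly C = (\<Prod>a\<leftarrow>as. [:- a, 1:])" using char_poly_factorized[OF C] by auto
  then obtain bs where bs: "jordan_nf C bs" using jordan_nf_exists[OF C] by blast
  then obtain m P Q where PQ: "{C, jordan_matrix bs, P, Q} \<subseteq> carrier_mat m m" "P * Q = 1\<^sub>m m" "Q * P = 1\<^sub>m m"
    "C = P * jordan_matrix bs * Q"
    unfolding jordan_nf_def using similar_matD by blast
  then have "m = n" using C by (auto simp: carrier_dim)
  then have d [simp]: "dim_row P = n" "dim_col P = n" "dim_row Q = n" "dim_col Q = n"
    and dJ: "dim_row (jordan_matrix bs) = n" "dim_col (jordan_matrix bs) = n"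
    using PQ(1) by (simp_all only: insert_subset carrier_dim)
  note PQ' = PQ(2,3)[unfolded \<open>m = n\<close>]
  obtain b bs' where b: "bs = b # bs'" using dJ n by (cases bs) auto
  have k: "fst b > 0" using bs b unfolding jordan_nf_def by auto
  let ?k = "fst b" and ?l = "sum_list (map fst bs')"
  let ?J = "jordan_block (fst b) (snd b)"
  have nkl: "n = ?k + ?l" using dJ(1) by (simp add: b)
  have J: "jordan_matrix bs = in1 ?k ?l * (?J * pr1 ?k ?l) + in2 ?k ?l * (jordan_matrix bs' * pr2 ?k ?l)"
  proof -
    have "jordan_matrix bs = four_block_mat ?J (0\<^sub>m ?k ?l) (0\<^sub>m ?l ?k) (jordan_matrix bs')"
      using jordan_matrix_dim[of bs'] unfolding b by (simp add: jordan_matrix_def Let_def case_prod_unfold)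
    then show ?thesis by (simp add: four_block_in_pr mat_ring)
  qed
  define D where "D = in1 ?k ?l * pr1 ?k ?l"
  have [simp]: "dim_row D = n" "dim_col D = n" by (simp_all add: D_def nkl)
  have DD: "D * D = D" by (simp add: D_def mat_ring in_pr)
  have DJ: "D * jordan_matrix bs = jordan_matrix bs * D"
    unfolding J D_def by (simp add: mat_ring in_pr)
  define M where "M = jordan_matrix bs"
  have [simp]: "dim_row M = n" "dim_col M = n" using dJ by (simp_all only: M_def)
  have CE: "C = P * (M * Q)" using PQ(4) by (simp add: mat_assoc M_def[symmetric])
  have "(P * (D * Q)) * (P * (D * Q)) = P * (D * Q)"
    by (simp add: mat_assoc mat_assoc_eq[OF PQ'(2)] mat_one_zero mat_assoc_eq[OF DD])
  moreover have "(P * (D * Q)) * C = C * (P * (D * Q))"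
    unfolding CE by (simp add: mat_assoc mat_assoc_eq[OF PQ'(2)] mat_one_zero mat_assoc_eq[OF DJ[folded M_def]])
  ultimately have "P * (D * Q) = 0\<^sub>m n n \<or> P * (D * Q) = 1\<^sub>m n" by (intro ind) simp_all
  moreover have "Q * (P * (D * Q)) * P = D"
    by (simp add: mat_assoc mat_assoc_eq[OF PQ'(2)] mat_one_zero PQ')
  ultimately have D: "D = 0\<^sub>m n n \<or> D = 1\<^sub>m n" by (auto simp: mat_one_zero PQ')
  have "D $$ (0, 0) = 1" using k by (simp add: D_def in_mult_index pr1_def del: index_mult_mat(1))
  then have D1: "D = 1\<^sub>m n" using D n by auto
  have z: "(in1 k l * pr1 k l) $$ (k, k) = 0" if "l > 0" for k l
    using that by (simp add: in_mult_index del: index_mult_mat(1))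
  have "?l = 0"
  proof (rule ccontr)
    assume "?l \<noteq> 0"
    then have "D $$ (?k, ?k) = 0" unfolding D_def by (intro z) (rule neq0_conv[THEN iffD1])
    moreover have "?k < n" using nkl \<open>?l \<noteq> 0\<close> by linarith
    then have "D $$ (?k, ?k) = 1" using D1 by simp
    ultimately show False by simp
  qed
  have "bs' = []"
  proof (cases bs')
    case (Cons c cs)
    then show ?thesis using bs \<open>?l = 0\<close> unfolding jordan_nf_def b by auto
  qed
  then have "jordan_matrix bs = jordan_block n (snd b)"
    using nkl by (simp add: b jordan_matrix_def case_prod_unfold del: diag_block_mat.simps)
  then show ?thesis using that[of P Q "snd b"] PQ' CE by (simp add: M_def)
qed

section \<open>Normal form of regular pencils\<close>

definition indecomposable_pencil :: "nat \<Rightarrow> complex mat \<Rightarrow> complex mat \<Rightarrow> bool" where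
  "indecomposable_pencil n A B \<longleftrightarrow> (\<forall>E F. dim_row E = n \<longrightarrow> dim_col E = n \<longrightarrow> dim_row F = n \<longrightarrow> dim_col F = n \<longrightarrow>
     E * E = E \<longrightarrow> F * F = F \<longrightarrow> F * A = A * E \<longrightarrow> F * B = B * E \<longrightarrow> E = 0\<^sub>m n n \<or> E = 1\<^sub>m n)"

lemma pencil_indecomposable:
  assumes dims [simp]: "dim_row A = n" "dim_col A = n" "dim_row B = n" "dim_col B = n"
    and ind: "indecomposable (pencil_module n r A B)"
  shows "indecomposable_pencil n A B"
  unfolding indecomposable_pencil_def
proof (intro allI impI)
  fix E F assume [simp]: "dim_row E = n" "dim_col E = n" "dim_row F = n" "dim_col F = n"
    and EF: "E * E = E" "F * F = F" "F * A = A * E" "F * B = B * E"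
  let ?E = "in1 n n * (E * pr1 n n) + in2 n n * (F * pr2 n n)"
  have "?E \<in> Hom (pencil_module n r A B) (pencil_module n r A B)"
    by (rule pencil_Hom) (simp_all add: EF)
  moreover have "?E * ?E = ?E" by (simp add: mat_ring in_pr mat_assoc_eq[OF EF(1)] mat_assoc_eq[OF EF(2)])
  ultimately have "?E = 0\<^sub>m (n + n) (n + n) \<or> ?E = 1\<^sub>m (n + n)"
    using ind unfolding indecomposable_def by (simp add: pencil_module)
  moreover have "E = pr1 n n * (Y * in1 n n)" if "?E = Y" for Y
    unfolding that[symmetric] by (simp add: mat_ring in_pr)
  ultimately have "E = pr1 n n * (0\<^sub>m (n + n) (n + n) * in1 n n) \<or> E = pr1 n n * (1\<^sub>m (n + n) * in1 n n)" by blast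
  then show "E = 0\<^sub>m n n \<or> E = 1\<^sub>m n" by (simp add: mat_ring in_pr)
qed

lemma inverse_det_nonzero:
  fixes A :: "complex mat"
  assumes "dim_row A = n" "dim_col A = n" "A * B = 1\<^sub>m n" "dim_row B = n" "dim_col B = n"
  shows "det A \<noteq> 0"
proof -
  have "det A * det B = det (A * B)" by (rule det_mult[symmetric, of _ n]) (use assms in \<open>simp_all add: carrier_dim\<close>)
  then show ?thesis using assms(3) by auto
qed

text \<open>With A invertible, the pencil is equivalent to (1, A^(-1) B). An idempotent E commuting
  with A^(-1) B extends to the pencil by F = A E A^(-1), so A^(-1) B is a single Jordan
  block.\<close>

lemma regular_pencil_block:
  assumes dims [simp]: "dim_row A = n" "dim_col A = n" "dim_row B = n" "dim_col B = n"
    and n: "n > 0" and ind: "indecomposable_pencil n A B" and A: "det A \<noteq> 0"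
  obtains a P Q P' Q' where "dim_row P = n" "dim_col P = n" "dim_row Q = n" "dim_col Q = n"
    "dim_row P' = n" "dim_col P' = n" "dim_row Q' = n" "dim_col Q' = n"
    "Q * A = P" "Q * B = jordan_block n a * P" "P * P' = 1\<^sub>m n" "Q * Q' = 1\<^sub>m n"
proof -
  obtain A' where [simp]: "dim_row A' = n" "dim_col A' = n" and A': "A * A' = 1\<^sub>m n" "A' * A = 1\<^sub>m n"
    by (rule det_nonzero_inverse[OF dims(1,2) A])
  note AA = mat_assoc_eq[OF A'(1)] mat_assoc_eq[OF A'(2)]
  have ind': "E = 0\<^sub>m n n \<or> E = 1\<^sub>m n" if [simp]: "dim_row E = n" "dim_col E = n" and E: "E * E = E" "E * (A' * B) = (A' * B) * E" for E
  proof -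
    let ?F = "A * (E * A')"
    have "?F * ?F = ?F" by (simp add: mat_assoc AA mat_one_zero mat_assoc_eq[OF E(1)])
    moreover have "?F * A = A * E" by (simp add: mat_assoc A' mat_one_zero)
    moreover have "?F * B = B * E"
    proof -
      have "?F * B = A * (E * (A' * B))" by (simp add: mat_assoc)
      also have "\<dots> = B * E" unfolding E(2) by (simp add: mat_assoc AA mat_one_zero)
      finally show ?thesis .
    qed
    ultimately show ?thesis using ind[unfolded indecomposable_pencil_def, rule_format, of E ?F] E(1) by simp
  qed
  obtain P Q a where [simp]: "dim_row P = n" "dim_col P = n" "dim_row Q = n" "dim_col Q = n"
    and PQ: "P * Q = 1\<^sub>m n" "Q * P = 1\<^sub>m n" and eq: "A' * B = P * (jordan_block n a * Q)"
    by (rule single_jordan_block[OF _ _ n ind', of "A' * B"]) (simp_all add: mat_assoc)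
  show ?thesis
  proof (rule that[of Q "Q * A'" P "A * P" a])
    show "Q * A' * A = Q" by (simp add: mat_assoc A' mat_one_zero)
    show "Q * A' * B = jordan_block n a * Q"
      by (simp add: mat_assoc eq mat_assoc_eq[OF PQ(2)] mat_one_zero)
    show "Q * A' * (A * P) = 1\<^sub>m n" by (simp add: mat_assoc AA mat_one_zero PQ)
  qed (simp_all add: PQ)
qed

lemma det_jordan_block:
  assumes "a \<noteq> (0 :: complex)"
  shows "det (jordan_block n a) \<noteq> 0"
proof -
  obtain B where "dim_row B = n" "dim_col B = n" "jordan_block n a * B = 1\<^sub>m n"
    by (rule triangular_inverse[of "jordan_block n a" n]) (simp_all add: assms)
  then show ?thesis by (intro inverse_det_nonzero[of _ n B]) simp_all
qed

text \<open>If A is invertible the point is finite. Otherwise, relative to the invertible A + c B,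
  the matrix A is a Jordan block with eigenvalue 0, so c B corresponds to 1 - N and is invertible.
  Exchanging A and B then gives the point at infinity.\<close>

lemma indecomposable_regular_pencil:
  assumes dims [simp]: "dim_row A = n" "dim_col A = n" "dim_row B = n" "dim_col B = n"
    and n: "n > 0" and ind: "indecomposable (pencil_module n r A B)" and reg: "det (A + c \<cdot>\<^sub>m B) \<noteq> 0"
  obtains \<eta> where "module_iso (pencil_module n r A B) (module_M n r \<eta>)"
proof (cases "det A = 0")
  case False
  obtain a P Q P' Q' where PQ: "dim_row P = n" "dim_col P = n" "dim_row Q = n" "dim_col Q = n"
    "dim_row P' = n" "dim_col P' = n" "dim_row Q' = n" "dim_col Q' = n"
    "Q * A = P" "Q * B = jordan_block n a * P" "P * P' = 1\<^sub>m n" "Q * Q' = 1\<^sub>m n"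
    by (rule regular_pencil_block[OF dims n pencil_indecomposable[OF dims ind] False])
  have "module_iso (pencil_module n r A B) (pencil_module n r (1\<^sub>m n) (jordan_block n a))"
    by (rule pencil_iso[of _ _ _ _ _ P Q P' Q']) (use PQ in \<open>simp_all add: mat_one_zero\<close>)
  then show ?thesis using that[of "Finite_Point a"] by (simp only: module_M_pencil)
next
  case True
  have dm: "det (M * N) = det M * det N" if "dim_row M = n" "dim_col M = n" "dim_row N = n" "dim_col N = n" for M N :: "complex mat"
    by (rule det_mult[of _ n]) (use that in \<open>simp_all add: carrier_dim\<close>)
  have zero: "a = 0" if "Q * A = jordan_block n a * P" "P * P' = 1\<^sub>m n" "dim_row P = n" "dim_col P = n" "dim_row Q = n" "dim_col Q = n"
    "dim_row P' = n" "dim_col P' = n" for a P P' Q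
  proof -
    have "det (jordan_block n a) * det P = 0"
      using dm[of Q A] dm[of "jordan_block n a" P] that True by simp
    then have "det (jordan_block n a) = 0" using inverse_det_nonzero[OF that(3,4,2,7,8)] by simp
    then show ?thesis using det_jordan_block by blast
  qed
  have c: "c \<noteq> 0" using reg True by (auto simp: mat_one_zero)
  have ind1: "indecomposable_pencil n (A + c \<cdot>\<^sub>m B) A"
    unfolding indecomposable_pencil_def
  proof (intro allI impI)
    fix E F assume [simp]: "dim_row E = n" "dim_col E = n" "dim_row F = n" "dim_col F = n"
      and EF: "E * E = E" "F * F = F" "F * (A + c \<cdot>\<^sub>m B) = (A + c \<cdot>\<^sub>m B) * E" "F * A = A * E"
    have "(-1) \<cdot>\<^sub>m (A * E) + (A * E + c \<cdot>\<^sub>m (F * B)) = (-1) \<cdot>\<^sub>m (A * E) + (A * E + c \<cdot>\<^sub>m (B * E))"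
      using EF(3,4) by (simp add: mat_ring)
    moreover have "(-1) \<cdot>\<^sub>m (A * E) + (A * E + Y) = Y" if "dim_row Y = n" "dim_col Y = n" for Y
      using that by (intro eq_matI) (simp_all del: index_mult_mat(1))
    ultimately have "(1 / c) \<cdot>\<^sub>m (c \<cdot>\<^sub>m (F * B)) = (1 / c) \<cdot>\<^sub>m (c \<cdot>\<^sub>m (B * E))" by simp
    then have "F * B = B * E" using c by (simp add: mat_one_zero)
    then show "E = 0\<^sub>m n n \<or> E = 1\<^sub>m n"
      using pencil_indecomposable[OF dims ind, unfolded indecomposable_pencil_def, rule_format, of E F] EF by simp
  qed
  obtain a P Q P' Q' where PQ: "dim_row P = n" "dim_col P = n" "dim_row Q = n" "dim_col Q = n"
    "dim_row P' = n" "dim_col P' = n" "dim_row Q' = n" "dim_col Q' = n"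
    "Q * (A + c \<cdot>\<^sub>m B) = P" "Q * A = jordan_block n a * P" "P * P' = 1\<^sub>m n" "Q * Q' = 1\<^sub>m n"
    by (rule regular_pencil_block[OF _ _ dims(1,2) n ind1 reg]) simp_all
  note [simp] = PQ(1-8)
  have a: "a = 0" by (rule zero[OF PQ(10,11)]) simp_all
  have "det B \<noteq> 0"
  proof -
    let ?N = "1\<^sub>m n + (-1) \<cdot>\<^sub>m jordan_block n 0 :: complex mat"
    obtain N' where "dim_row N' = n" "dim_col N' = n" "?N * N' = 1\<^sub>m n"
      by (rule triangular_inverse[of ?N n]) auto
    then have N: "det ?N \<noteq> 0" by (intro inverse_det_nonzero[of ?N n N']) simp_all
    have "c \<cdot>\<^sub>m (Q * B) = ?N * P"
    proof -
      have "c \<cdot>\<^sub>m (Q * B) = Q * (A + c \<cdot>\<^sub>m B) + (-1) \<cdot>\<^sub>m (Q * A)"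
        by (simp add: mat_ring) (rule eq_matI; simp del: index_mult_mat(1))
      also have "\<dots> = ?N * P" unfolding PQ(9,10) a by (simp add: mat_ring)
      finally show ?thesis .
    qed
    then have "(c \<cdot>\<^sub>m Q) * B = ?N * P" by (simp add: mat_smult_mult)
    then have "det (c \<cdot>\<^sub>m Q) * det B = det ?N * det P" using dm[of "c \<cdot>\<^sub>m Q" B] dm[of ?N P] by simp
    moreover have "det P \<noteq> 0" using inverse_det_nonzero[of P n P'] PQ by simp
    ultimately show ?thesis using N by auto
  qed
  have ind2: "indecomposable_pencil n B A"
    using pencil_indecomposable[OF dims ind] unfolding indecomposable_pencil_def by blast
  obtain a P Q P' Q' where PQ: "dim_row P = n" "dim_col P = n" "dim_row Q = n" "dim_col Q = n"
    "dim_row P' = n" "dim_col P' = n" "dim_row Q' = n" "dim_col Q' = n"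
    "Q * B = P" "Q * A = jordan_block n a * P" "P * P' = 1\<^sub>m n" "Q * Q' = 1\<^sub>m n"
    by (rule regular_pencil_block[OF dims(3,4,1,2) n ind2 \<open>det B \<noteq> 0\<close>])
  have a: "a = 0" by (rule zero[OF PQ(10,11)]) (use PQ in simp_all)
  have "module_iso (pencil_module n r A B) (pencil_module n r (jordan_block n 0) (1\<^sub>m n))"
    by (rule pencil_iso[of _ _ _ _ _ P Q P' Q']) (use PQ a in \<open>simp_all add: mat_one_zero\<close>)
  then show ?thesis using that[of Infinite_Point] by (simp only: module_M_pencil)
qed

lemma singular_pencil_trace:
  assumes dims [simp]: "dim_row A = n" "dim_col A = n" "dim_row B = n" "dim_col B = n"
    and sing: "\<And>t :: nat. t \<le> n \<Longrightarrow> det (A + of_nat t \<cdot>\<^sub>m B) = 0"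
  shows "has_trace (pencil_module n r A B)"
proof -
  obtain E F where [simp]: "dim_row E = n" "dim_col E = n" "dim_row F = n" "dim_col F = n"
    and EF: "F * A = A * E" "F * B = B * E" and ne: "tr E \<noteq> tr F"
    by (rule singular_pencil_endomorphism[OF assms])
  let ?h = "in1 n n * (E * pr1 n n) + in2 n n * (F * pr2 n n)"
  have h: "?h \<in> Hom (pencil_module n r A B) (pencil_module n r A B)"
    by (rule pencil_Hom) (simp_all add: EF)
  have t1: "tr (in1 n n * (E * pr1 n n)) = tr E"
    by (subst tr_comm) (simp_all add: mat_ring in_pr)
  have t2: "tr (in2 n n * (F * pr2 n n)) = tr F"
    by (subst tr_comm) (simp_all add: mat_ring in_pr)
  have "tr (opK (pencil_module n r A B) * ?h) = (-1)^r * (tr F - tr E)"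
    by (simp add: pencil_module pencil_K_def mat_ring in_pr tr_linear t1 t2 algebra_simps)
  then show ?thesis using ne unfolding has_trace_def by (intro bexI[OF _ h]) simp
qed

text \<open>Induction on the dimension: split off P(r) if xi_1 xi_2 acts nontrivially, split along a
  nontrivial idempotent if there is one, and otherwise pass to a square pencil, which is singular or
  regular.\<close>

lemma trace_or_decomposes:
  assumes "X \<in> Rep"
  shows "has_trace X \<or> decomposes X"
  using assms
proof (induction "vdim X" arbitrary: X rule: less_induct)
  case less
  note X = less.prems
  \<comment> \<open>Y may have the dimension of X if it is known to decompose; this covers X
    isomorphic to P(r).\<close>
  have summand: "has_trace X \<or> decomposes X"
    if "Y \<in> Rep" "Z \<in> Rep" "module_iso X (dsum Y Z)" "vdim Z < vdim X" "vdim Y < vdim X \<or> decomposes Y" for Y Z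
    using dsum_trace_or_decomposes[OF X that(1-3)] less.hyps[of Y] less.hyps[of Z] that by blast
  consider "vdim X = 0" | "vdim X \<noteq> 0" "op1 X * op2 X \<noteq> 0\<^sub>m (vdim X) (vdim X)"
    | "vdim X \<noteq> 0" "op1 X * op2 X = 0\<^sub>m (vdim X) (vdim X)" "\<not> indecomposable X"
    | "vdim X \<noteq> 0" "op1 X * op2 X = 0\<^sub>m (vdim X) (vdim X)" "indecomposable X" by blast
  then show ?case
  proof cases
    case 1
    have "module_iso X (direct_sum [])"
      by (rule inverse_Hom[where S = "0\<^sub>m 0 0" and T = "0\<^sub>m 0 0"])
        (auto simp: 1 X direct_sum_Nil Hom_def carrier_dim Rep_act[OF X] Rep_act[OF direct_sum_Nil(2)] intro!: eq_matI)
    then show ?thesis unfolding decomposes_def by (intro disjI2 exI[of _ "[]"]) simp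
  next
    case 2
    obtain r i p where r: "r \<in> {0, 1}" "i \<in> Hom (module_P r) X" "p \<in> Hom X (module_P r)" "p * i = 1\<^sub>m 4"
      by (rule projective_summand[OF X 2(2)])
    obtain Z where Z: "Z \<in> Rep" "module_iso X (dsum (module_P r) Z)"
      by (rule retract_complement[OF X module_P(1) r(2,3)]) (simp_all add: r module_P)
    show ?thesis
    proof (rule summand[OF module_P(1) Z])
      show "vdim Z < vdim X" using iso_vdim[OF Z(2)] by (simp add: module_P)
      show "vdim (module_P r) < vdim X \<or> decomposes (module_P r)"
        using r(1) by (intro disjI2 decomposes_single) (auto simp: standard_modules_def)
    qed
  next
    case 3
    then obtain e where e: "e \<in> Hom X X" "e * e = e" "e \<noteq> 0\<^sub>m (vdim X) (vdim X)" "e \<noteq> 1\<^sub>m (vdim X)"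
      unfolding indecomposable_def by blast
    obtain Y i p where Y: "Y \<in> Rep" "i \<in> Hom Y X" "p \<in> Hom X Y" "p * i = 1\<^sub>m (vdim Y)" "i * p = e"
      by (rule idempotent_split[OF X e(1,2)])
    obtain Z where Z: "Z \<in> Rep" "module_iso X (dsum Y Z)"
      by (rule retract_complement[OF X Y(1-4)])
    note d = HomD(1,2)[OF Y(2)] HomD(1,2)[OF Y(3)]
    have "vdim Y \<noteq> 0"
    proof
      assume "vdim Y = 0"
      then have "e = 0\<^sub>m (vdim X) (vdim X)" unfolding Y(5)[symmetric] using d by (intro eq_matI) (auto simp: scalar_prod_def)
      then show False using e by simp
    qed
    moreover have "vdim Y \<noteq> vdim X"
    proof
      assume "vdim Y = vdim X"
      then have "i * p = 1\<^sub>m (vdim X)" using Y(4) d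
        by (intro mat_mult_left_right_inverse[of p "vdim X" i]) (simp_all add: carrier_dim)
      then show False using e Y(5) by simp
    qed
    ultimately show ?thesis
      using summand[OF Y(1) Z] iso_vdim[OF Z(2)] by auto
  next
    case 4
    show ?thesis
    proof (rule disjCI)
      assume "\<not> decomposes X"
      show "has_trace X"
      proof (rule ccontr)
        assume nt: "\<not> has_trace X"
        obtain r where r: "r \<in> {0, 1}" "opK X * op1 X = (-1)^r \<cdot>\<^sub>m op1 X" "opK X * op2 X = (-1)^r \<cdot>\<^sub>m op2 X"
          by (rule indecomposable_parity[OF X 4(2,3)])
        obtain n A B where dims: "dim_row A = n" "dim_col A = n" "dim_row B = n" "dim_col B = n"
          and iso: "module_iso X (pencil_module n r A B)"
          by (rule parity_pencil[OF X r(2,3) nt])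
        note P = pencil_module(1)[OF dims, of r]
        have n: "n > 0" using iso_vdim[OF iso] 4(1) pencil_module(2)[OF dims] by simp
        have "\<not> has_trace (pencil_module n r A B)" using has_trace_iso[OF X P iso] nt by blast
        then obtain t :: nat where t: "det (A + of_nat t \<cdot>\<^sub>m B) \<noteq> 0"
          using singular_pencil_trace[OF dims] by blast
        obtain \<eta> where "module_iso (pencil_module n r A B) (module_M n r \<eta>)"
          by (rule indecomposable_regular_pencil[OF dims n indecomposable_iso[OF X P iso 4(3)] t])
        then have "module_iso X (module_M n r \<eta>)" by (rule iso_trans[OF X P module_M(1) iso])
        moreover have "module_M n r \<eta> \<in> standard_modules"
          unfolding standard_modules_def using n r(1) by (intro UnI1 CollectI exI conjI refl) (simp_all add: Suc_le_eq)
        ultimately have "decomposes X"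
          using decomposes_iso[OF X module_M(1)] decomposes_single by blast
        then show False using \<open>\<not> decomposes X\<close> by simp
      qed
    qed
  qed
qed

subsection \<open>The classification of ideals\<close>

text \<open>The strict bound demands some finite order even where f is infinite, and order 0 where f
  is 1. Null orders start at 0, which is why f takes values from 1 on.\<close>

definition null_ideal :: "(cp1 \<Rightarrow> enat) \<Rightarrow> k2_module set" where
  "null_ideal f = {X \<in> Rep. \<forall>\<eta>. \<exists>n. enat n < f \<eta> \<and> null_at \<eta> n X}"

lemma null_iso:
  assumes "X \<in> Rep" "Y \<in> Rep" "module_iso X Y" "null a b n X"
  shows "null a b n Y"
  using assms(3) null_retract[OF assms(1,2) _ _ _ assms(4)] unfolding module_iso_def by blast

lemma enat_0_less: "1 \<le> x \<Longrightarrow> enat 0 < x"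
  by (cases x) (auto simp: one_enat_def)

lemma null_ideal_tensor_ideal: "tensor_ideal (null_ideal f)"
  unfolding tensor_ideal_def subcategory_def
proof (intro conjI ballI impI)
  show "null_ideal f \<subseteq> Rep" by (auto simp: null_ideal_def)
  fix X assume "X \<in> null_ideal f"
  then have X: "X \<in> Rep" "\<And>\<eta>. \<exists>n. enat n < f \<eta> \<and> null_at \<eta> n X" by (auto simp: null_ideal_def)
  show "Y \<in> null_ideal f" if "Y \<in> Rep" "module_iso X Y" for Y
    using X(2) null_iso[OF X(1) that] that(1) unfolding null_ideal_def by blast
  show "tensor_module V X \<in> null_ideal f" if "V \<in> Rep" for V
    using X(2) null_tensor[OF that X(1)] tensor_module(1)[OF that X(1)] unfolding null_ideal_def by blast
next
  fix Y Z assume R: "Y \<in> Rep" "Z \<in> Rep" and "direct_sum [Y, Z] \<in> null_ideal f"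
  then have D: "\<And>\<eta>. \<exists>n. enat n < f \<eta> \<and> null_at \<eta> n (dsum Y Z)"
    by (auto simp: null_ideal_def direct_sum_pair)
  have "null_at \<eta> n Y" "null_at \<eta> n Z" if "null_at \<eta> n (dsum Y Z)" for \<eta> n
    using null_retract[OF dsum_Rep[OF R] R(1) dsum_Hom(1,3)[OF R] _ that]
      null_retract[OF dsum_Rep[OF R] R(2) dsum_Hom(2,4)[OF R] _ that] by (simp_all add: in_pr)
  then show "Y \<in> null_ideal f" "Z \<in> null_ideal f"
    using D R unfolding null_ideal_def by blast+
qed

lemma null_ideal_additive:
  assumes f: "\<forall>\<eta>. 1 \<le> f \<eta>"
  shows "additive_ideal (null_ideal f)"
  unfolding additive_ideal_def
proof (intro allI impI)
  fix Xs assume "set Xs \<subseteq> null_ideal f"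
  then show "direct_sum Xs \<in> null_ideal f"
  proof (induction Xs)
    case Nil
    have "enat 0 < f \<eta>" for \<eta> using f enat_0_less by blast
    then show ?case
      using null_zero[OF direct_sum_Nil(2,1)] by (auto simp: null_ideal_def direct_sum_Nil)
  next
    case (Cons X Xs)
    have "set Xs \<subseteq> Rep" using Cons.prems by (auto simp: null_ideal_def)
    moreover have XR: "X \<in> Rep" using Cons.prems by (auto simp: null_ideal_def)
    ultimately have eq: "direct_sum (X # Xs) = dsum X (direct_sum Xs)" and R: "direct_sum Xs \<in> Rep"
      by (auto simp: direct_sum_Cons direct_sum_Rep)
    have "\<exists>n. enat n < f \<eta> \<and> null_at \<eta> n (dsum X (direct_sum Xs))" for \<eta>
    proof -
      obtain n m where n: "enat n < f \<eta>" "null_at \<eta> n X" and m: "enat m < f \<eta>" "null_at \<eta> m (direct_sum Xs)"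
        using Cons.prems Cons.IH unfolding null_ideal_def by fastforce
      have "null_at \<eta> (max n m) (dsum X (direct_sum Xs))"
        by (rule null_dsum[OF XR R null_mono[OF XR n(2)] null_mono[OF R m(2)]]) simp_all
      moreover have "enat (max n m) < f \<eta>" using n m by (simp add: max_def)
      ultimately show ?thesis by blast
    qed
    then show ?case using dsum_Rep[OF XR R] unfolding eq null_ideal_def by blast
  qed
qed

lemma null_ideal_no_trace: "X \<in> null_ideal f \<Longrightarrow> \<not> has_trace X"
  unfolding null_ideal_def has_trace_def using null_trace by blast

lemma projective_in_null_ideal:
  assumes f: "\<forall>\<eta>. 1 \<le> f \<eta>" and P: "projective P"
  shows "P \<in> null_ideal f"
proof -
  have "enat 0 < f \<eta>" for \<eta> using f enat_0_less by blast
  moreover have "P \<in> Rep" using P by (simp add: projective_def)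
  ultimately show ?thesis using projective_null[OF P] unfolding null_ideal_def by blast
qed

lemma module_M_in_null_ideal:
  assumes f: "\<forall>\<eta>. 1 \<le> f \<eta>"
  shows "module_M k r \<eta> \<in> null_ideal f \<longleftrightarrow> enat k < f \<eta>"
proof
  assume "module_M k r \<eta> \<in> null_ideal f"
  then obtain n where "enat n < f \<eta>" "k \<le> n"
    unfolding null_ideal_def using module_M_null_iff by blast
  then show "enat k < f \<eta>" by (metis enat_ord_simps(1) le_less_trans)
next
  assume k: "enat k < f \<eta>"
  have "\<exists>n. enat n < f \<eta>' \<and> null_at \<eta>' n (module_M k r \<eta>)" for \<eta>'
  proof (cases "\<eta>' = \<eta>")
    case True
    then show ?thesis using k module_M_null by blast
  next
    case False
    have "enat 0 < f \<eta>'" using f enat_0_less by blast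
    then show ?thesis using module_M_other_point[OF False] by blast
  qed
  then show "module_M k r \<eta> \<in> null_ideal f"
    unfolding null_ideal_def using module_M(1) by blast
qed

lemma null_ideal_proper: "proper (null_ideal f)"
proof -
  have "has_trace (simple_V 0)"
    unfolding has_trace_def
    by (rule bexI[OF _ Hom_one[OF simple_V(1)]]) (simp add: simple_V mat_one_zero tr_linear)
  then show ?thesis using null_ideal_no_trace simple_V(1) unfolding proper_def by blast
qed

lemma null_ideal_nonzero: "\<forall>\<eta>. 1 \<le> f \<eta> \<Longrightarrow> nonzero (null_ideal f)"
  unfolding nonzero_def
  by (rule bexI[OF _ projective_in_null_ideal[OF _ module_P_projective[of 0]]]) (simp_all add: module_P)

lemma ideal_decomposition:
  assumes I: "tensor_ideal I" "additive_ideal I" and X: "X \<in> Rep" and nt: "\<not> has_trace X"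
  obtains Xs where "set Xs \<subseteq> standard_modules" "module_iso X (direct_sum Xs)" "X \<in> I \<longleftrightarrow> set Xs \<subseteq> I"
proof -
  obtain Xs where Xs: "set Xs \<subseteq> standard_modules" "module_iso X (direct_sum Xs)"
    using trace_or_decomposes[OF X] nt unfolding decomposes_def by blast
  have R: "set Xs \<subseteq> Rep" using Xs(1) standard_modules_Rep by blast
  have "X \<in> I \<longleftrightarrow> direct_sum Xs \<in> I"
    using I(1) X direct_sum_Rep[OF R] Xs(2) iso_sym[OF Xs(2)] unfolding tensor_ideal_def subcategory_def by blast
  then show ?thesis using that[OF Xs] direct_sum_iff[OF I R] by blast
qed

text \<open>Trace-free additive ideals are determined by the standard modules in them, since every
  member is a direct sum of standard modules that again lie in the ideal.\<close>

lemma ideal_subset: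
  assumes I: "tensor_ideal I" "additive_ideal I" "\<And>X. X \<in> I \<Longrightarrow> \<not> has_trace X"
    and J: "tensor_ideal J" "additive_ideal J" and sub: "I \<inter> standard_modules \<subseteq> J"
  shows "I \<subseteq> J"
proof
  fix X assume X: "X \<in> I"
  then have R: "X \<in> Rep" using I(1) by (auto simp: tensor_ideal_def subcategory_def)
  obtain Xs where Xs: "set Xs \<subseteq> standard_modules" "module_iso X (direct_sum Xs)" "X \<in> I \<longleftrightarrow> set Xs \<subseteq> I"
    by (rule ideal_decomposition[OF I(1,2) R I(3)[OF X]])
  have "set Xs \<subseteq> J" using Xs X sub by blast
  then have "direct_sum Xs \<in> J" using J(2) unfolding additive_ideal_def by blast
  then show "X \<in> J" using J(1) R iso_sym[OF Xs(2)] unfolding tensor_ideal_def subcategory_def by blast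
qed

lemma phi_null_ideal:
  assumes f: "\<forall>\<eta>. 1 \<le> f \<eta>"
  shows "phi f = null_ideal f"
proof
  let ?S = "{module_M k r \<eta> | k r \<eta>. 1 \<le> k \<and> r \<in> {0, 1} \<and> enat k < f \<eta>} \<union>
      {P. \<exists>r\<in>{0, 1}. projective_cover P (simple_V r)}"
  note N = null_ideal_tensor_ideal[of f] null_ideal_additive[OF f]
  have S: "?S \<subseteq> null_ideal f"
    using module_M_in_null_ideal[OF f] projective_in_null_ideal[OF f] unfolding projective_cover_def by blast
  show "phi f \<subseteq> null_ideal f"
  proof
    fix Y assume "Y \<in> phi f"
    then obtain Xs where Y: "Y \<in> Rep" and Xs: "set Xs \<subseteq> ?S" "module_iso Y (direct_sum Xs)"
      unfolding phi_def additive_completion_def by blast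
    then have "direct_sum Xs \<in> null_ideal f"
      using N(2) S unfolding additive_ideal_def by (meson subset_trans)
    then show "Y \<in> null_ideal f"
      using N(1) Y iso_sym[OF Xs(2)] unfolding tensor_ideal_def subcategory_def by blast
  qed
  show "null_ideal f \<subseteq> phi f"
  proof
    fix X assume X: "X \<in> null_ideal f"
    then have R: "X \<in> Rep" by (simp add: null_ideal_def)
    obtain Xs where Xs: "set Xs \<subseteq> standard_modules" "module_iso X (direct_sum Xs)" "X \<in> null_ideal f \<longleftrightarrow> set Xs \<subseteq> null_ideal f"
      by (rule ideal_decomposition[OF N R null_ideal_no_trace[OF X]])
    have "Z \<in> ?S" if "Z \<in> set Xs" for Z
    proof -
      have "Z \<in> standard_modules" "Z \<in> null_ideal f" using that Xs X by auto
      then show ?thesis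
        using module_M_in_null_ideal[OF f] module_P_cover unfolding standard_modules_def by blast
    qed
    then show "X \<in> phi f"
      unfolding phi_def additive_completion_def using R Xs(2) by blast
  qed
qed

text \<open>Tensoring with V(1) on the left changes the signs of K, xi_1 and xi_2. Conjugation by K
  restores those of xi_1 and xi_2, so only the parity changes.\<close>

lemma module_M_twist:
  assumes "r \<in> {0, 1}"
  shows "module_iso (tensor_module (simple_V (Suc 0)) (module_M k r \<eta>)) (module_M k (1 - r) \<eta>)"
proof -
  note t = tensor_module[OF simple_V(1)[of "Suc 0"] module_M(1)[of k r \<eta>], unfolded simple_V module_M]
  note [simp] = Rep_act(1,2)[OF module_M(1)[of k r \<eta>], unfolded module_M]
  note rr = relations_rules[OF Rep_relations[OF module_M(1)[of k r \<eta>]], unfolded module_M]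
  have op: "op1 (module_M k (1 - r) \<eta>) = op1 (module_M k r \<eta>)" "op2 (module_M k (1 - r) \<eta>) = op2 (module_M k r \<eta>)"
    by (cases \<eta>; simp add: module_M_pencil pencil_module del: module_M.simps)+
  have K: "pencil_K k (1 - r) = (-1) \<cdot>\<^sub>m pencil_K k r"
    using assms by (auto simp: pencil_K_def mat_ring)
  show ?thesis
  proof (rule inverse_Hom[OF t(1) module_M(1), where S = "pencil_K k r" and T = "pencil_K k r"])
    show "pencil_K k r \<in> Hom (tensor_module (simple_V (Suc 0)) (module_M k r \<eta>)) (module_M k (1 - r) \<eta>)"
      by (rule HomI[OF t(1) module_M(1)])
        (simp_all add: t op[simplified] K[simplified] module_M kronecker_linear kronecker_one mat_ring rr del: module_M.simps)
  qed (simp_all add: t module_M rr del: module_M.simps)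
qed

lemma ideal_module_M_le:
  assumes I: "tensor_ideal I" "additive_ideal I" "proper I" and M: "module_M k r' \<eta> \<in> I"
    and j: "1 \<le> j" "j \<le> k" and r: "r \<in> {0, 1}"
  shows "module_M j r \<eta> \<in> I"
proof -
  let ?X = "tensor_module (module_M j 0 \<eta>) (module_M k r' \<eta>)"
  note R = tensor_module(1)[OF module_M(1) module_M(1), of j 0 \<eta> k r' \<eta>]
  have X: "?X \<in> I" using I(1) M module_M(1) unfolding tensor_ideal_def by blast
  then have nt: "\<not> has_trace ?X" using proper_ideal_trace[OF I(1,3)] unfolding has_trace_def by blast
  obtain Xs where Xs: "set Xs \<subseteq> standard_modules" "module_iso ?X (direct_sum Xs)" "?X \<in> I \<longleftrightarrow> set Xs \<subseteq> I"
    by (rule ideal_decomposition[OF I(1,2) R nt])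
  have XsR: "set Xs \<subseteq> Rep" using Xs(1) standard_modules_Rep by blast
  \<comment> \<open>The bound satisfied by the left factor: order j at \<eta> and order 0 elsewhere.
    It confines the summands to projectives and M_i(s, \<eta>) with i \<le> j.\<close>
  define f where "f \<eta>' = (if \<eta>' = \<eta> then enat (Suc j) else 1)" for \<eta>'
  have f: "\<forall>\<eta>'. 1 \<le> f \<eta>'" by (simp add: f_def one_enat_def)
  have f': "enat n < f \<eta>' \<longleftrightarrow> n \<le> (if \<eta>' = \<eta> then j else 0)" for n \<eta>'
    by (auto simp: f_def one_enat_def less_Suc_eq_le)
  have "module_M j 0 \<eta> \<in> null_ideal f"
    by (simp add: module_M_in_null_ideal[OF f] f' del: module_M.simps)
  then have "?X \<in> null_ideal f"
    unfolding null_ideal_def using null_tensor_left[OF module_M(1) module_M(1)] R by blast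
  then have "direct_sum Xs \<in> null_ideal f"
    using null_ideal_tensor_ideal[of f] direct_sum_Rep[OF XsR] Xs(2) unfolding tensor_ideal_def subcategory_def by blast
  then have Xs_null: "set Xs \<subseteq> null_ideal f"
    using direct_sum_iff[OF null_ideal_tensor_ideal null_ideal_additive[OF f] XsR] by blast
  have "\<exists>s\<in>{0, 1}. module_M j s \<eta> \<in> set Xs"
  proof (rule ccontr)
    assume no: "\<not> ?thesis"
    \<comment> \<open>One less at \<eta>. Without a summand of size j the tensor product would be
      null of order j - 1, contradicting \<open>tensor_MM_not_null\<close>.\<close>
    define g where "g \<eta>' = (if \<eta>' = \<eta> then enat j else 1)" for \<eta>'
    have g: "\<forall>\<eta>'. 1 \<le> g \<eta>'" using j by (simp add: g_def one_enat_def)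
    have g': "enat n < g \<eta>' \<longleftrightarrow> n \<le> (if \<eta>' = \<eta> then j - 1 else 0)" for n \<eta>'
      using j by (auto simp: g_def one_enat_def)
    have "Z \<in> null_ideal g" if Z: "Z \<in> set Xs" for Z
    proof -
      have "Z \<in> standard_modules" using Z Xs(1) by blast
      then consider "Z = module_P 0 \<or> Z = module_P 1" | i s \<eta>' where "Z = module_M i s \<eta>'" "1 \<le> i" "s \<in> {0, 1}"
        unfolding standard_modules_def by blast
      then show ?thesis
      proof cases
        case 1
        then show ?thesis using projective_in_null_ideal[OF g module_P_projective] by blast
      next
        case 2
        have "enat i < f \<eta>'" using Xs_null Z 2(1) module_M_in_null_ideal[OF f] by blast
        then have "\<eta>' = \<eta>" "i \<le> j" using 2(2) by (auto simp: f' split: if_splits)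
        moreover have "i \<noteq> j" using no Z 2 \<open>\<eta>' = \<eta>\<close> by blast
        ultimately show ?thesis
          unfolding 2(1) module_M_in_null_ideal[OF g] by (simp add: g')
      qed
    qed
    then have "direct_sum Xs \<in> null_ideal g"
      using null_ideal_additive[OF g] unfolding additive_ideal_def by blast
    then have "?X \<in> null_ideal g"
      using null_ideal_tensor_ideal[of g] R iso_sym[OF Xs(2)] unfolding tensor_ideal_def subcategory_def by blast
    then obtain n where "n \<le> j - 1" "null_at \<eta> n ?X"
      unfolding null_ideal_def g' by (auto dest: spec[of _ \<eta>])
    then show False using tensor_MM_not_null[of n j k] j by auto
  qed
  then obtain s where s: "s \<in> {0, 1}" "module_M j s \<eta> \<in> I" using Xs(3) X by blast
  have "module_M j (1 - s) \<eta> \<in> I"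
  proof -
    have "tensor_module (simple_V (Suc 0)) (module_M j s \<eta>) \<in> I"
      using I(1) s(2) simple_V(1) unfolding tensor_ideal_def by blast
    then show ?thesis
      using I(1) module_M_twist[OF s(1)] module_M(1) unfolding tensor_ideal_def subcategory_def by blast
  qed
  moreover have "r = s \<or> r = 1 - s" using r s(1) by auto
  ultimately show ?thesis using s(2) by blast
qed

lemma ideal_null_ideal:
  assumes I: "tensor_ideal I" "additive_ideal I" "proper I" "nonzero I"
  obtains f where "\<forall>\<eta>. 1 \<le> f \<eta>" "I = null_ideal f"
proof -
  \<comment> \<open>Including 0 gives f the value 1 at points where the ideal contains no M_k. With
    \<open>Suc\<close> in the supremum, k < f(\<eta>) means that some member of
    \<open>S \<eta>\<close> is at least k, also when the supremum is infinite.\<close>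
  define S where "S \<eta> = {k. k = 0 \<or> 1 \<le> k \<and> module_M k 0 \<eta> \<in> I}" for \<eta>
  define f where "f \<eta> = (SUP k\<in>S \<eta>. enat (Suc k))" for \<eta>
  have f: "\<forall>\<eta>. 1 \<le> f \<eta>"
  proof
    fix \<eta>
    have "enat (Suc 0) \<le> f \<eta>" unfolding f_def by (rule SUP_upper) (simp add: S_def)
    then show "1 \<le> f \<eta>" by (simp add: one_enat_def)
  qed
  have M: "module_M k r \<eta> \<in> I \<longleftrightarrow> module_M k r \<eta> \<in> null_ideal f" if k: "1 \<le> k" and r: "r \<in> {0, 1}" for k r \<eta>
  proof -
    have "enat k < f \<eta> \<longleftrightarrow> (\<exists>l\<in>S \<eta>. k \<le> l)"
      unfolding f_def by (simp add: less_SUP_iff less_Suc_eq_le)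
    also have "\<dots> \<longleftrightarrow> module_M k r \<eta> \<in> I"
    proof
      assume "\<exists>l\<in>S \<eta>. k \<le> l"
      then obtain l where "k \<le> l" "module_M l 0 \<eta> \<in> I" using k by (auto simp: S_def simp del: module_M.simps)
      then show "module_M k r \<eta> \<in> I" using ideal_module_M_le[OF I(1-3)] k r by blast
    next
      assume "module_M k r \<eta> \<in> I"
      then have "module_M k 0 \<eta> \<in> I" using ideal_module_M_le[OF I(1-3) _ k order_refl] by blast
      then show "\<exists>l\<in>S \<eta>. k \<le> l" using k unfolding S_def by blast
    qed
    finally show ?thesis using module_M_in_null_ideal[OF f] by blast
  qed
  have P: "module_P r \<in> I" "module_P r \<in> null_ideal f" for r
    using projective_in_ideal[OF I(1) _ _ module_P_projective] I(4) projective_in_null_ideal[OF f module_P_projective]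
    unfolding nonzero_def by blast+
  have nt: "\<not> has_trace X" if "X \<in> I" for X
    using proper_ideal_trace[OF I(1,3) that] unfolding has_trace_def by blast
  note N = null_ideal_tensor_ideal[of f] null_ideal_additive[OF f]
  have "I \<inter> standard_modules \<subseteq> null_ideal f" "null_ideal f \<inter> standard_modules \<subseteq> I"
    using M P unfolding standard_modules_def by blast+
  then have "I = null_ideal f"
    using ideal_subset[OF I(1,2) nt N] ideal_subset[OF N null_ideal_no_trace[of _ f] I(1,2)] by blast
  then show ?thesis using that f by blast
qed

lemma enat_eqI:
  fixes a b :: enat
  assumes "1 \<le> a" "1 \<le> b" "\<And>k. 1 \<le> k \<Longrightarrow> enat k < a \<longleftrightarrow> enat k < b"
  shows "a = b"
proof -
  have le: "a \<le> b" if "1 \<le> b" "\<And>k. 1 \<le> k \<Longrightarrow> enat k < a \<longleftrightarrow> enat k < b" for a b :: enat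
  proof (rule ccontr)
    assume "\<not> a \<le> b"
    then obtain m where m: "b = enat m" "enat m < a" by (cases b) auto
    then have "1 \<le> m" using that(1) by (simp add: one_enat_def)
    then show False using that(2)[of m] m by simp
  qed
  show ?thesis using le[of b a] le[of a b] assms by (metis order_antisym)
qed

theorem theorem5p3:
  shows "bij_betw phi {f :: cp1 \<Rightarrow> enat. \<forall>\<eta>. 1 \<le> f \<eta>}
           {I. tensor_ideal I \<and> additive_ideal I \<and> proper I \<and> nonzero I}"
proof (rule bij_betw_imageI)
  show "inj_on phi {f. \<forall>\<eta>. 1 \<le> f \<eta>}"
  proof (rule inj_onI, rule ext)
    fix f g :: "cp1 \<Rightarrow> enat" and \<eta>
    assume "f \<in> {f. \<forall>\<eta>. 1 \<le> f \<eta>}" "g \<in> {f. \<forall>\<eta>. 1 \<le> f \<eta>}" and eq: "phi f = phi g"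
    then have fg: "\<forall>\<eta>. 1 \<le> f \<eta>" "\<forall>\<eta>. 1 \<le> g \<eta>" by auto
    have "null_ideal f = null_ideal g" using eq phi_null_ideal[OF fg(1)] phi_null_ideal[OF fg(2)] by simp
    then have "enat k < f \<eta> \<longleftrightarrow> enat k < g \<eta>" for k
      using module_M_in_null_ideal[OF fg(1), of k 0 \<eta>] module_M_in_null_ideal[OF fg(2), of k 0 \<eta>] by simp
    then show "f \<eta> = g \<eta>" by (intro enat_eqI fg[rule_format])
  qed
  show "phi ` {f. \<forall>\<eta>. 1 \<le> f \<eta>} = {I. tensor_ideal I \<and> additive_ideal I \<and> proper I \<and> nonzero I}"
  proof (intro equalityI subsetI)
    fix I assume "I \<in> phi ` {f. \<forall>\<eta>. 1 \<le> f \<eta>}"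
    then obtain f where f: "\<forall>\<eta>. 1 \<le> f \<eta>" and "I = phi f" by auto
    then have "I = null_ideal f" using phi_null_ideal by simp
    then show "I \<in> {I. tensor_ideal I \<and> additive_ideal I \<and> proper I \<and> nonzero I}"
      using null_ideal_tensor_ideal null_ideal_additive[OF f] null_ideal_proper null_ideal_nonzero[OF f] by simp
  next
    fix I assume "I \<in> {I. tensor_ideal I \<and> additive_ideal I \<and> proper I \<and> nonzero I}"
    then obtain f where f: "\<forall>\<eta>. 1 \<le> f \<eta>" "I = null_ideal f" using ideal_null_ideal by blast
    then have "I = phi f" using phi_null_ideal by simp
    then show "I \<in> phi ` {f. \<forall>\<eta>. 1 \<le> f \<eta>}" using f(1) by blast
  qed
qed

end
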